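(* Let $\mathbf{A}\in\mathbb{R}^{m\times n}$ with $m\ge n$, let $k,s,p$ be the parameters of Algorithm 2 (described in the context), let $l=k+s$ with $l\le n-k$, and let $\mathbf{Q}\in\mathbb{R}^{m\times l}$ be the orthonormal matrix obtained by Algorithm 2 after its power-iteration loop. Let $j<k$ be a positive integer, and let $\beta,\gamma>1$ be real numbers such that $$\phi=\frac{1}{\sqrt{2\pi(l-j+1)}}\left(\frac{e}{(l-j+1)\beta}\right)^{l-j+1}+\frac{1}{4\gamma(\gamma^2-1)}\left(\frac{1}{\sqrt{\pi(n-k)}}\left(\frac{2\gamma^2}{e^{\gamma^2-1}}\right)^{n-k}+\frac{1}{\sqrt{\pi l}}\left(\frac{2\gamma^2}{e^{\gamma^2-1}}\right)^{l}\right)\le 1 .$$ Then, with probability not less than $1-\phi$, $$\|\mathbf{Q}\mathbf{Q}^{\mathrm{T}}\mathbf{A}-\mathbf{A}\|\le 2\sqrt{\left(2l^2\beta^2\gamma^2\prod_{c=1}^{p}\left(\frac{\sigma_{j+1}^2-\alpha_c}{\sigma_j^2-\alpha_c}\right)^{2}+1\right)\sigma_{j+1}^2+\left(2l(n-k)\beta^2\gamma^2\prod_{c=1}^{p}\left(\frac{\sigma_{k+1}^2-\alpha_c}{\sigma_j^2-\alpha_c}\right)^{2}+1\right)\sigma_{k+1}^2},$$ where $\alpha_c$ is the shift value used in the $c$-th shifted power iteration of Algorithm 2 and $\sigma_t$ denotes the $t$-th largest singular value of $\mathbf{A}$.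
   Context: $\|\cdot\|$ denotes the spectral norm. Algorithm 2 (randomized SVD with dynamic shifts), analyzed in exact arithmetic, takes $\mathbf{A}\in\mathbb{R}^{m\times n}$ and integers $k,s,p$ and does: set $l=k+s$ and let $\mathbf{\Omega}\in\mathbb{R}^{n\times l}$ have i.i.d. standard Gaussian entries; set $\mathbf{Q}=\mathrm{orth}(\mathbf{A}\mathbf{\Omega})$ (an $m\times l$ matrix whose orthonormal columns span the column space of $\mathbf{A}\mathbf{\Omega}$) and $\alpha=0$; then for $c=1,\dots,p$: compute the economic SVD $\mathbf{A}\mathbf{A}^{\mathrm{T}}\mathbf{Q}-\alpha\mathbf{Q}=\mathbf{Q}'\hat{\mathbf{S}}\mathbf{W}^{\mathrm{T}}$ (singular values on the diagonal of $\hat{\mathbf{S}}$ in decreasing order) and replace $\mathbf{Q}$ by the $m\times l$ matrix $\mathbf{Q}'$ of left singular vectors; then, if $\hat{\mathbf{S}}(l,l)>\alpha$, replace $\alpha$ by $(\hat{\mathbf{S}}(l,l)+\alpha)/2$. The value $\alpha_c$ is the value of $\alpha$ used in the matrix $\mathbf{A}\mathbf{A}^{\mathrm{T}}\mathbf{Q}-\alpha\mathbf{Q}$ at iteration $c$ (so $\alpha_1=0$). The probability is over the Gaussian matrix $\mathbf{\Omega}$. *)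

theory Defs
  imports "HOL-Probability.Probability" "Jordan_Normal_Form.Matrix"
begin

definition vnorm :: "real vec \<Rightarrow> real" where
  "vnorm x = sqrt (x \<bullet> x)"

definition spec_norm :: "real mat \<Rightarrow> real" where
  "spec_norm B = Sup {vnorm (B *\<^sub>v x) | x. x \<in> carrier_vec (dim_col B) \<and> vnorm x = 1}"

definition col_space :: "real mat \<Rightarrow> real vec set" where
  "col_space B = {B *\<^sub>v x | x. x \<in> carrier_vec (dim_col B)}"

definition econ_svd :: "real mat \<Rightarrow> real mat \<Rightarrow> real mat \<Rightarrow> real mat \<Rightarrow> bool" where
  "econ_svd B U S W \<longleftrightarrow>
     (let r = dim_row B; c = dim_col B in
      U \<in> carrier_mat r c \<and> transpose_mat U * U = 1\<^sub>m c \<and>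
      S \<in> carrier_mat c c \<and> (\<forall>i<c. \<forall>j<c. i \<noteq> j \<longrightarrow> S $$ (i, j) = 0) \<and>
      (\<forall>i<c. 0 \<le> S $$ (i, i)) \<and> (\<forall>i j. i \<le> j \<longrightarrow> j < c \<longrightarrow> S $$ (j, j) \<le> S $$ (i, i)) \<and>
      W \<in> carrier_mat c c \<and> transpose_mat W * W = 1\<^sub>m c \<and>
      B = U * S * transpose_mat W)"

(* the t-th largest singular value (t >= 1) of a matrix B with dim_row B >= dim_col B *)
definition sing_val :: "real mat \<Rightarrow> nat \<Rightarrow> real" where
  "sing_val B t = (THE xs. \<exists>U S W. econ_svd B U S W \<and>
                      xs = map (\<lambda>i. S $$ (i, i)) [0..<dim_col B]) ! (t - 1)"

(* A run of Algorithm 2 on A with parameters k s p and Gaussian matrix Om, in exact arithmetic.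
   Q 0 = orth(A Om); for c = 1..p: Q c is the left factor of an economic SVD of
   A A^T Q(c-1) - alpha c * Q(c-1) with singular value matrix Sh c; alpha 1 = 0 and
   alpha (c+1) is the updated shift.  The output matrix is Q p. *)
definition alg2_run :: "real mat \<Rightarrow> nat \<Rightarrow> nat \<Rightarrow> nat \<Rightarrow> real mat \<Rightarrow>
     (nat \<Rightarrow> real mat) \<Rightarrow> (nat \<Rightarrow> real) \<Rightarrow> (nat \<Rightarrow> real mat) \<Rightarrow> (nat \<Rightarrow> real mat) \<Rightarrow> bool" where
  "alg2_run A k s p Om Q alpha Sh W \<longleftrightarrow>
     (let l = k + s in
      Q 0 \<in> carrier_mat (dim_row A) l \<and> transpose_mat (Q 0) * Q 0 = 1\<^sub>m l \<and>
      col_space (Q 0) = col_space (A * Om) \<and>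
      alpha 1 = 0 \<and>
      (\<forall>c\<in>{1..p}.
         econ_svd (A * transpose_mat A * Q (c - 1) - alpha c \<cdot>\<^sub>m Q (c - 1)) (Q c) (Sh c) (W c) \<and>
         alpha (c + 1) = (if Sh c $$ (l - 1, l - 1) > alpha c
                          then (Sh c $$ (l - 1, l - 1) + alpha c) / 2 else alpha c)))"

end

theory Submission
  imports Defs "HOL-Real_Asymp.Real_Asymp" "Jordan_Normal_Form.Char_Poly"
begin

text \<open>Write \<open>A = U \<Sigma> V\<^sup>T\<close> and \<open>G = V\<^sup>T \<Omega>\<close>, again a Gaussian matrix, with row blocks \<open>G\<^sub>1\<close> (the first j rows),
  \<open>G\<^sub>2\<close> (up to row k) and \<open>G\<^sub>3\<close>. The range of the output contains \<open>U f(\<Sigma>) \<Sigma> G h\<close> for every h, where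
  \<open>f(\<sigma>) = \<Prod>c. (\<sigma>\<^sup>2 - \<alpha>\<^sub>c)\<close>. For a unit vector x choose h so that the first j coordinates of A x are matched
  exactly; this costs at most the operator norms of \<open>G\<^sub>2 G\<^sub>1\<^sup>+\<close> and \<open>G\<^sub>3 G\<^sub>1\<^sup>+\<close> times the ratios of the filter values.
  Both norms are bounded with probability at least one minus the first summand of \<open>\<phi>\<close>: for a fixed
  right-hand side w the vector \<open>G\<^sub>1\<^sup>+ w\<close> is controlled by the reciprocal norm of a Gaussian vector in
  l - j + 1 dimensions, and averaging over a Gaussian w gives the operator norm. On the deterministic
  side the shifts never exceed half of the l-th squared singular value, which makes the filter monotone
  on the leading indices.\<close>

text \<open>The obstacle is the budget of constants. Bounding \<open>G\<^sub>2\<close> and the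
  pseudoinverse of \<open>G\<^sub>1\<close> separately would cost a failure probability for each
  factor, so products are treated jointly: given the first j rows, a product applied to a fixed
  vector is Gaussian, and only the small-ball probability of one vector in d = l - j + 1 dimensions
  enters. This produces the power d in the first summand of \<phi>. Squaring the claimed bound puts
  a factor 4 in front of its constants 2. So 8 l^2 is available for the middle block. For the tail
  block 8 l (n - k) is split into 16/3 times 3/2, where 3/2 absorbs the loss that occurs when the
  shifts exceed half of \<open>(\<sigma> k)\<^sup>2\<close> (indices start at 0) and the filter is
  not largest at k among the tail. With this split the two failure probabilities add up to at most
  27 pi / (32 e) times the first summand, and that factor is just below 1.\<close>

no_notation vec_nth (infixl "$" 90)

section \<open>Standard Gaussian families\<close>

abbreviation std_normal :: "real measure" where
  "std_normal \<equiv> std_normal_distribution"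

text \<open>A density proportional to \<open>1 + Re (u e\<^bsup>i t Y k\<^esup>)\<close> with |u| = 1 tilts M to a probability measure under
  which the coordinates in K have the same characteristic function, so the induction hypothesis
  applies to it as well.\<close>

lemma indicator_iexp_integral:
  fixes Y :: "'k \<Rightarrow> 'a \<Rightarrow> real"
  assumes "prob_space M" and K: "finite K" "k \<notin> K"
    and Ym: "\<And>i. i \<in> insert k K \<Longrightarrow> Y i \<in> borel_measurable M"
    and ch: "\<And>\<theta>. (CLINT \<omega>|M. iexp (\<Sum>i\<in>insert k K. \<theta> i * Y i \<omega>))
               = (\<Prod>i\<in>insert k K. complex_of_real (exp (- (\<theta> i)\<^sup>2 / 2)))"
    and B: "B \<in> sets M"
    and IH: "\<And>M'. prob_space M' \<Longrightarrow> sets M' = sets M \<Longrightarrow>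
       (\<And>\<theta>. (CLINT \<omega>|M'. iexp (\<Sum>i\<in>K. \<theta> i * Y i \<omega>))
               = (\<Prod>i\<in>K. complex_of_real (exp (- (\<theta> i)\<^sup>2 / 2)))) \<Longrightarrow> measure M' B = b"
  shows "(CLINT \<omega>|M. indicator B \<omega> * iexp (t * Y k \<omega>)) = b * exp (- t\<^sup>2 / 2)"
proof -
  interpret prob_space M by fact
  have Ykm[measurable]: "Y k \<in> borel_measurable M" using Ym by auto
  have Yim: "Y i \<in> borel_measurable M" if "i \<in> K" for i using Ym that by auto
  have [measurable]: "B \<in> sets M" by fact
  let ?e = "exp (- t\<^sup>2 / 2)"
  have split: "(CLINT \<omega>|M. iexp (\<Sum>i\<in>K. \<theta> i * Y i \<omega>) * iexp (r * Y k \<omega>))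
      = (\<Prod>i\<in>K. complex_of_real (exp (- (\<theta> i)\<^sup>2 / 2))) * exp (- r\<^sup>2 / 2)" for \<theta> r
  proof -
    have 1: "(\<Sum>i\<in>K. (\<theta>(k := r)) i * Y i \<omega>) = (\<Sum>i\<in>K. \<theta> i * Y i \<omega>)" for \<omega>
      using K by (intro sum.cong) auto
    have 2: "(\<Prod>i\<in>K. complex_of_real (exp (- ((\<theta>(k := r)) i)\<^sup>2 / 2))) =
        (\<Prod>i\<in>K. complex_of_real (exp (- (\<theta> i)\<^sup>2 / 2)))"
      using K by (intro prod.cong) auto
    have 3: "iexp (\<Sum>i\<in>K. \<theta> i * Y i \<omega>) * iexp (r * Y k \<omega>)
        = iexp (\<Sum>i\<in>insert k K. (\<theta>(k := r)) i * Y i \<omega>)" for \<omega>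
      using K unfolding sum.insert[OF K] 1 by (simp add: exp_add[symmetric] algebra_simps)
    show ?thesis
      unfolding 3 ch prod.insert[OF K] 2 by (simp add: mult.commute)
  qed
  have Sm[measurable]: "(\<lambda>\<omega>. \<Sum>i\<in>K. \<theta> i * Y i \<omega>) \<in> borel_measurable M" for \<theta>
    using Yim by (intro borel_measurable_sum borel_measurable_times) auto
  have int: "integrable M (\<lambda>\<omega>. iexp (\<Sum>i\<in>K. \<theta> i * Y i \<omega>) * iexp (r * Y k \<omega>))" for \<theta> r
    by (rule integrable_const_bound[of _ 1], simp add: norm_mult, measurable)
  have int0: "integrable M (\<lambda>\<omega>. iexp (\<Sum>i\<in>K. \<theta> i * Y i \<omega>))" for \<theta>
    by (rule integrable_const_bound[of _ 1], simp, measurable)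
  have ch0: "(CLINT \<omega>|M. iexp (\<Sum>i\<in>K. \<theta> i * Y i \<omega>))
      = (\<Prod>i\<in>K. complex_of_real (exp (- (\<theta> i)\<^sup>2 / 2)))" for \<theta>
    using split[of \<theta> 0] by simp
  have b: "measure M B = b"
    by (rule IH) (use ch0 in \<open>auto intro: prob_space_axioms\<close>)
  \<comment> \<open>Two choices of the unimodular u are needed later: u = 1 turns the tilt into a
    cosine, u = - i into a sine. The normalising constant 1 + Re u * exp (- t^2 / 2) is positive for
    both.\<close>
  have tilt: "(LINT \<omega>|M. indicator B \<omega> * Re (u * iexp (t * Y k \<omega>))) = b * (Re u * ?e)"
    if u: "norm u = 1" and m: "1 + Re u * ?e > 0" for u
  proof -
    define m where "m = 1 + Re u * ?e"
    have mp: "m > 0" using m by (simp add: m_def)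
    define f where "f \<omega> = (1 + Re (u * iexp (t * Y k \<omega>))) / m" for \<omega>
    have [measurable]: "f \<in> borel_measurable M"
      unfolding f_def by measurable
    have norm1: "norm (u * iexp (t * Y k \<omega>)) = 1" for \<omega> using u by (simp add: norm_mult)
    have Re1: "\<bar>Re (u * iexp (t * Y k \<omega>))\<bar> \<le> 1" for \<omega>
      using abs_Re_le_cmod norm1 by metis
    have f0: "f \<omega> \<ge> 0" for \<omega>
      using Re1[of \<omega>] mp unfolding f_def by (intro divide_nonneg_pos) auto
    have f2: "\<bar>f \<omega>\<bar> \<le> 2 / m" for \<omega>
      using Re1[of \<omega>] mp f0[of \<omega>]
      by (simp only: abs_of_nonneg) (simp add: f_def divide_right_mono)
    have cf: "complex_of_real (f \<omega>) = (1 + (u * iexp (t * Y k \<omega>) + cnj u * iexp ((-t) * Y k \<omega>)) / 2) / m" for \<omega>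
    proof -
      have "complex_of_real (Re (u * iexp (t * Y k \<omega>)))
          = (u * iexp (t * Y k \<omega>) + cnj (u * iexp (t * Y k \<omega>))) / 2"
        unfolding complex_add_cnj by simp
      also have "cnj (u * iexp (t * Y k \<omega>)) = cnj u * iexp ((-t) * Y k \<omega>)"
        by (simp add: exp_cnj)
      finally show ?thesis unfolding f_def by simp
    qed
    have intf: "(CLINT \<omega>|M. f \<omega> *\<^sub>R iexp (\<Sum>i\<in>K. \<theta> i * Y i \<omega>))
        = (\<Prod>i\<in>K. complex_of_real (exp (- (\<theta> i)\<^sup>2 / 2)))" for \<theta>
    proof -
      let ?E = "\<lambda>\<omega>. iexp (\<Sum>i\<in>K. \<theta> i * Y i \<omega>)"
      let ?P = "\<Prod>i\<in>K. complex_of_real (exp (- (\<theta> i)\<^sup>2 / 2))"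
      have "(CLINT \<omega>|M. f \<omega> *\<^sub>R ?E \<omega>) =
         (CLINT \<omega>|M. (?E \<omega> + (u * (?E \<omega> * iexp (t * Y k \<omega>)) + cnj u * (?E \<omega> * iexp ((-t) * Y k \<omega>))) / 2) / m)"
        by (rule Bochner_Integration.integral_cong) (simp_all add: scaleR_conv_of_real cf field_simps)
      also have "\<dots> = (?P + (u * (?P * ?e) + cnj u * (?P * ?e)) / 2) / m"
        using int0[of \<theta>] int[of \<theta> t] int[of \<theta> "-t"] split[of \<theta> t] split[of \<theta> "-t"] ch0[of \<theta>] by simp
      also have "\<dots> = ?P * (1 + complex_of_real (Re u * ?e)) / m"
      proof -
        have "(u * (?P * ?e) + cnj u * (?P * ?e)) = (u + cnj u) * (?P * ?e)"
          by (simp only: distrib_right)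
        also have "\<dots> = 2 * (?P * complex_of_real (Re u * ?e))"
          unfolding complex_add_cnj by simp
        finally show ?thesis by (simp add: distrib_left)
      qed
      also have "1 + complex_of_real (Re u * ?e) = complex_of_real m" by (simp add: m_def)
      also have "?P * complex_of_real m / complex_of_real m = ?P" using mp by simp
      finally show ?thesis .
    qed
    let ?M' = "density M (\<lambda>\<omega>. ennreal (f \<omega>))"
    have fint: "integrable M f"
      by (rule integrable_const_bound[of _ "2 / m"]) (use f2 in auto)
    have "complex_of_real (LINT \<omega>|M. f \<omega>) = 1"
      using intf[of "\<lambda>_. 0"] by (simp add: scaleR_conv_of_real)
    hence fi: "(LINT \<omega>|M. f \<omega>) = 1" by simp
    have pM': "prob_space ?M'"
    proof (rule prob_spaceI)
      have "emeasure ?M' (space ?M') = (\<integral>\<^sup>+ \<omega>. ennreal (f \<omega>) \<partial>M)"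
        by (subst emeasure_density) (auto intro!: nn_integral_cong)
      also have "\<dots> = 1" using fint f0 fi by (subst nn_integral_eq_integral) auto
      finally show "emeasure ?M' (space ?M') = 1" .
    qed
    interpret M': prob_space ?M' by fact
    have "measure ?M' B = b"
    proof (rule IH[OF pM'])
      fix \<theta>
      show "(CLINT \<omega>|?M'. iexp (\<Sum>i\<in>K. \<theta> i * Y i \<omega>)) = (\<Prod>i\<in>K. complex_of_real (exp (- (\<theta> i)\<^sup>2 / 2)))"
        by (subst integral_density, measurable) (use f0 intf in auto)
    qed simp
    moreover have "measure ?M' B = (LINT \<omega>|?M'. indicator B \<omega>)" by simp
    moreover have "\<dots> = (LINT \<omega>|M. f \<omega> *\<^sub>R indicator B \<omega>)"
      by (subst integral_density) (use f0 in auto)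
    moreover have "\<dots> = (LINT \<omega>|M. (indicator B \<omega> + indicator B \<omega> * Re (u * iexp (t * Y k \<omega>))) / m)"
      by (rule Bochner_Integration.integral_cong) (auto simp: f_def field_simps)
    moreover have "\<dots> = (b + (LINT \<omega>|M. indicator B \<omega> * Re (u * iexp (t * Y k \<omega>)))) / m"
    proof -
      have "integrable M (\<lambda>\<omega>. indicator B \<omega> * Re (u * iexp (t * Y k \<omega>)))"
      proof (rule integrable_const_bound[of _ 1])
        show "AE \<omega> in M. norm (indicator B \<omega> * Re (u * iexp (t * Y k \<omega>))) \<le> 1"
          using Re1 by (auto simp: indicator_def)
      qed measurable
      moreover have "integrable M (indicat_real B)"
        by (intro integrable_const_bound[of _ 1]) (auto simp: indicator_def)
      ultimately show ?thesis using b
        by (subst integral_divide_zero, subst Bochner_Integration.integral_add) simp_all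
    qed
    \<comment> \<open>The tilted measure gives B the same mass b; solving this equation yields the
      integral against B.\<close>
    ultimately have "b = (b + (LINT \<omega>|M. indicator B \<omega> * Re (u * iexp (t * Y k \<omega>)))) / m"
      by (simp only:)
    hence "b * m = b + (LINT \<omega>|M. indicator B \<omega> * Re (u * iexp (t * Y k \<omega>)))"
      using mp by (metis nonzero_eq_divide_eq less_irrefl)
    thus ?thesis by (simp add: m_def distrib_left)
  qed
  have c: "(LINT \<omega>|M. indicator B \<omega> * cos (t * Y k \<omega>)) = b * ?e"
    using tilt[of 1] by (simp add: Re_exp add_pos_pos)
  have s: "(LINT \<omega>|M. indicator B \<omega> * sin (t * Y k \<omega>)) = 0"
    using tilt[of "- \<i>"] by (simp add: Im_exp)
  have ii: "integrable M (\<lambda>\<omega>. indicator B \<omega> * iexp (t * Y k \<omega>))"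
    by (rule integrable_const_bound[of _ 1], simp add: norm_mult indicator_def, measurable)
  show ?thesis
  proof (rule complex_eqI)
    have "Re (CLINT \<omega>|M. indicator B \<omega> * iexp (t * Y k \<omega>)) = (LINT \<omega>|M. Re (indicator B \<omega> * iexp (t * Y k \<omega>)))"
      by (rule integral_Re[OF ii, symmetric])
    also have "\<dots> = (LINT \<omega>|M. indicator B \<omega> * cos (t * Y k \<omega>))"
      by (rule Bochner_Integration.integral_cong) (auto simp: indicator_def Re_exp)
    finally show "Re (CLINT \<omega>|M. indicator B \<omega> * iexp (t * Y k \<omega>)) = Re (complex_of_real (b * ?e))"
      using c by simp
    have "Im (CLINT \<omega>|M. indicator B \<omega> * iexp (t * Y k \<omega>)) = (LINT \<omega>|M. Im (indicator B \<omega> * iexp (t * Y k \<omega>)))"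
      by (rule integral_Im[OF ii, symmetric])
    also have "\<dots> = (LINT \<omega>|M. indicator B \<omega> * sin (t * Y k \<omega>))"
      by (rule Bochner_Integration.integral_cong) (auto simp: indicator_def Im_exp)
    finally show "Im (CLINT \<omega>|M. indicator B \<omega> * iexp (t * Y k \<omega>)) = Im (complex_of_real (b * ?e))"
      using s by simp
  qed
qed

text \<open>Lifts the one-dimensional Levy uniqueness theorem to finite families. The measure is
  generalised in the induction because the hypothesis for K is applied to the tilted measures of
  \<open>indicator_iexp_integral\<close>, not only to M.\<close>

lemma normal_box_probability:
  fixes Y :: "'k \<Rightarrow> 'a \<Rightarrow> real"
  assumes "finite K" "prob_space M"
    and "\<And>i. i \<in> K \<Longrightarrow> Y i \<in> borel_measurable M"
    and "\<And>\<theta>. (CLINT \<omega>|M. iexp (\<Sum>i\<in>K. \<theta> i * Y i \<omega>))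
               = (\<Prod>i\<in>K. complex_of_real (exp (- (\<theta> i)\<^sup>2 / 2)))"
    and "\<And>i. i \<in> K \<Longrightarrow> A i \<in> sets borel"
  shows "measure M {\<omega> \<in> space M. \<forall>i\<in>K. Y i \<omega> \<in> A i} = (\<Prod>i\<in>K. measure std_normal (A i))"
  using assms
proof (induction K arbitrary: M rule: finite_induct)
  case empty
  thus ?case by (simp add: prob_space.prob_space)
next
  case (insert k K)
  interpret prob_space M by fact
  have Ykm[measurable]: "Y k \<in> borel_measurable M" using insert.prems(2) by auto
  define B where "B = {\<omega> \<in> space M. \<forall>i\<in>K. Y i \<omega> \<in> A i}"
  define b where "b = (\<Prod>i\<in>K. measure std_normal (A i))"
  have B[measurable]: "B \<in> sets M"
    unfolding B_def using insert.hyps(1) insert.prems(2,4) by measurable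
  have IH: "measure M' B = b" if "prob_space M'" "sets M' = sets M"
       "\<And>\<theta>. (CLINT \<omega>|M'. iexp (\<Sum>i\<in>K. \<theta> i * Y i \<omega>))
               = (\<Prod>i\<in>K. complex_of_real (exp (- (\<theta> i)\<^sup>2 / 2)))" for M'
  proof -
    have "measure M' {\<omega> \<in> space M'. \<forall>i\<in>K. Y i \<omega> \<in> A i} = b" unfolding b_def
      by (rule insert.IH) (use that insert.prems measurable_cong_sets[OF that(2) refl, of borel] in auto)
    thus ?thesis using sets_eq_imp_space_eq[OF that(2)] by (simp add: B_def)
  qed
  have key: "(CLINT \<omega>|M. indicator B \<omega> * iexp (t * Y k \<omega>)) = b * exp (- t\<^sup>2 / 2)" for t
    by (rule indicator_iexp_integral[OF insert.prems(1) insert.hyps insert.prems(2) insert.prems(3) B IH])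
  have "complex_of_real (measure M B) = (CLINT \<omega>|M. complex_of_real (indicator B \<omega>))"
    by (subst integral_complex_of_real) simp
  also have "\<dots> = b" using key[of 0] by (simp add: of_real_indicator)
  finally have bB: "measure M B = b" by simp
  have b0: "b \<ge> 0" by (simp add: b_def prod_nonneg)
  let ?C = "{\<omega> \<in> space M. Y k \<omega> \<in> A k}"
  have Am[measurable]: "A k \<in> sets borel" using insert.prems by auto
  have Cm[measurable]: "?C \<in> sets M" by measurable
  have goal_eq: "{\<omega> \<in> space M. \<forall>i\<in>insert k K. Y i \<omega> \<in> A i} = B \<inter> ?C" by (auto simp: B_def)
  have "measure M (B \<inter> ?C) = b * measure std_normal (A k)"
  proof (cases "b = 0")
    case True
    have "measure M (B \<inter> ?C) \<le> measure M B" by (rule finite_measure_mono) auto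
    thus ?thesis using True bB measure_nonneg[of M "B \<inter> ?C"] by simp
  next
    case False
    hence bp: "b > 0" using b0 by simp
    \<comment> \<open>Density of M conditioned on B. By \<open>key\<close>, the characteristic
      function of \<open>Y k\<close> under it is the standard normal one.\<close>
    define f where "f \<omega> = indicator B \<omega> / b" for \<omega>
    have f0: "f \<omega> \<ge> 0" for \<omega> using bp by (simp add: f_def)
    have [measurable]: "f \<in> borel_measurable M" unfolding f_def by measurable
    let ?M' = "density M (\<lambda>\<omega>. ennreal (f \<omega>))"
    have pM': "prob_space ?M'"
    proof (rule prob_spaceI)
      have "emeasure ?M' (space ?M') = (\<integral>\<^sup>+ \<omega>. ennreal (f \<omega>) \<partial>M)"
        by (subst emeasure_density) (auto intro!: nn_integral_cong)
      also have "\<dots> = ennreal (LINT \<omega>|M. f \<omega>)"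
        using bp by (intro nn_integral_eq_integral integrable_const_bound[of _ "1 / b"])
          (auto simp: f_def indicator_def)
      also have "(LINT \<omega>|M. f \<omega>) = 1" using bp bB by (simp add: f_def)
      finally show "emeasure ?M' (space ?M') = 1" by simp
    qed
    interpret M': prob_space ?M' by fact
    have rd: "real_distribution (distr ?M' borel (Y k))"
      by (rule M'.real_distribution_distr) simp
    have "char (distr ?M' borel (Y k)) = char std_normal"
    proof
      fix t
      have "char (distr ?M' borel (Y k)) t = (CLINT \<omega>|M. f \<omega> *\<^sub>R iexp (t * Y k \<omega>))"
        unfolding char_def by (subst integral_distr, simp, simp, subst integral_density) (use f0 in auto)
      also have "\<dots> = (CLINT \<omega>|M. indicator B \<omega> * iexp (t * Y k \<omega>) / b)"
        by (rule Bochner_Integration.integral_cong) (auto simp: f_def indicator_def scaleR_conv_of_real)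
      also have "\<dots> = exp (- t\<^sup>2 / 2)" using key[of t] bp by simp
      finally show "char (distr ?M' borel (Y k)) t = char std_normal t"
        by (simp add: char_std_normal_distribution)
    qed
    hence "distr ?M' borel (Y k) = std_normal"
      by (intro Levy_uniqueness rd real_dist_normal_dist)
    hence "measure std_normal (A k) = measure (distr ?M' borel (Y k)) (A k)" by simp
    also have "\<dots> = measure ?M' ?C"
      by (subst measure_distr) (auto intro!: arg_cong[where f="measure _"])
    also have "\<dots> = (LINT \<omega>|?M'. indicator ?C \<omega>)"
      using sets.Int_space_eq2[OF Cm] by (simp add: Int_def conj_commute)
    also have "\<dots> = (LINT \<omega>|M. f \<omega> *\<^sub>R indicator ?C \<omega>)"
      by (subst integral_density) (use f0 in auto)
    also have "\<dots> = (LINT \<omega>|M. indicator (B \<inter> ?C) \<omega> / b)"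
      by (rule Bochner_Integration.integral_cong) (auto simp: f_def indicator_def)
    also have "\<dots> = measure M (B \<inter> ?C) / b" by simp
    finally show ?thesis using bp by (simp add: field_simps)
  qed
  thus ?case unfolding goal_eq b_def using insert.hyps by (simp add: mult.commute)
qed

text \<open>Stated as an equality of joint laws rather than as independence with prescribed
  marginals, so that an integral over the family transfers to the product space in one step.\<close>

definition gauss :: "'a measure \<Rightarrow> 'i set \<Rightarrow> ('i \<Rightarrow> 'a \<Rightarrow> real) \<Rightarrow> bool" where
  "gauss M I Y \<longleftrightarrow> (\<forall>i\<in>I. Y i \<in> borel_measurable M) \<and>
     distr M (\<Pi>\<^sub>M i\<in>I. borel) (\<lambda>\<omega>. \<lambda>i\<in>I. Y i \<omega>) = (\<Pi>\<^sub>M i\<in>I. std_normal)"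

lemma prob_space_std_normal: "prob_space std_normal"
  by (rule prob_space_normal_density) simp

interpretation std_normal: prob_space std_normal
  by (rule prob_space_std_normal)

interpretation std_normal_PiM: product_prob_space "\<lambda>_. std_normal" I for I
  by unfold_locales

lemma sets_PiM_std_normal [measurable_cong]: "sets (\<Pi>\<^sub>M i\<in>I. std_normal) = sets (\<Pi>\<^sub>M i\<in>I. borel)"
  by (intro sets_PiM_cong) auto

lemma space_PiM_std_normal: "space (\<Pi>\<^sub>M i\<in>I. std_normal) = extensional I"
  by (simp add: space_PiM PiE_def)

lemma gauss_measurable: "gauss M I Y \<Longrightarrow> i \<in> I \<Longrightarrow> Y i \<in> borel_measurable M"
  by (auto simp: gauss_def)

lemma gauss_restrict_measurable:
  "gauss M I Y \<Longrightarrow> (\<lambda>\<omega>. \<lambda>i\<in>I. Y i \<omega>) \<in> measurable M (\<Pi>\<^sub>M i\<in>I. borel)"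
  by (intro measurable_restrict) (auto simp: gauss_def)

lemma gaussI:
  fixes Y :: "'k \<Rightarrow> 'a \<Rightarrow> real"
  assumes "finite K" "prob_space M"
    and Ym: "\<And>i. i \<in> K \<Longrightarrow> Y i \<in> borel_measurable M"
    and ch: "\<And>\<theta>. (CLINT \<omega>|M. iexp (\<Sum>i\<in>K. \<theta> i * Y i \<omega>))
               = (\<Prod>i\<in>K. complex_of_real (exp (- (\<theta> i)\<^sup>2 / 2)))"
  shows "gauss M K Y"
  unfolding gauss_def
proof (intro conjI ballI Ym)
  interpret prob_space M by fact
  have m: "(\<lambda>\<omega>. \<lambda>i\<in>K. Y i \<omega>) \<in> measurable M (\<Pi>\<^sub>M i\<in>K. borel)"
    by (intro measurable_restrict Ym)
  show "distr M (\<Pi>\<^sub>M i\<in>K. borel) (\<lambda>\<omega>. \<lambda>i\<in>K. Y i \<omega>) = (\<Pi>\<^sub>M i\<in>K. std_normal)"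
  proof (rule std_normal_PiM.PiM_eqI)
    fix A :: "'k \<Rightarrow> real set" assume A: "\<And>i. i \<in> K \<Longrightarrow> A i \<in> sets std_normal"
    have A': "Pi\<^sub>E K A \<in> sets (\<Pi>\<^sub>M i\<in>K. borel)" using A assms(1) by (intro sets_PiM_I_finite) auto
    have "emeasure (distr M (\<Pi>\<^sub>M i\<in>K. borel) (\<lambda>\<omega>. \<lambda>i\<in>K. Y i \<omega>)) (Pi\<^sub>E K A)
       = emeasure M {\<omega> \<in> space M. \<forall>i\<in>K. Y i \<omega> \<in> A i}"
      using m A' by (subst emeasure_distr) (auto intro!: arg_cong[where f="emeasure M"] simp: PiE_iff)
    also have "\<dots> = ennreal (\<Prod>i\<in>K. measure std_normal (A i))"
      unfolding emeasure_eq_measure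
      using normal_box_probability[OF assms, where A=A] A by simp
    finally show "emeasure (distr M (\<Pi>\<^sub>M i\<in>K. borel) (\<lambda>\<omega>. \<lambda>i\<in>K. Y i \<omega>)) (Pi\<^sub>E K A)
       = (\<Prod>i\<in>K. emeasure std_normal (A i))"
      by (simp add: std_normal.emeasure_eq_measure prod_ennreal)
  qed (simp_all add: assms sets_PiM_std_normal)
qed

lemma gauss_nn_integral:
  assumes "gauss M I Y" "f \<in> borel_measurable (\<Pi>\<^sub>M i\<in>I. borel)"
  shows "(\<integral>\<^sup>+\<omega>. f (\<lambda>i\<in>I. Y i \<omega>) \<partial>M) = (\<integral>\<^sup>+x. f x \<partial>(\<Pi>\<^sub>M i\<in>I. std_normal))"
  using assms gauss_restrict_measurable[OF assms(1)] nn_integral_distr[of "\<lambda>\<omega>. \<lambda>i\<in>I. Y i \<omega>" M "\<Pi>\<^sub>M i\<in>I. borel" f]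
  by (simp add: gauss_def)

lemma gauss_char:
  fixes Y :: "'k \<Rightarrow> 'a \<Rightarrow> real"
  assumes g: "gauss M K Y" and K: "finite K"
  shows "(CLINT \<omega>|M. iexp (\<Sum>i\<in>K. \<theta> i * Y i \<omega>)) = (\<Prod>i\<in>K. complex_of_real (exp (- (\<theta> i)\<^sup>2 / 2)))"
proof -
  let ?f = "\<lambda>x. iexp (\<Sum>i\<in>K. \<theta> i * x i)"
  have fm: "?f \<in> borel_measurable (\<Pi>\<^sub>M i\<in>K. borel)" by measurable
  have "(CLINT \<omega>|M. iexp (\<Sum>i\<in>K. \<theta> i * Y i \<omega>)) = (CLINT \<omega>|M. ?f (\<lambda>i\<in>K. Y i \<omega>))"
    by simp
  also have "\<dots> = (CLINT x|(\<Pi>\<^sub>M i\<in>K. std_normal). ?f x)"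
    using g integral_distr[OF gauss_restrict_measurable[OF g] fm] by (simp add: gauss_def)
  also have "\<dots> = (CLINT x|(\<Pi>\<^sub>M i\<in>K. std_normal). (\<Prod>i\<in>K. iexp (\<theta> i * x i)))"
    by (rule Bochner_Integration.integral_cong) (simp_all add: sum_distrib_left exp_sum K)
  also have "\<dots> = (\<Prod>i\<in>K. CLINT y|std_normal. iexp (\<theta> i * y))"
  proof (rule std_normal_PiM.product_integral_prod[OF K])
    fix i
    show "complex_integrable std_normal (\<lambda>y. iexp (\<theta> i * y))"
      by (rule std_normal.integrable_const_bound[of _ 1], simp, measurable)
  qed
  also have "\<dots> = (\<Prod>i\<in>K. complex_of_real (exp (- (\<theta> i)\<^sup>2 / 2)))"
    using fun_cong[OF char_std_normal_distribution] by (simp add: char_def)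
  finally show ?thesis .
qed

text \<open>The characteristic function of the new family at \<theta> is that of Y at the
  combination of the rows c with coefficients \<theta>, and orthonormal rows preserve the Euclidean
  norm. I may be smaller than R, so projections are covered as well as rotations.\<close>

lemma gauss_rotate:
  fixes Y :: "'k \<Rightarrow> 'a \<Rightarrow> real"
  assumes "prob_space M" and g: "gauss M R Y" and R: "finite R" and I: "finite I"
    and orth: "\<And>a b. a \<in> I \<Longrightarrow> b \<in> I \<Longrightarrow> (\<Sum>r\<in>R. c a r * c b r) = (if a = b then 1 else 0)"
  shows "gauss M I (\<lambda>i \<omega>. \<Sum>r\<in>R. c i r * Y r \<omega>)"
proof (rule gaussI[OF I assms(1)])
  show "(\<lambda>\<omega>. \<Sum>r\<in>R. c i r * Y r \<omega>) \<in> borel_measurable M" for i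
    using gauss_measurable[OF g] by (intro borel_measurable_sum borel_measurable_times) auto
  fix \<theta>
  have "(\<Sum>i\<in>I. \<theta> i * (\<Sum>r\<in>R. c i r * Y r \<omega>)) = (\<Sum>r\<in>R. (\<Sum>i\<in>I. \<theta> i * c i r) * Y r \<omega>)" for \<omega>
    unfolding sum_distrib_left sum_distrib_right by (subst sum.swap) (simp add: mult.assoc)
  hence "(CLINT \<omega>|M. iexp (\<Sum>i\<in>I. \<theta> i * (\<Sum>r\<in>R. c i r * Y r \<omega>)))
      = (\<Prod>r\<in>R. complex_of_real (exp (- (\<Sum>i\<in>I. \<theta> i * c i r)\<^sup>2 / 2)))"
    using gauss_char[OF g R, of "\<lambda>r. \<Sum>i\<in>I. \<theta> i * c i r"] by simp
  also have "\<dots> = complex_of_real (exp (\<Sum>r\<in>R. - (\<Sum>i\<in>I. \<theta> i * c i r)\<^sup>2 / 2))"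
    by (simp add: exp_sum R)
  also have "(\<Sum>r\<in>R. - (\<Sum>i\<in>I. \<theta> i * c i r)\<^sup>2 / 2) = - (\<Sum>r\<in>R. (\<Sum>i\<in>I. \<theta> i * c i r)\<^sup>2) / 2"
    by (simp add: sum_negf sum_divide_distrib)
  also have "(\<Sum>r\<in>R. (\<Sum>i\<in>I. \<theta> i * c i r)\<^sup>2) = (\<Sum>i\<in>I. (\<theta> i)\<^sup>2)"
  proof -
    have "(\<Sum>r\<in>R. (\<Sum>i\<in>I. \<theta> i * c i r)\<^sup>2) = (\<Sum>r\<in>R. \<Sum>a\<in>I. \<Sum>b\<in>I. \<theta> a * \<theta> b * (c a r * c b r))"
      by (simp add: power2_eq_square sum_product mult_ac)
    also have "\<dots> = (\<Sum>a\<in>I. \<Sum>b\<in>I. \<theta> a * \<theta> b * (\<Sum>r\<in>R. c a r * c b r))"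
      unfolding sum_distrib_left by (subst sum.swap, rule sum.cong, simp, subst sum.swap, simp)
    also have "\<dots> = (\<Sum>a\<in>I. \<Sum>b\<in>I. if a = b then \<theta> a * \<theta> b else 0)"
      by (intro sum.cong refl) (simp add: orth)
    also have "\<dots> = (\<Sum>i\<in>I. (\<theta> i)\<^sup>2)" using I by (simp add: power2_eq_square)
    finally show ?thesis .
  qed
  also have "- (\<Sum>i\<in>I. (\<theta> i)\<^sup>2) / 2 = (\<Sum>i\<in>I. - (\<theta> i)\<^sup>2 / 2)"
    by (simp add: sum_negf sum_divide_distrib)
  also have "complex_of_real (exp \<dots>) = (\<Prod>i\<in>I. complex_of_real (exp (- (\<theta> i)\<^sup>2 / 2)))"
    by (simp add: exp_sum I)
  finally show "(CLINT \<omega>|M. iexp (\<Sum>i\<in>I. \<theta> i * (\<Sum>r\<in>R. c i r * Y r \<omega>))) = \<dots>" .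
qed

lemma gauss_PiM: "gauss (\<Pi>\<^sub>M i\<in>I. std_normal) I (\<lambda>i x. x i)"
proof -
  have "distr (\<Pi>\<^sub>M i\<in>I. std_normal) (\<Pi>\<^sub>M i\<in>I. borel) (\<lambda>\<omega>. \<lambda>i\<in>I. \<omega> i)
      = distr (\<Pi>\<^sub>M i\<in>I. std_normal) (\<Pi>\<^sub>M i\<in>I. borel) (\<lambda>x. x)"
    by (rule distr_cong) (auto simp: space_PiM_std_normal extensional_restrict)
  also have "\<dots> = (\<Pi>\<^sub>M i\<in>I. std_normal)"
    by (rule distr_id2) (simp add: sets_PiM_std_normal)
  finally show ?thesis unfolding gauss_def by (auto intro: measurable_component_singleton)
qed

lemma gauss_indep_vars:
  assumes "prob_space M" and I: "finite I" "I \<noteq> {}"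
    and ind: "prob_space.indep_vars M (\<lambda>_. borel) X I"
    and dist: "\<And>i. i \<in> I \<Longrightarrow> distributed M lborel (X i) (\<lambda>x. ennreal (std_normal_density x))"
  shows "gauss M I X"
proof -
  interpret prob_space M by fact
  have Xm: "X i \<in> borel_measurable M" if "i \<in> I" for i
    using dist[OF that] by (auto simp: distributed_def)
  have "distr M (\<Pi>\<^sub>M i\<in>I. borel) (\<lambda>x. \<lambda>i\<in>I. X i x) = (\<Pi>\<^sub>M i\<in>I. distr M borel (X i))"
    using indep_vars_iff_distr_eq_PiM'[OF I(2), where X=X and M'="\<lambda>_. borel"] Xm ind by auto
  also have "\<dots> = (\<Pi>\<^sub>M i\<in>I. std_normal)"
  proof (rule PiM_cong[OF refl])
    fix i assume "i \<in> I"
    have "distr M borel (X i) = distr M lborel (X i)" by (rule distr_cong) auto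
    thus "distr M borel (X i) = std_normal" using dist[OF \<open>i \<in> I\<close>] by (simp add: distributed_def)
  qed
  finally show ?thesis using Xm by (simp add: gauss_def)
qed

section \<open>Density and small-ball probabilities of the Gaussian product measure\<close>

lemma prod_std_normal_density_measurable:
  "(\<lambda>x. \<Prod>i\<in>I. ennreal (std_normal_density (x i))) \<in> borel_measurable (\<Pi>\<^sub>M i\<in>I. lborel)"
proof -
  have "(\<lambda>x. ennreal (\<Prod>i\<in>I. std_normal_density (x i))) \<in> borel_measurable (\<Pi>\<^sub>M i\<in>I. lborel)"
    by measurable
  thus ?thesis by (simp add: prod_ennreal)
qed

lemma PiM_std_normal_density:
  assumes "finite I"
  shows "(\<Pi>\<^sub>M i\<in>I. std_normal) =
    density (\<Pi>\<^sub>M i\<in>I. lborel) (\<lambda>x. \<Prod>i\<in>I. ennreal (std_normal_density (x i)))"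
proof (rule std_normal_PiM.PiM_eqI[symmetric, OF assms])
  interpret L: product_sigma_finite "\<lambda>_. lborel :: real measure" by standard
  show "sets (density (\<Pi>\<^sub>M i\<in>I. lborel) (\<lambda>x. \<Prod>i\<in>I. ennreal (std_normal_density (x i)))) = sets (\<Pi>\<^sub>M i\<in>I. std_normal)"
    by (auto simp: sets_PiM_std_normal intro!: sets_PiM_cong)
  fix A :: "'a \<Rightarrow> real set" assume A: "\<And>i. i \<in> I \<Longrightarrow> A i \<in> sets std_normal"
  have A': "Pi\<^sub>E I A \<in> sets (\<Pi>\<^sub>M i\<in>I. lborel)" using A assms by (intro sets_PiM_I_finite) auto
  have "emeasure (density (\<Pi>\<^sub>M i\<in>I. lborel) (\<lambda>x. \<Prod>i\<in>I. ennreal (std_normal_density (x i)))) (Pi\<^sub>E I A)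
     = (\<integral>\<^sup>+x. (\<Prod>i\<in>I. ennreal (std_normal_density (x i))) * indicator (Pi\<^sub>E I A) x \<partial>(\<Pi>\<^sub>M i\<in>I. lborel))"
    by (rule emeasure_density[OF prod_std_normal_density_measurable A'])
  also have "\<dots> = (\<integral>\<^sup>+x. (\<Prod>i\<in>I. ennreal (std_normal_density (x i)) * indicator (A i) (x i)) \<partial>(\<Pi>\<^sub>M i\<in>I. lborel))"
  proof (rule nn_integral_cong)
    fix x assume "x \<in> space (\<Pi>\<^sub>M i\<in>I. lborel :: real measure)"
    hence "indicator (Pi\<^sub>E I A) x = (\<Prod>i\<in>I. indicator (A i) (x i) :: ennreal)"
      using assms by (auto simp: space_PiM PiE_iff indicator_def prod_zero_iff)
    thus "(\<Prod>i\<in>I. ennreal (std_normal_density (x i))) * indicator (Pi\<^sub>E I A) x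
       = (\<Prod>i\<in>I. ennreal (std_normal_density (x i)) * indicator (A i) (x i))"
      by (simp add: prod.distrib)
  qed
  also have "\<dots> = (\<Prod>i\<in>I. \<integral>\<^sup>+y. ennreal (std_normal_density y) * indicator (A i) y \<partial>lborel)"
    using A by (intro L.product_nn_integral_prod assms) auto
  also have "\<dots> = (\<Prod>i\<in>I. emeasure std_normal (A i))"
    using A by (intro prod.cong refl) (simp add: emeasure_density)
  finally show "emeasure (density (\<Pi>\<^sub>M i\<in>I. lborel) (\<lambda>x. \<Prod>i\<in>I. ennreal (std_normal_density (x i)))) (Pi\<^sub>E I A)
     = (\<Prod>i\<in>I. emeasure std_normal (A i))" .
qed

text \<open>The volume of the unit ball times the peak value of the d-dimensional standard normal
  density.\<close>

definition ball_const :: "nat \<Rightarrow> real" where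
  "ball_const d = unit_ball_vol (real d) / sqrt (2 * pi) ^ d"

lemma ball_const_nonneg: "ball_const d \<ge> 0"
  by (simp add: ball_const_def)

text \<open>The density is at most its value at the origin, so the mass of a ball is at most that
  value times the Lebesgue volume.\<close>

lemma gauss_small_ball:
  assumes I: "finite I" and t: "t \<ge> 0" and ne: "I \<noteq> {}"
  shows "emeasure (\<Pi>\<^sub>M i\<in>I. std_normal) {x \<in> space (\<Pi>\<^sub>M i\<in>I. std_normal). (\<Sum>i\<in>I. (x i)\<^sup>2) \<le> t\<^sup>2}
     \<le> ennreal (ball_const (card I) * t ^ card I)"
proof -
  let ?L = "\<Pi>\<^sub>M i\<in>I. (lborel :: real measure)"
  have sp: "space (\<Pi>\<^sub>M i\<in>I. std_normal) = space ?L" by (simp add: space_PiM)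
  have pos: "emeasure (\<Pi>\<^sub>M i\<in>I. std_normal) {x \<in> space (\<Pi>\<^sub>M i\<in>I. std_normal). (\<Sum>i\<in>I. (x i)\<^sup>2) \<le> t\<^sup>2}
     \<le> ennreal (ball_const (card I) * t ^ card I)" if t: "t > 0" for t
  proof -
    let ?B = "{x \<in> space ?L. (\<Sum>i\<in>I. (x i)\<^sup>2) \<le> t\<^sup>2}"
    have B: "?B = {f. sqrt (\<Sum>i\<in>I. (f i)\<^sup>2) \<le> t} \<inter> space ?L"
      using t by (auto simp: real_sqrt_le_iff real_le_lsqrt sum_nonneg intro: real_le_lsqrt dest: sqrt_le_D)
    have Bm: "?B \<in> sets ?L" by measurable
    have dens: "std_normal_density y \<le> 1 / sqrt (2 * pi)" for y
      unfolding std_normal_density_def by (simp add: divide_right_mono)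
    have "emeasure (\<Pi>\<^sub>M i\<in>I. std_normal) ?B
       = (\<integral>\<^sup>+x. (\<Prod>i\<in>I. ennreal (std_normal_density (x i))) * indicator ?B x \<partial>?L)"
      unfolding PiM_std_normal_density[OF I]
      by (rule emeasure_density[OF prod_std_normal_density_measurable Bm])
    also have "\<dots> \<le> (\<integral>\<^sup>+x. ennreal ((1 / sqrt (2 * pi)) ^ card I) * indicator ?B x \<partial>?L)"
    proof (intro nn_integral_mono mult_right_mono)
      fix x
      have "(\<Prod>i\<in>I. ennreal (std_normal_density (x i))) = ennreal (\<Prod>i\<in>I. std_normal_density (x i))"
        by (intro prod_ennreal) simp
      also have "\<dots> \<le> ennreal (\<Prod>i\<in>I. 1 / sqrt (2 * pi))"
        using dens by (intro ennreal_leI prod_mono) auto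
      finally show "(\<Prod>i\<in>I. ennreal (std_normal_density (x i))) \<le> ennreal ((1 / sqrt (2 * pi)) ^ card I)"
        by simp
    qed simp
    also have "\<dots> = ennreal ((1 / sqrt (2 * pi)) ^ card I) * emeasure ?L ?B"
      using Bm by (intro nn_integral_cmult_indicator) auto
    also have "emeasure ?L ?B = ennreal (unit_ball_vol (real (card I)) * t ^ card I)"
      unfolding B by (rule emeasure_cball_aux[OF I t])
    also have "ennreal ((1 / sqrt (2 * pi)) ^ card I) * \<dots> = ennreal (ball_const (card I) * t ^ card I)"
      using t by (subst ennreal_mult[symmetric]) (auto simp: ball_const_def field_simps)
    finally show ?thesis unfolding sp .
  qed
  show ?thesis
  proof (cases "t = 0")
    case False
    thus ?thesis using pos t by simp
  next
    case True
    \<comment> \<open>The volume formula needs a positive radius; radius 0 is reached as the limit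
      of the radii 1 / (n + 1).\<close>
    let ?P = "\<lambda>t. {x \<in> space (\<Pi>\<^sub>M i\<in>I. std_normal). (\<Sum>i\<in>I. (x i)\<^sup>2) \<le> t\<^sup>2}"
    have c: "card I > 0" using I ne by (simp add: card_gt_0_iff)
    have "emeasure (\<Pi>\<^sub>M i\<in>I. std_normal) (?P 0) \<le> ennreal (ball_const (card I) * (1 / Suc n) ^ card I)" for n
    proof -
      have "emeasure (\<Pi>\<^sub>M i\<in>I. std_normal) (?P 0) \<le> emeasure (\<Pi>\<^sub>M i\<in>I. std_normal) (?P (1 / Suc n))"
      proof (rule emeasure_mono)
        show "?P 0 \<subseteq> ?P (1 / Suc n)"
          by (auto intro: order_trans[of _ 0])
        show "?P (1 / Suc n) \<in> sets (\<Pi>\<^sub>M i\<in>I. std_normal)" by measurable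
      qed
      also have "\<dots> \<le> ennreal (ball_const (card I) * (1 / Suc n) ^ card I)" by (rule pos) simp
      finally show ?thesis .
    qed
    moreover have "(\<lambda>n. ennreal (ball_const (card I) * (1 / Suc n) ^ card I)) \<longlonglongrightarrow> ennreal (ball_const (card I) * 0 ^ card I)"
      by (intro tendsto_ennrealI tendsto_mult tendsto_const tendsto_power) (rule LIMSEQ_Suc[OF lim_1_over_n])
    ultimately have "emeasure (\<Pi>\<^sub>M i\<in>I. std_normal) (?P 0) \<le> ennreal (ball_const (card I) * 0 ^ card I)"
      by (intro LIMSEQ_le_const) auto
    thus ?thesis using True by simp
  qed
qed

section \<open>Moments and small-ball constants\<close>

text \<open>The value is (2 r - 1)!!, written as a rising factorial at 1 / 2 so that several
  coordinates can be combined by the Vandermonde identity.\<close>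

lemma std_normal_even_moment:
  "(\<integral>\<^sup>+y. ennreal ((y\<^sup>2) ^ r) \<partial>std_normal) = ennreal (2 ^ r * pochhammer (1 / 2) r)"
proof -
  have "(\<integral>\<^sup>+y. ennreal ((y\<^sup>2) ^ r) \<partial>std_normal)
      = (\<integral>\<^sup>+y. ennreal (std_normal_density y * y ^ (2 * r)) \<partial>lborel)"
    by (subst nn_integral_density) (auto simp: ennreal_mult' power_mult[symmetric] mult.commute)
  also have "\<dots> = ennreal (fact (2 * r) / (2 ^ r * fact r))"
    using std_normal_moment_even[of r]
    by (intro nn_integral_eq_integral[THEN trans])
       (auto simp: has_bochner_integral_iff)
  also have "fact (2 * r) / (2 ^ r * fact r) = (2 ^ r * pochhammer (1 / 2) r :: real)"
  proof -
    have "(2::real) ^ (2 * r) = 2 ^ r * 2 ^ r" by (simp add: mult_2 power_add)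
    thus ?thesis by (simp add: fact_double)
  qed
  finally show ?thesis .
qed

lemma pochhammer_ge_0: "x \<ge> 0 \<Longrightarrow> pochhammer (x :: real) n \<ge> 0"
  by (simp add: pochhammer_prod prod_nonneg)

lemma prob_space_PiM_std_normal: "prob_space (\<Pi>\<^sub>M i\<in>I. std_normal)"
  by (intro prob_space_PiM prob_space_std_normal)

text \<open>Moments of the chi-squared law. Adding a coordinate expands the power binomially; by the
  Vandermonde identity for rising factorials (\<open>pochhammer_binomial_sum\<close>) the parameter
  just grows by 1 / 2.\<close>

lemma gauss_even_moment:
  assumes "finite I"
  shows "(\<integral>\<^sup>+x. ennreal ((\<Sum>i\<in>I. (x i)\<^sup>2) ^ q) \<partial>(\<Pi>\<^sub>M i\<in>I. std_normal))
     = ennreal (2 ^ q * pochhammer (real (card I) / 2) q)"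
  using assms
proof (induction I arbitrary: q rule: finite_induct)
  case empty
  show ?case
    by (cases q) (simp_all add: std_normal_PiM.nn_integral_empty pochhammer_0_left
        prob_space.emeasure_space_1[OF prob_space_PiM_std_normal])
next
  case (insert i I)
  have upd: "(\<Sum>a\<in>insert i I. ((x(i := y)) a)\<^sup>2) = y\<^sup>2 + (\<Sum>a\<in>I. (x a)\<^sup>2)" for x y
  proof -
    have "(\<Sum>a\<in>I. ((x(i := y)) a)\<^sup>2) = (\<Sum>a\<in>I. (x a)\<^sup>2)"
      using insert.hyps by (intro sum.cong) auto
    thus ?thesis using insert.hyps by simp
  qed
  let ?S = "\<lambda>x. \<Sum>a\<in>I. (x a)\<^sup>2 :: real"
  have "(\<integral>\<^sup>+x. ennreal ((\<Sum>a\<in>insert i I. (x a)\<^sup>2) ^ q) \<partial>(\<Pi>\<^sub>M a\<in>insert i I. std_normal))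
     = (\<integral>\<^sup>+x. (\<integral>\<^sup>+y. ennreal ((y\<^sup>2 + ?S x) ^ q) \<partial>std_normal) \<partial>(\<Pi>\<^sub>M a\<in>I. std_normal))"
    by (subst std_normal_PiM.product_nn_integral_insert[OF insert.hyps]) (measurable, simp only: upd)
  also have "\<dots> = (\<integral>\<^sup>+x. (\<Sum>r\<le>q. ennreal (real (q choose r) * (2 ^ r * pochhammer (1 / 2) r)) * ennreal (?S x ^ (q - r))) \<partial>(\<Pi>\<^sub>M a\<in>I. std_normal))"
  proof (rule nn_integral_cong)
    fix x
    have S0: "?S x \<ge> 0" by (simp add: sum_nonneg)
    have "ennreal ((y\<^sup>2 + ?S x) ^ q) = (\<Sum>r\<le>q. ennreal (real (q choose r) * ?S x ^ (q - r)) * ennreal ((y\<^sup>2) ^ r))" for y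
    proof -
      have "(y\<^sup>2 + ?S x) ^ q = (\<Sum>r\<le>q. real (q choose r) * ?S x ^ (q - r) * (y\<^sup>2) ^ r)"
        by (subst binomial_ring) (simp add: mult_ac)
      also have "ennreal \<dots> = (\<Sum>r\<le>q. ennreal (real (q choose r) * ?S x ^ (q - r) * (y\<^sup>2) ^ r))"
        using S0 by (intro sum_ennreal[symmetric]) (auto intro!: mult_nonneg_nonneg)
      also have "\<dots> = (\<Sum>r\<le>q. ennreal (real (q choose r) * ?S x ^ (q - r)) * ennreal ((y\<^sup>2) ^ r))"
        using S0 by (intro sum.cong refl ennreal_mult) auto
      finally show ?thesis .
    qed
    hence "(\<integral>\<^sup>+y. ennreal ((y\<^sup>2 + ?S x) ^ q) \<partial>std_normal)
       = (\<Sum>r\<le>q. ennreal (real (q choose r) * ?S x ^ (q - r)) * (\<integral>\<^sup>+y. ennreal ((y\<^sup>2) ^ r) \<partial>std_normal))"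
      by (simp add: nn_integral_sum nn_integral_cmult)
    also have "\<dots> = (\<Sum>r\<le>q. ennreal (real (q choose r) * (2 ^ r * pochhammer (1 / 2) r)) * ennreal (?S x ^ (q - r)))"
      using S0 by (intro sum.cong refl)
        (simp add: std_normal_even_moment ennreal_mult'[symmetric] ennreal_mult[symmetric] pochhammer_ge_0 mult_ac)
    finally show "(\<integral>\<^sup>+y. ennreal ((y\<^sup>2 + ?S x) ^ q) \<partial>std_normal) = \<dots>" .
  qed
  also have "\<dots> = (\<Sum>r\<le>q. ennreal (real (q choose r) * (2 ^ r * pochhammer (1 / 2) r)) *
       (\<integral>\<^sup>+x. ennreal (?S x ^ (q - r)) \<partial>(\<Pi>\<^sub>M a\<in>I. std_normal)))"
    by (subst nn_integral_sum, measurable) (intro sum.cong refl nn_integral_cmult, measurable)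
  also have "\<dots> = (\<Sum>r\<le>q. ennreal (2 ^ q * (real (q choose r) * pochhammer (1 / 2) r * pochhammer (real (card I) / 2) (q - r))))"
  proof (intro sum.cong refl)
    fix r assume "r \<in> {..q}"
    hence "(2::real) ^ q = 2 ^ r * 2 ^ (q - r)" by (simp add: power_add[symmetric])
    thus "ennreal (real (q choose r) * (2 ^ r * pochhammer (1 / 2) r)) *
       (\<integral>\<^sup>+x. ennreal (?S x ^ (q - r)) \<partial>(\<Pi>\<^sub>M a\<in>I. std_normal))
       = ennreal (2 ^ q * (real (q choose r) * pochhammer (1 / 2) r * pochhammer (real (card I) / 2) (q - r)))"
      unfolding insert.IH by (subst ennreal_mult[symmetric]) (auto simp: pochhammer_ge_0 mult_ac)
  qed
  also have "\<dots> = ennreal (2 ^ q * pochhammer (1 / 2 + real (card I) / 2) q)"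
    by (subst sum_ennreal) (auto simp: pochhammer_ge_0 pochhammer_binomial_sum sum_distrib_left)
  also have "1 / 2 + real (card I) / 2 = real (card (insert i I)) / 2"
    using insert.hyps by (simp add: field_simps)
  finally show ?case .
qed

text \<open>AM-GM on pairs: the factors with indices i and q - 1 - i have the sum 2 (M + q - 1) for
  every i. Hence the product is squared and one copy is reindexed backwards.\<close>

lemma pochhammer_half_le:
  "2 ^ q * pochhammer (real M / 2) q \<le> (real M + real (q - 1)) ^ q"
proof -
  let ?f = "\<lambda>i. real M + 2 * real i"
  have eq: "2 ^ q * pochhammer (real M / 2) q = (\<Prod>i<q. ?f i)"
  proof -
    have "(\<Prod>i<q. ?f i) = (\<Prod>i<q. 2 * (real M / 2 + real i))"
      by (intro prod.cong refl) (simp add: field_simps)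
    also have "\<dots> = 2 ^ q * pochhammer (real M / 2) q"
      by (simp only: pochhammer_prod prod.distrib prod_constant card_lessThan atLeast0LessThan)
    finally show ?thesis by simp
  qed
  have "(\<Prod>i<q. ?f i)\<^sup>2 = (\<Prod>i<q. ?f i) * (\<Prod>i<q. ?f (q - Suc i))"
    unfolding power2_eq_square by (subst (2) prod.nat_diff_reindex[symmetric]) simp
  also have "\<dots> = (\<Prod>i<q. ?f i * ?f (q - Suc i))" by (simp add: prod.distrib)
  also have "\<dots> \<le> (\<Prod>i<q. (real M + real (q - 1))\<^sup>2)"
  proof (intro prod_mono conjI)
    fix i assume "i \<in> {..<q}"
    hence i: "real (q - Suc i) = real (q - 1) - real i" by (auto simp: of_nat_diff)
    have "?f i * ?f (q - Suc i) = (real M + real (q - 1))\<^sup>2 - (real (q - 1) - 2 * real i)\<^sup>2"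
      unfolding i by (simp add: power2_eq_square algebra_simps)
    thus "?f i * ?f (q - Suc i) \<le> (real M + real (q - 1))\<^sup>2" by simp
  qed simp
  also have "\<dots> = ((real M + real (q - 1)) ^ q)\<^sup>2"
    by (simp only: prod_constant card_lessThan power_mult[symmetric] mult.commute)
  finally have "(\<Prod>i<q. ?f i) \<le> (real M + real (q - 1)) ^ q"
    by (rule power2_le_imp_le) simp
  thus ?thesis using eq by simp
qed

text \<open>Young's inequality between consecutive powers; it serves to bound an odd moment by the
  next even one.\<close>

lemma young_nat:
  fixes t :: real assumes "t \<ge> 0"
  shows "real (Suc d) * t ^ d \<le> real d * t ^ Suc d + 1"
proof (induction d)
  case (Suc d)
  have "t ^ d * (t - 1)\<^sup>2 \<ge> 0" using assms by simp
  hence "real (Suc d) * (t ^ d * (t - 1)\<^sup>2) \<ge> 0" by simp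
  have "real (Suc d) * t ^ Suc (Suc d) + 1 - real (Suc (Suc d)) * t ^ Suc d
     = (real d * t ^ Suc d + 1 - real (Suc d) * t ^ d) + real (Suc d) * (t ^ d * (t - 1)\<^sup>2)"
    by (simp add: power2_eq_square algebra_simps)
  thus ?case using Suc.IH \<open>real (Suc d) * (t ^ d * (t - 1)\<^sup>2) \<ge> 0\<close> by linarith
qed simp

text \<open>Closed forms exist here for even moments of the norm. For odd d the moment of order d +
  1 is used through \<open>young_nat\<close>.\<close>

lemma gauss_norm_moment:
  assumes I: "finite I" "I \<noteq> {}" and d: "d \<ge> 1"
  shows "(\<integral>\<^sup>+x. ennreal (sqrt (\<Sum>i\<in>I. (x i)\<^sup>2) ^ d) \<partial>(\<Pi>\<^sub>M i\<in>I. std_normal))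
     \<le> ennreal (sqrt (real (card I) + (real d - 1) / 2) ^ d)"
proof -
  let ?P = "\<Pi>\<^sub>M i\<in>I. std_normal"
  let ?S = "\<lambda>x. \<Sum>i\<in>I. (x i)\<^sup>2 :: real"
  have S0: "?S x \<ge> 0" for x by (simp add: sum_nonneg)
  have M: "card I \<ge> 1" using I by (simp add: Suc_le_eq card_gt_0_iff)
  have even: "(\<integral>\<^sup>+x. ennreal (?S x ^ q) \<partial>?P) \<le> ennreal ((real (card I) + real (q - 1)) ^ q)" for q
    unfolding gauss_even_moment[OF I(1)] by (intro ennreal_leI pochhammer_half_le)
  show ?thesis
  proof (cases "even d")
    case True
    then obtain q where q: "d = 2 * q" by blast
    have "(\<integral>\<^sup>+x. ennreal (sqrt (?S x) ^ d) \<partial>?P) = (\<integral>\<^sup>+x. ennreal (?S x ^ q) \<partial>?P)"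
      using S0 by (simp add: q power_mult)
    also have "\<dots> \<le> ennreal ((real (card I) + real (q - 1)) ^ q)" by (rule even)
    also have "\<dots> \<le> ennreal ((real (card I) + (real d - 1) / 2) ^ q)"
      using d q by (intro ennreal_leI power_mono) auto
    also have "\<dots> = ennreal (sqrt (real (card I) + (real d - 1) / 2) ^ d)"
      using d M by (simp add: q power_mult)
    finally show ?thesis .
  next
    case False
    then obtain r where r: "d = 2 * r + 1" by (auto elim: oddE)
    \<comment> \<open>With this scale the bound for the moment of order d + 1 is a ^ (d + 1), so the
      two terms of Young's inequality add up to exactly a ^ d.\<close>
    define a where "a = sqrt (real (card I) + real r)"
    have a: "a > 0" "a\<^sup>2 = real (card I) + real r" using M by (auto simp: a_def)
    have "(\<integral>\<^sup>+x. ennreal (sqrt (?S x) ^ d) \<partial>?P)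
       \<le> (\<integral>\<^sup>+x. ennreal (real d / (a * (real d + 1))) * ennreal (?S x ^ Suc r) + ennreal (a ^ d / (real d + 1)) \<partial>?P)"
    proof (rule nn_integral_mono)
      fix x
      let ?y = "sqrt (?S x)"
      have y: "?y \<ge> 0" "?y ^ Suc d = ?S x ^ Suc r"
        using S0[of x] r power_mult[of "?y" 2 "Suc r"] by simp_all
      have "real (Suc d) * (?y / a) ^ d \<le> real d * (?y / a) ^ Suc d + 1"
        using a y by (intro young_nat) auto
      hence "(?y / a) ^ d \<le> (real d * (?y / a) ^ Suc d + 1) / (real d + 1)"
        by (simp add: pos_le_divide_eq mult.commute add.commute)
      hence "a ^ d * (?y / a) ^ d \<le> a ^ d * ((real d * (?y / a) ^ Suc d + 1) / (real d + 1))"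
        using a by (intro mult_left_mono) auto
      also have "a ^ d * (?y / a) ^ d = ?y ^ d" using a by (simp add: power_divide)
      also have "a ^ d * ((real d * (?y / a) ^ Suc d + 1) / (real d + 1))
          = real d / (a * (real d + 1)) * ?y ^ Suc d + a ^ d / (real d + 1)"
      proof -
        have e: "a ^ d * (?y / a) ^ Suc d = ?y ^ Suc d / a" using a by (simp add: power_divide)
        have "a ^ d * ((real d * (?y / a) ^ Suc d + 1) / (real d + 1))
            = (real d * (a ^ d * (?y / a) ^ Suc d) + a ^ d) / (real d + 1)"
          by (simp add: algebra_simps del: power_Suc)
        thus ?thesis unfolding e by (simp add: add_divide_distrib del: power_Suc)
      qed
      finally have "?y ^ d \<le> real d / (a * (real d + 1)) * ?y ^ Suc d + a ^ d / (real d + 1)" .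
      hence "ennreal (?y ^ d) \<le> ennreal (real d / (a * (real d + 1)) * ?S x ^ Suc r + a ^ d / (real d + 1))"
        unfolding y(2) by (rule ennreal_leI)
      also have "\<dots> = ennreal (real d / (a * (real d + 1))) * ennreal (?S x ^ Suc r) + ennreal (a ^ d / (real d + 1))"
        using a S0[of x] by (subst ennreal_plus, simp, simp, subst ennreal_mult) (simp_all del: power_Suc)
      finally show "ennreal (?y ^ d) \<le> \<dots>" .
    qed
    also have "\<dots> = ennreal (real d / (a * (real d + 1))) * (\<integral>\<^sup>+x. ennreal (?S x ^ Suc r) \<partial>?P) + ennreal (a ^ d / (real d + 1))"
      by (subst nn_integral_add, measurable, subst nn_integral_cmult, measurable)
         (simp add: std_normal_PiM.prob_space prob_space.emeasure_space_1[OF std_normal_PiM.prob_space_axioms] nn_integral_const)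
    also have "\<dots> \<le> ennreal (real d / (a * (real d + 1))) * ennreal ((a\<^sup>2) ^ Suc r) + ennreal (a ^ d / (real d + 1))"
      using even[of "Suc r"] a by (intro add_right_mono mult_left_mono) auto
    also have "\<dots> = ennreal (real d / (a * (real d + 1)) * (a\<^sup>2) ^ Suc r + a ^ d / (real d + 1))"
      using a by (subst ennreal_plus, simp, simp, subst ennreal_mult) (simp_all del: power_Suc)
    also have "real d / (a * (real d + 1)) * (a\<^sup>2) ^ Suc r + a ^ d / (real d + 1) = a ^ d"
    proof -
      have "(a\<^sup>2) ^ Suc r = a * a ^ d" 
        unfolding r power_mult[symmetric] by simp
      hence "real d / (a * (real d + 1)) * (a\<^sup>2) ^ Suc r + a ^ d / (real d + 1)
          = real d / (a * (real d + 1)) * (a * a ^ d) + a ^ d / (real d + 1)" by (simp only:)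
      also have "\<dots> = (real d * a ^ d + a ^ d) / (real d + 1)"
        using a(1) by (simp add: add_divide_distrib)
      also have "\<dots> = (real d + 1) * a ^ d / (real d + 1)" by (simp add: distrib_right)
      finally show ?thesis by (simp add: add_nonneg_eq_0_iff)
    qed
    also have "a = sqrt (real (card I) + (real d - 1) / 2)" by (simp add: a_def r)
    finally show ?thesis .
  qed
qed

text \<open>Mills ratio bound: F is a primitive of f, f lies below the normal density, and F
  vanishes at infinity, so each tail is at least - F s. The restriction s >= 1 makes f nonnegative
  on the range of integration.\<close>

lemma std_normal_tail_lower:
  assumes s: "s \<ge> 1"
  shows "ennreal (sqrt (2 / pi) * exp (- s\<^sup>2 / 2) * s / (s\<^sup>2 + 1)) \<le> emeasure std_normal {x. \<bar>x\<bar> \<ge> s}"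
proof -
  define F where "F x = - (x / (x\<^sup>2 + 1)) * std_normal_density x" for x :: real
  define f where "f x = (x ^ 4 + 2 * x\<^sup>2 - 1) / (x\<^sup>2 + 1)\<^sup>2 * std_normal_density x" for x :: real
  have p1: "x\<^sup>2 + 1 \<noteq> 0" for x :: real
    using zero_le_power2[of x] by linarith
  have der: "DERIV F x :> f x" for x
  proof -
    have d1: "DERIV (\<lambda>x. - (x / (x\<^sup>2 + 1))) x :> - ((1 * (x\<^sup>2 + 1) - x * (2 * x)) / ((x\<^sup>2 + 1) * (x\<^sup>2 + 1)))"
      using p1[of x] by (auto intro!: derivative_eq_intros)
    have d2: "DERIV std_normal_density x :> - x * std_normal_density x"
    proof -
      have "DERIV (\<lambda>x. exp (- x\<^sup>2 / 2)) x :> - x * exp (- x\<^sup>2 / 2)"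
        by (auto intro!: derivative_eq_intros)
      from DERIV_cmult[OF this, of "1 / sqrt (2 * pi)"] show ?thesis
        unfolding std_normal_density_def by (simp only: mult.left_commute)
    qed
    have r: "(x ^ 4 + 2 * x\<^sup>2 - 1) / (x\<^sup>2 + 1)\<^sup>2
        = - ((1 * (x\<^sup>2 + 1) - x * (2 * x)) / ((x\<^sup>2 + 1) * (x\<^sup>2 + 1))) + x * (x / (x\<^sup>2 + 1))"
      using p1[of x] by (simp add: divide_simps) (simp add: algebra_simps power2_eq_square power4_eq_xxxx)
    have "f x = - ((1 * (x\<^sup>2 + 1) - x * (2 * x)) / ((x\<^sup>2 + 1) * (x\<^sup>2 + 1))) * std_normal_density x
        + - x * std_normal_density x * - (x / (x\<^sup>2 + 1))"
      unfolding f_def r by (simp only: distrib_right) (simp only: mult_ac minus_mult_minus)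
    thus ?thesis unfolding F_def using DERIV_mult[OF d1 d2] by (simp only:)
  qed
  have f0: "f x \<ge> 0" if "x \<ge> s" for x
  proof -
    have "x\<^sup>2 \<ge> 1" using that s by (metis one_le_power order_trans)
    moreover have "x ^ 4 \<ge> 0" by simp
    ultimately have "x ^ 4 + 2 * x\<^sup>2 - 1 \<ge> 0" by linarith
    thus ?thesis by (simp add: f_def)
  qed
  have fle: "f x \<le> std_normal_density x" for x
  proof -
    have "x ^ 4 + 2 * x\<^sup>2 - 1 \<le> (x\<^sup>2 + 1)\<^sup>2" by (simp add: power2_eq_square power4_eq_xxxx algebra_simps)
    hence "(x ^ 4 + 2 * x\<^sup>2 - 1) / (x\<^sup>2 + 1)\<^sup>2 \<le> 1" using p1[of x] by (simp add: divide_simps)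
    from mult_right_mono[OF this, of "std_normal_density x"] show ?thesis unfolding f_def by simp
  qed
  have lim: "(F \<longlongrightarrow> 0) at_top"
  proof (rule Lim_null_comparison[of _ "\<lambda>x. 1 / x"])
    show "\<forall>\<^sub>F x in at_top. norm (F x) \<le> 1 / x"
    proof (rule eventually_mono[OF eventually_gt_at_top[of 0]])
      fix x :: real assume x: "x > 0"
      have dens: "std_normal_density x \<le> 1"
      proof -
        have "1 \<le> sqrt (2 * pi)" using pi_gt3 by (simp add: real_le_rsqrt)
        moreover have "exp (- x\<^sup>2 / 2) \<le> 1" by simp
        ultimately have "exp (- x\<^sup>2 / 2) \<le> sqrt (2 * pi)" by linarith
        thus ?thesis unfolding std_normal_density_def by (simp add: divide_le_eq_1)
      qed
      have "norm (F x) = x / (x\<^sup>2 + 1) * std_normal_density x"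
        using x by (simp add: F_def abs_mult add_nonneg_nonneg)
      also have "\<dots> \<le> x / (x\<^sup>2 + 1) * 1" using dens x by (intro mult_left_mono) (auto intro!: divide_nonneg_nonneg)
      also have "\<dots> \<le> 1 / x" using x by (simp add: divide_simps power2_eq_square add_pos_pos)
      finally show "norm (F x) \<le> 1 / x" .
    qed
    show "((\<lambda>x::real. 1 / x) \<longlongrightarrow> 0) at_top" by real_asymp
  qed
  have fm: "f \<in> borel_measurable borel" unfolding f_def std_normal_density_def by measurable
  have "ennreal (s / (s\<^sup>2 + 1) * std_normal_density s) = ennreal (0 - F s)" by (simp add: F_def)
  also have "\<dots> = (\<integral>\<^sup>+x. ennreal (f x) * indicator {s ..} x \<partial>lborel)"
    by (rule nn_integral_FTC_atLeast[OF fm der f0 lim, symmetric])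
  also have "\<dots> \<le> (\<integral>\<^sup>+x. ennreal (std_normal_density x) * indicator {s ..} x \<partial>lborel)"
    by (intro nn_integral_mono mult_right_mono ennreal_leI fle) simp
  also have "\<dots> = emeasure std_normal {s ..}" by (simp add: emeasure_density)
  finally have up: "ennreal (s / (s\<^sup>2 + 1) * std_normal_density s) \<le> emeasure std_normal {s ..}" .
  have "emeasure std_normal {.. - s} = (\<integral>\<^sup>+x. ennreal (std_normal_density x) * indicator {.. - s} x \<partial>lborel)"
    by (simp add: emeasure_density)
  also have "\<dots> = (\<integral>\<^sup>+x. ennreal (std_normal_density (0 + (-1) * x)) * indicator {.. - s} (0 + (-1) * x) \<partial>lborel)"
    by (subst nn_integral_real_affine[of _ "-1" 0]) auto
  also have "\<dots> = (\<integral>\<^sup>+x. ennreal (std_normal_density x) * indicator {s ..} x \<partial>lborel)"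
    by (intro nn_integral_cong) (auto simp: std_normal_density_def indicator_def)
  also have "\<dots> = emeasure std_normal {s ..}" by (simp add: emeasure_density)
  finally have low: "emeasure std_normal {.. - s} = emeasure std_normal {s ..}" .
  have "{x. \<bar>x\<bar> \<ge> s} = {.. - s} \<union> {s ..}" by (auto simp: abs_real_def split: if_splits)
  hence "emeasure std_normal {x. \<bar>x\<bar> \<ge> s} = emeasure std_normal {.. - s} + emeasure std_normal {s ..}"
    using s by (simp add: plus_emeasure[symmetric] disjoint_iff)
  also have "\<dots> \<ge> ennreal (s / (s\<^sup>2 + 1) * std_normal_density s) + ennreal (s / (s\<^sup>2 + 1) * std_normal_density s)"
    unfolding low by (intro add_mono up)
  also have "ennreal (s / (s\<^sup>2 + 1) * std_normal_density s) + ennreal (s / (s\<^sup>2 + 1) * std_normal_density s)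
      = ennreal (2 * (s / (s\<^sup>2 + 1) * std_normal_density s))"
    using s by (subst ennreal_plus[symmetric]) (auto intro!: mult_nonneg_nonneg divide_nonneg_nonneg add_nonneg_nonneg)
  also have "2 * (s / (s\<^sup>2 + 1) * std_normal_density s) = sqrt (2 / pi) * exp (- s\<^sup>2 / 2) * s / (s\<^sup>2 + 1)"
  proof -
    have "2 / sqrt (2 * pi) = sqrt (2 / pi)"
      by (simp add: real_sqrt_mult real_sqrt_divide field_simps)
    moreover have "2 * (s / (s\<^sup>2 + 1) * std_normal_density s)
        = (2 / sqrt (2 * pi)) * exp (- s\<^sup>2 / 2) * s / (s\<^sup>2 + 1)"
      unfolding std_normal_density_def by (simp add: mult_ac)
    ultimately show ?thesis by simp
  qed
  finally show ?thesis by simp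
qed

text \<open>Stirling-type bound Gamma (x + 1) >= e (x / e)^x at half integers x >= 1. It passes from
  x to x + 1 because (1 + 1 / x)^x <= e; hence steps of two in d, with base cases d = 2, where
  equality holds, and d = 3.\<close>

lemma Gamma_half_lower:
  assumes "d \<ge> 2"
  shows "Gamma (real d / 2 + 1) \<ge> exp 1 * (real d / (2 * exp 1)) powr (real d / 2)"
  using assms
proof (induction d rule: less_induct)
  case (less d)
  consider "d = 2" | "d = 3" | "d \<ge> 4" using less.prems by linarith
  thus ?case
  proof cases
    case 1
    have "Gamma (2::real) = 1" using Gamma_fact[of 1, where ?'a=real] by simp
    thus ?thesis using 1 by (simp add: field_simps)
  next
    case 2
    have G: "Gamma (real d / 2 + 1) = 3 / 4 * sqrt pi"
    proof -
      have "Gamma (5 / 2 :: real) = 3 / 2 * Gamma (3 / 2)"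
        using Gamma_plus1[of "3/2 :: real"] nonpos_Ints_nonpos[of "3/2 :: real"] by auto
      also have "Gamma (3 / 2 :: real) = 1 / 2 * Gamma (1 / 2)"
        using Gamma_plus1[of "1/2 :: real"] nonpos_Ints_nonpos[of "1/2 :: real"] by auto
      finally show ?thesis using 2 by (simp add: Gamma_one_half_real)
    qed
    have "(exp 1 * (3 / (2 * exp 1)) powr (3 / 2))\<^sup>2 = (exp (1::real))\<^sup>2 * ((3 / (2 * exp 1)) powr (3 / 2)) powr 2"
      by (simp add: power_mult_distrib)
    also have "((3 / (2 * exp 1 :: real)) powr (3 / 2)) powr 2 = (3 / (2 * exp 1)) ^ 3"
      by (simp add: powr_powr powr_numeral)
    also have "(exp 1)\<^sup>2 * (3 / (2 * exp 1 :: real)) ^ 3 = 27 / 8 / exp 1"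
      by (simp add: power2_eq_square power3_eq_cube)
    also have "\<dots> \<le> 27 / 8 / 2" using exp_ge_add_one_self[of 1] by (intro divide_left_mono) auto
    also have "\<dots> \<le> (3 / 4 * sqrt pi)\<^sup>2" using pi_gt3 by (simp add: power_mult_distrib power2_eq_square)
    finally have "exp 1 * (3 / (2 * exp 1)) powr (3 / 2) \<le> 3 / 4 * sqrt pi"
      by (rule power2_le_imp_le) simp
    thus ?thesis using G 2 by simp
  next
    case 3
    define x where "x = real (d - 2) / 2"
    have x: "x \<ge> 1" "real d / 2 = x + 1" "real (d - 2) = 2 * x"
    proof -
      have "real (d - 2) = real d - 2" using 3 by (simp add: of_nat_diff)
      thus "real d / 2 = x + 1" unfolding x_def by linarith
      show "x \<ge> 1" using 3 by (simp add: x_def)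
      show "real (d - 2) = 2 * x" by (simp add: x_def)
    qed
    have IH: "Gamma (x + 1) \<ge> exp 1 * (x / exp 1) powr x"
    proof -
      have "Gamma (real (d - 2) / 2 + 1) \<ge> exp 1 * (real (d - 2) / (2 * exp 1)) powr (real (d - 2) / 2)"
        by (rule less.IH) (use 3 in auto)
      thus ?thesis unfolding x(3) by simp
    qed
    have "(1 + 1 / x) powr x = exp (x * ln (1 + 1 / x))"
    proof -
      have "1 + 1 / x > 0" using x by (simp add: add_pos_nonneg)
      thus ?thesis by (simp add: powr_def)
    qed
    also have "\<dots> \<le> exp 1" using x ln_add_one_self_le_self[of "1 / x"]
      by (simp add: field_simps)
    finally have e: "(1 + 1 / x) powr x \<le> exp 1" .
    have "((x + 1) / exp 1) powr (x + 1) = ((x + 1) / exp 1) * ((x / exp 1) powr x * (1 + 1 / x) powr x)"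
    proof -
      have "(x + 1) / exp 1 = x / exp 1 * (1 + 1 / x)" using x by (simp add: field_simps)
      hence "((x + 1) / exp 1) powr x = (x / exp 1) powr x * (1 + 1 / x) powr x"
        using x by (simp only: powr_mult)
      thus ?thesis using x by (simp add: powr_add)
    qed
    also have "\<dots> \<le> ((x + 1) / exp 1) * ((x / exp 1) powr x * exp 1)"
      using e x by (intro mult_left_mono) auto
    also have "\<dots> = (x + 1) * (x / exp 1) powr x" by simp
    finally have "exp 1 * ((x + 1) / exp 1) powr (x + 1) \<le> exp 1 * ((x + 1) * (x / exp 1) powr x)"
      by (intro mult_left_mono) auto
    also have "\<dots> = (x + 1) * (exp 1 * (x / exp 1) powr x)" by simp
    also have "\<dots> \<le> (x + 1) * Gamma (x + 1)" using IH x by (intro mult_left_mono) auto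
    also have "\<dots> = Gamma (x + 1 + 1)"
    proof -
      have "x + 1 \<notin> \<int>\<^sub>\<le>\<^sub>0" using nonpos_Ints_nonpos[of "x + 1"] x by auto
      thus ?thesis by (rule Gamma_plus1[symmetric])
    qed
    finally have fin: "exp 1 * ((x + 1) / exp 1) powr (x + 1) \<le> Gamma (x + 1 + 1)" .
    have "real d / (2 * exp 1) = real d / 2 / exp 1" by simp
    hence "real d / (2 * exp 1) = (x + 1) / exp 1" unfolding x(2) .
    thus ?thesis using fin unfolding x(2) by (simp only:)
  qed
qed

text \<open>The powers of pi cancel and leave 2^(- d / 2) / Gamma (d / 2 + 1), to which
  \<open>Gamma_half_lower\<close> applies.\<close>

lemma ball_const_le:
  assumes "d \<ge> 2"
  shows "ball_const d \<le> sqrt (exp 1 / real d) ^ d / exp 1"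
proof -
  have d: "real d > 0" using assms by simp
  have pw: "sqrt y ^ d = y powr (real d / 2)" if "y > 0" for y :: real
    using that by (simp add: powr_half_sqrt[symmetric] powr_realpow[symmetric] powr_powr)
  let ?G = "Gamma (real d / 2 + 1)"
  have "ball_const d = pi powr (real d / 2) / (2 * pi) powr (real d / 2) / ?G"
    by (simp add: ball_const_def unit_ball_vol_def pw)
  also have "\<dots> = (1 / 2) powr (real d / 2) / ?G"
    by (simp add: powr_mult powr_divide)
  also have "\<dots> \<le> (1 / 2) powr (real d / 2) / (exp 1 * (real d / (2 * exp 1)) powr (real d / 2))"
    using Gamma_half_lower[OF assms] d by (intro divide_left_mono mult_pos_pos) (auto intro: Gamma_real_pos)
  also have "\<dots> = ((1 / 2) / (real d / (2 * exp 1))) powr (real d / 2) / exp 1"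
    using d by (subst powr_divide) auto
  also have "(1 / 2) / (real d / (2 * exp 1)) = exp 1 / real d" using d by (simp add: field_simps)
  finally show ?thesis using d by (simp add: pw)
qed

section \<open>Minimum-norm solutions of underdetermined systems\<close>

text \<open>Padding the m < n equations with zero rows gives a singular square matrix; a normalised
  kernel vector is the witness.\<close>

lemma orthogonal_unit_vector:
  fixes a :: "nat \<Rightarrow> nat \<Rightarrow> real"
  assumes "m < n"
  obtains x where "(\<Sum>t<n. (x t)\<^sup>2) = 1" "\<And>i. i < m \<Longrightarrow> (\<Sum>t<n. a i t * x t) = 0"
proof -
  define A where "A = mat n n (\<lambda>(i, t). if i < m then a i t else 0)"
  have A: "A \<in> carrier_mat n n" by (simp add: A_def)
  have "det A = 0"
    unfolding det_def'[OF A]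
  proof (intro sum.neutral ballI)
    fix p assume "p \<in> {p. p permutes {0..<n}}"
    hence "p m < n" using assms permutes_in_image[of p "{0..<n}" m] by auto
    hence "A $$ (m, p m) = 0" using assms by (simp add: A_def)
    hence "(\<Prod>i = 0..<n. A $$ (i, p i)) = 0" using assms by (intro prod_zero) auto
    thus "signof p * (\<Prod>i = 0..<n. A $$ (i, p i)) = 0" by simp
  qed
  then obtain v where v: "v \<in> carrier_vec n" "v \<noteq> 0\<^sub>v n" "A *\<^sub>v v = 0\<^sub>v n"
    using det_0_iff_vec_prod_zero_field[OF A] by auto
  have eq: "(\<Sum>t<n. a i t * v $ t) = 0" if "i < m" for i
  proof -
    have "(A *\<^sub>v v) $ i = 0" using v that assms by simp
    thus ?thesis using v that assms
      by (simp add: A_def scalar_prod_def atLeast0LessThan)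
  qed
  define N where "N = (\<Sum>t<n. (v $ t)\<^sup>2)"
  have "\<exists>t<n. v $ t \<noteq> 0" using v by (metis eq_vecI carrier_vecD index_zero_vec)
  hence N: "N > 0" unfolding N_def by (auto intro!: sum_pos2)
  show ?thesis
  proof (rule that[of "\<lambda>t. v $ t / sqrt N"])
    show "(\<Sum>t<n. (v $ t / sqrt N)\<^sup>2) = 1"
      using N by (simp add: power_divide sum_divide_distrib[symmetric] N_def[symmetric])
    show "(\<Sum>t<n. a i t * (v $ t / sqrt N)) = 0" if "i < m" for i
      using eq[OF that] by (simp add: sum_divide_distrib[symmetric])
  qed
qed

text \<open>Each new vector is made orthogonal to the rows a and to the vectors already found, fewer
  than n conditions in total. The rows a may be linearly dependent.\<close>

lemma orthonormal_complement:
  fixes a :: "nat \<Rightarrow> nat \<Rightarrow> real"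
  assumes "m + d \<le> n"
  shows "\<exists>q. (\<forall>i<d. \<forall>k<d. (\<Sum>t<n. q i t * q k t) = (if i = k then 1 else 0)) \<and>
     (\<forall>i<m. \<forall>k<d. (\<Sum>t<n. a i t * q k t) = 0)"
  using assms
proof (induction d)
  case (Suc d)
  then obtain q where q': "\<forall>i<d. \<forall>k<d. (\<Sum>t<n. q i t * q k t) = (if i = k then 1 else 0)"
     "\<forall>i<m. \<forall>k<d. (\<Sum>t<n. a i t * q k t) = 0" by auto
  hence q: "\<And>i k. i < d \<Longrightarrow> k < d \<Longrightarrow> (\<Sum>t<n. q i t * q k t) = (if i = k then 1 else 0)"
     "\<And>i k. i < m \<Longrightarrow> k < d \<Longrightarrow> (\<Sum>t<n. a i t * q k t) = 0" by auto
  obtain x where x: "(\<Sum>t<n. (x t)\<^sup>2) = 1"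
     "\<And>i. i < m + d \<Longrightarrow> (\<Sum>t<n. (if i < m then a i else q (i - m)) t * x t) = 0"
    using orthogonal_unit_vector[of "m + d" n "\<lambda>i. if i < m then a i else q (i - m)"] Suc.prems by auto
  have xa: "(\<Sum>t<n. a i t * x t) = 0" if "i < m" for i using x(2)[of i] that by simp
  have xq: "(\<Sum>t<n. q i t * x t) = 0" if "i < d" for i using x(2)[of "m + i"] that by simp
  show ?case
  proof (intro exI[of _ "q(d := x)"] conjI allI impI)
    fix i k assume "i < Suc d" "k < Suc d"
    thus "(\<Sum>t<n. (q(d := x)) i t * (q(d := x)) k t) = (if i = k then 1 else 0)"
      using q(1)[of i k] x(1) xq[of i] xq[of k]
      by (auto simp: less_Suc_eq power2_eq_square mult.commute)
  next
    fix i k assume "i < m" "k < Suc d"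
    thus "(\<Sum>t<n. a i t * (q(d := x)) k t) = 0"
      using q(2)[of i k] xa[of i] by (auto simp: less_Suc_eq)
  qed
qed auto

lemma orthonormal_rows_imp_cols:
  fixes F :: "nat \<Rightarrow> nat \<Rightarrow> real"
  assumes "\<And>i k. i < n \<Longrightarrow> k < n \<Longrightarrow> (\<Sum>t<n. F i t * F k t) = (if i = k then 1 else 0)"
    and "s < n" "t < n"
  shows "(\<Sum>i<n. F i s * F i t) = (if s = t then 1 else 0)"
proof -
  define A where "A = mat n n (\<lambda>(i, t). F i t)"
  have A: "A \<in> carrier_mat n n" by (simp add: A_def)
  have "A * transpose_mat A = 1\<^sub>m n"
    by (rule eq_matI) (auto simp: A_def scalar_prod_def assms atLeast0LessThan)
  hence "transpose_mat A * A = 1\<^sub>m n"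
    using mat_mult_left_right_inverse[OF A] A by auto
  hence "(transpose_mat A * A) $$ (s, t) = (if s = t then 1 else 0)" using assms by simp
  thus ?thesis using assms by (simp add: A_def scalar_prod_def atLeast0LessThan)
qed

lemma complete_to_orthonormal_rows:
  fixes w :: "nat \<Rightarrow> real"
  assumes "0 < n" "(\<Sum>t<n. (w t)\<^sup>2) = 1"
  obtains F where "\<And>i k. i < n \<Longrightarrow> k < n \<Longrightarrow> (\<Sum>t<n. F i t * F k t) = (if i = k then 1 else 0)"
    "F 0 = w"
proof -
  obtain q where q: "\<And>i k. i < n - 1 \<Longrightarrow> k < n - 1 \<Longrightarrow> (\<Sum>t<n. q i t * q k t) = (if i = k then 1 else 0)"
     "\<And>k. k < n - 1 \<Longrightarrow> (\<Sum>t<n. w t * q k t) = 0"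
    using orthonormal_complement[of 1 "n - 1" n "\<lambda>_. w"] assms(1) by auto
  show ?thesis
  proof (rule that[of "\<lambda>i. if i = 0 then w else q (i - 1)"])
    fix i k assume "i < n" "k < n"
    thus "(\<Sum>t<n. (if i = 0 then w else q (i - 1)) t * (if k = 0 then w else q (k - 1)) t) = (if i = k then 1 else 0)"
      using assms q(1)[of "i - 1" "k - 1"] q(2)[of "i - 1"] q(2)[of "k - 1"]
      by (auto simp: power2_eq_square mult.commute)
  qed simp
qed

lemma sum_square_Cauchy:
  fixes f g :: "'a \<Rightarrow> real"
  shows "(\<Sum>t\<in>T. f t * g t)\<^sup>2 \<le> (\<Sum>t\<in>T. (f t)\<^sup>2) * (\<Sum>t\<in>T. (g t)\<^sup>2)"
  by (rule Cauchy_Schwarz_ineq_sum)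

section \<open>Gram matrices and the adjugate formula for the minimum-norm solution\<close>

definition gram :: "nat \<Rightarrow> nat \<Rightarrow> (nat \<times> nat \<Rightarrow> real) \<Rightarrow> real mat" where
  "gram j l g = mat j j (\<lambda>(a, b). \<Sum>t<l. g (a, t) * g (b, t))"

text \<open>\<^emph>\<open>sol\<close> is the minimum-norm solution of the system with rows \<^term>\<open>g\<close> and right-hand side
  \<^term>\<open>w\<close>; the adjugate makes it visibly measurable in \<^term>\<open>g\<close>. If the Gram determinant vanishes
  it has the junk value 0.\<close>

definition coef :: "nat \<Rightarrow> nat \<Rightarrow> (nat \<times> nat \<Rightarrow> real) \<Rightarrow> (nat \<Rightarrow> real) \<Rightarrow> nat \<Rightarrow> real" where
  "coef j l g w a = (\<Sum>b<j. adj_mat (gram j l g) $$ (a, b) * w b) / det (gram j l g)"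

definition sol :: "nat \<Rightarrow> nat \<Rightarrow> (nat \<times> nat \<Rightarrow> real) \<Rightarrow> (nat \<Rightarrow> real) \<Rightarrow> nat \<Rightarrow> real" where
  "sol j l g w t = (\<Sum>a<j. coef j l g w a * g (a, t))"

lemma gram_carrier: "gram j l g \<in> carrier_mat j j"
  by (simp add: gram_def)

lemma gram_cong:
  assumes "\<And>a t. a < j \<Longrightarrow> t < l \<Longrightarrow> g (a, t) = g' (a, t)"
  shows "gram j l g = gram j l g'"
  unfolding gram_def by (rule cong_mat) (use assms in auto)

lemma sol_cong:
  assumes "\<And>a t. a < j \<Longrightarrow> t < l \<Longrightarrow> g (a, t) = g' (a, t)" "\<And>b. b < j \<Longrightarrow> w b = w' b" "t < l"
  shows "sol j l g w t = sol j l g' w' t"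
proof -
  have "gram j l g = gram j l g'" by (rule gram_cong) (rule assms(1))
  thus ?thesis unfolding sol_def coef_def using assms by simp
qed

lemma sol_solves:
  assumes "det (gram j l g) \<noteq> 0" "i < j"
  shows "(\<Sum>t<l. g (i, t) * sol j l g w t) = w i"
proof -
  let ?G = "gram j l g" and ?y = "coef j l g w"
  have "(\<Sum>t<l. g (i, t) * sol j l g w t) = (\<Sum>a<j. ?y a * (\<Sum>t<l. g (i, t) * g (a, t)))"
    unfolding sol_def sum_distrib_left by (subst sum.swap) (simp add: mult_ac)
  also have "\<dots> = (\<Sum>a<j. ?G $$ (i, a) * ?y a)"
    using assms by (simp add: gram_def mult.commute)
  also have "\<dots> = (\<Sum>a<j. \<Sum>b<j. ?G $$ (i, a) * adj_mat ?G $$ (a, b) * w b) / det ?G"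
    unfolding coef_def by (simp add: sum_divide_distrib sum_distrib_left mult.assoc)
  also have "(\<Sum>a<j. \<Sum>b<j. ?G $$ (i, a) * adj_mat ?G $$ (a, b) * w b)
      = (\<Sum>b<j. (\<Sum>a<j. ?G $$ (i, a) * adj_mat ?G $$ (a, b)) * w b)"
    by (subst sum.swap) (simp add: sum_distrib_right)
  also have "\<dots> = (\<Sum>b<j. (?G * adj_mat ?G) $$ (i, b) * w b)"
    using assms(2) gram_carrier[of j l g] adj_mat(1)[OF gram_carrier, of j l g]
    by (simp add: scalar_prod_def atLeast0LessThan)
  also have "\<dots> = (\<Sum>b<j. if b = i then det ?G * w b else 0)"
    unfolding adj_mat(2)[OF gram_carrier] using assms(2) by (intro sum.cong) auto
  also have "\<dots> = det ?G * w i" using assms(2) by simp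
  finally show ?thesis using assms(1) by simp
qed

text \<open>Exhibits the solution operator as a matrix for each fixed g;
  \<open>gauss_block_bound\<close> needs it in this form to apply a transpose.\<close>

lemma sol_linear: "sol j l g w t = (\<Sum>b<j. w b * sol j l g (\<lambda>c. if c = b then 1 else 0) t)"
proof -
  have c: "coef j l g w a = (\<Sum>b<j. w b * coef j l g (\<lambda>c. if c = b then 1 else 0) a)" for a
    unfolding coef_def by (simp add: sum_divide_distrib if_distrib[of "\<lambda>x. _ * x"] cong: if_cong)
       (simp add: mult.commute)
  show ?thesis
    unfolding sol_def c sum_distrib_left sum_distrib_right by (subst sum.swap) (simp add: mult.assoc)
qed

text \<open>In other words |sol| <= sqrt W / |u|, where u is a projection of the normalised row
  combination r that is blind to all combinations with coefficients perpendicular to w. The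
  coefficients y of the solution satisfy |sol|^2 = y . w = c. Splitting y into its component along w
  and a rest invisible to u gives u . sol = (c / sqrt W) |u|^2, and Cauchy-Schwarz finishes.\<close>

lemma sol_norm_bound:
  fixes g :: "nat \<times> nat \<Rightarrow> real"
  assumes det: "det (gram j l g) \<noteq> 0"
    and W: "W = (\<Sum>a<j. (w a)\<^sup>2)" "W > 0"
    and r: "\<And>t. t < l \<Longrightarrow> r t = (\<Sum>a<j. w a * g (a, t)) / sqrt W"
    and perp: "\<And>c. (\<Sum>a<j. c a * w a) = 0 \<Longrightarrow> (\<Sum>t<l. u t * (\<Sum>a<j. c a * g (a, t))) = 0"
    and u: "(\<Sum>t<l. u t * r t) = (\<Sum>t<l. (u t)\<^sup>2)"
  shows "(\<Sum>t<l. (sol j l g w t)\<^sup>2) * (\<Sum>t<l. (u t)\<^sup>2) \<le> W"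
proof -
  let ?h = "sol j l g w" and ?y = "coef j l g w"
  define c where "c = (\<Sum>a<j. ?y a * w a)"
  let ?U = "\<Sum>t<l. (u t)\<^sup>2"
  have h2: "(\<Sum>t<l. (?h t)\<^sup>2) = c"
  proof -
    have "(\<Sum>t<l. (?h t)\<^sup>2) = (\<Sum>t<l. \<Sum>a<j. ?y a * (g (a, t) * ?h t))"
      unfolding power2_eq_square by (subst (1) sol_def) (simp add: sum_distrib_right mult.assoc)
    also have "\<dots> = (\<Sum>a<j. ?y a * (\<Sum>t<l. g (a, t) * ?h t))"
      by (subst sum.swap) (simp add: sum_distrib_left)
    also have "\<dots> = c" unfolding c_def by (intro sum.cong) (auto simp: sol_solves[OF det])
    finally show ?thesis .
  qed
  have uh: "(\<Sum>t<l. u t * ?h t) = c / sqrt W * ?U"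
  proof -
    define y' where "y' a = ?y a - c / W * w a" for a
    have "(\<Sum>a<j. y' a * w a) = c - c / W * W"
    proof -
      have "(\<Sum>a<j. y' a * w a) = c - c / W * (\<Sum>a<j. (w a)\<^sup>2)"
        unfolding y'_def left_diff_distrib sum_subtractf c_def[symmetric]
        by (simp add: sum_distrib_left power2_eq_square mult.assoc)
      thus ?thesis using W(1) by simp
    qed
    hence "(\<Sum>a<j. y' a * w a) = 0" using W by simp
    from perp[OF this] have p: "(\<Sum>t<l. u t * (\<Sum>a<j. y' a * g (a, t))) = 0" .
    have "(\<Sum>t<l. u t * ?h t) = (\<Sum>t<l. u t * (\<Sum>a<j. y' a * g (a, t))) + (\<Sum>t<l. u t * (c / sqrt W * r t))"
      unfolding sum.distrib[symmetric]
    proof (intro sum.cong refl)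
      fix t assume t: "t \<in> {..<l}"
      have "c / sqrt W * r t = c / W * (\<Sum>a<j. w a * g (a, t))"
      proof -
        have "c / sqrt W * r t = c * (\<Sum>a<j. w a * g (a, t)) / (sqrt W * sqrt W)"
          using r[of t] t by simp
        thus ?thesis using W(2) by simp
      qed
      hence "?h t = (\<Sum>a<j. y' a * g (a, t)) + c / sqrt W * r t"
        unfolding sol_def y'_def by (simp add: algebra_simps sum.distrib sum_subtractf sum_distrib_left)
      thus "u t * ?h t = u t * (\<Sum>a<j. y' a * g (a, t)) + u t * (c / sqrt W * r t)"
        by (simp add: distrib_left)
    qed
    also have "(\<Sum>t<l. u t * (c / sqrt W * r t)) = c / sqrt W * ?U"
      unfolding u[symmetric] by (simp add: sum_distrib_left mult_ac)
    finally show ?thesis using p by simp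
  qed
  have "(c / sqrt W * ?U)\<^sup>2 \<le> ?U * c"
    using sum_square_Cauchy[of u ?h "{..<l}"] unfolding uh h2 .
  hence "c * ?U * (c * ?U) \<le> c * ?U * W"
    using W by (simp add: power2_eq_square field_simps)
  moreover have "c \<ge> 0" unfolding h2[symmetric] by (simp add: sum_nonneg)
  moreover have "?U \<ge> 0" by (simp add: sum_nonneg)
  ultimately have "c * ?U \<le> W" using W(2)
    by (metis mult_left_le_imp_le mult_nonneg_nonneg less_eq_real_def mult_eq_0_iff order_less_imp_le)
  thus ?thesis using h2 by simp
qed

section \<open>Measurability of the minimum-norm solution\<close>

lemma det_mat_measurable:
  fixes f :: "nat \<Rightarrow> nat \<Rightarrow> 'a \<Rightarrow> real"
  assumes "\<And>a b. a < n \<Longrightarrow> b < n \<Longrightarrow> f a b \<in> borel_measurable M"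
  shows "(\<lambda>x. det (mat n n (\<lambda>(a, b). f a b x))) \<in> borel_measurable M"
proof -
  have eq: "det (mat n n (\<lambda>(a, b). f a b x)) =
     (\<Sum>p\<in>{p. p permutes {0..<n}}. signof p * (\<Prod>i = 0..<n. f i (p i) x))" for x
  proof (subst det_def'[of _ n], simp, intro sum.cong refl arg_cong2[where f="(*)"] prod.cong)
    fix p i assume "p \<in> {p. p permutes {0..<n}}" "i \<in> {0..<n}"
    thus "mat n n (\<lambda>(a, b). f a b x) $$ (i, p i) = f i (p i) x"
      using permutes_in_image[of p "{0..<n}" i] by auto
  qed
  show ?thesis unfolding eq
  proof (intro borel_measurable_sum borel_measurable_times borel_measurable_prod borel_measurable_const assms)
    fix p i assume "p \<in> {p. p permutes {0..<n}}" "i \<in> {0..<n}"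
    thus "i < n" "p i < n" using permutes_in_image[of p "{0..<n}" i] by auto
  qed
qed

lemma gram_measurable:
  assumes "\<And>a t. a < j \<Longrightarrow> t < l \<Longrightarrow> (\<lambda>x. g x (a, t)) \<in> borel_measurable M"
  shows "(\<lambda>x. det (gram j l (g x))) \<in> borel_measurable M"
    and "a < j \<Longrightarrow> b < j \<Longrightarrow> (\<lambda>x. adj_mat (gram j l (g x)) $$ (a, b)) \<in> borel_measurable M"
proof -
  have e: "(\<lambda>x. \<Sum>t<l. g x (a, t) * g x (b, t)) \<in> borel_measurable M" if "a < j" "b < j" for a b
    using assms that by (intro borel_measurable_sum borel_measurable_times) auto
  show "(\<lambda>x. det (gram j l (g x))) \<in> borel_measurable M"
    unfolding gram_def by (rule det_mat_measurable) (rule e)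
  assume ab: "a < j" "b < j"
  let ?i = "\<lambda>i. if i < b then i else Suc i" and ?k = "\<lambda>k. if k < a then k else Suc k"
  have eq: "adj_mat (gram j l (g x)) $$ (a, b) = (-1) ^ (b + a) *
     det (mat (j - 1) (j - 1) (\<lambda>(i, k). \<Sum>t<l. g x (?i i, t) * g x (?k k, t)))" for x
  proof -
    have "mat_delete (gram j l (g x)) b a =
       mat (j - 1) (j - 1) (\<lambda>(i, k). \<Sum>t<l. g x (?i i, t) * g x (?k k, t))"
      unfolding mat_delete_def gram_def using ab by (auto intro!: eq_matI)
    thus ?thesis using ab by (simp add: adj_mat_def cofactor_def gram_def)
  qed
  show "(\<lambda>x. adj_mat (gram j l (g x)) $$ (a, b)) \<in> borel_measurable M"
    unfolding eq
    by (intro borel_measurable_times borel_measurable_const det_mat_measurable e) (use ab in auto)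
qed

lemma sol_measurable:
  assumes "\<And>a t. a < j \<Longrightarrow> t < l \<Longrightarrow> (\<lambda>x. g x (a, t)) \<in> borel_measurable M"
    and "\<And>b. b < j \<Longrightarrow> (\<lambda>x. w x b) \<in> borel_measurable M" and "t < l"
  shows "(\<lambda>x. sol j l (g x) (w x) t) \<in> borel_measurable M"
  unfolding sol_def coef_def
  by (intro borel_measurable_sum borel_measurable_times borel_measurable_divide gram_measurable assms) auto

section \<open>Tails for Gaussian systems\<close>

lemma gauss_cong: "(\<And>i. i \<in> I \<Longrightarrow> Y i = Y' i) \<Longrightarrow> gauss M I Y \<longleftrightarrow> gauss M I Y'"
  unfolding gauss_def by (auto simp: restrict_def cong: if_cong)

lemma nn_integral_PiM_le:
  assumes IJ: "I \<inter> J = {}" "finite I" "finite J"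
    and f: "f \<in> borel_measurable (\<Pi>\<^sub>M i\<in>I \<union> J. borel :: real measure)"
    and le: "\<And>z. (\<integral>\<^sup>+y. f (merge I J (z, y)) \<partial>(\<Pi>\<^sub>M i\<in>J. std_normal)) \<le> C"
  shows "(\<integral>\<^sup>+x. f x \<partial>(\<Pi>\<^sub>M i\<in>I \<union> J. std_normal)) \<le> C"
proof -
  have f': "f \<in> borel_measurable (\<Pi>\<^sub>M i\<in>I \<union> J. std_normal)" using f by measurable
  have "(\<integral>\<^sup>+x. f x \<partial>(\<Pi>\<^sub>M i\<in>I \<union> J. std_normal))
      = (\<integral>\<^sup>+z. (\<integral>\<^sup>+y. f (merge I J (z, y)) \<partial>(\<Pi>\<^sub>M i\<in>J. std_normal)) \<partial>(\<Pi>\<^sub>M i\<in>I. std_normal))"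
    by (rule std_normal_PiM.product_nn_integral_fold[OF IJ f'])
  also have "\<dots> \<le> (\<integral>\<^sup>+z. C \<partial>(\<Pi>\<^sub>M i\<in>I. std_normal))"
    by (intro nn_integral_mono le)
  also have "\<dots> = C" by (simp add: prob_space.emeasure_space_1[OF prob_space_PiM_std_normal])
  finally show ?thesis .
qed

text \<open>The transpose of F acts on the first j rows. Thus the combination of the rotated rows
  with coefficients \<open>F 0\<close> is row 0 of x again, which is how a prescribed direction
  \<open>F 0\<close> is moved to a single row.\<close>

definition rot :: "nat \<Rightarrow> (nat \<Rightarrow> nat \<Rightarrow> real) \<Rightarrow> (nat \<times> nat \<Rightarrow> real) \<Rightarrow> nat \<times> nat \<Rightarrow> real" where
  "rot j F x = (\<lambda>(b, t). if b < j then \<Sum>i<j. F i b * x (i, t) else x (b, t))"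

lemma gauss_rot:
  assumes F: "\<And>i k. i < j \<Longrightarrow> k < j \<Longrightarrow> (\<Sum>t<j. F i t * F k t) = (if i = k then 1 else 0)"
    and jn: "j \<le> n"
  shows "gauss (\<Pi>\<^sub>M p\<in>{..<n} \<times> {..<l}. std_normal) ({..<n} \<times> {..<l}) (\<lambda>p x. rot j F x p)"
proof -
  let ?idx = "{..<n} \<times> {..<l}"
  define \<alpha> where "\<alpha> b i = (if b < j then (if i < j then F i b else 0) else if i = b then 1 else 0)" for b i
  define c where "c p r = (if snd p = snd r then \<alpha> (fst p) (fst r) else 0)" for p r :: "nat \<times> nat"
  have inner: "(\<Sum>r\<in>?idx. (if snd p = snd r then f (fst r) else 0) * x r) = (\<Sum>i<n. f i * x (i, snd p))"
    if "p \<in> ?idx" for p f and x :: "nat \<times> nat \<Rightarrow> real"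
  proof -
    have "(\<Sum>r\<in>?idx. (if snd p = snd r then f (fst r) else 0) * x r)
      = (\<Sum>i<n. \<Sum>t<l. (if snd p = t then f i else 0) * x (i, t))"
      by (simp add: sum.cartesian_product case_prod_unfold)
    also have "\<dots> = (\<Sum>i<n. \<Sum>t<l. if t = snd p then f i * x (i, snd p) else 0)"
      by (intro sum.cong refl) auto
    also have "\<dots> = (\<Sum>i<n. f i * x (i, snd p))" using that by auto
    finally show ?thesis .
  qed
  have \<alpha>sum: "(\<Sum>i<n. \<alpha> b i * f i) = (if b < j then \<Sum>i<j. F i b * f i else f b)" if "b < n" for b f
  proof (cases "b < j")
    case True
    have "(\<Sum>i<n. \<alpha> b i * f i) = (\<Sum>i<j. \<alpha> b i * f i)"
      using jn True by (intro sum.mono_neutral_right) (auto simp: \<alpha>_def)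
    thus ?thesis using True by (simp add: \<alpha>_def)
  next
    case False
    have "(\<Sum>i<n. \<alpha> b i * f i) = (\<Sum>i<n. if i = b then f i else 0)"
      using False by (intro sum.cong refl) (auto simp: \<alpha>_def)
    thus ?thesis using that False by simp
  qed
  have "gauss (\<Pi>\<^sub>M p\<in>?idx. std_normal) ?idx (\<lambda>p x. \<Sum>r\<in>?idx. c p r * x r)"
  proof (rule gauss_rotate[OF prob_space_PiM_std_normal gauss_PiM])
    fix p q assume p: "p \<in> ?idx" and q: "q \<in> ?idx"
    have "(\<Sum>r\<in>?idx. c p r * c q r) = (\<Sum>i<n. \<alpha> (fst p) i * c q (i, snd p))"
      unfolding c_def[of p] by (rule inner[OF p])
    also have "\<dots> = (if snd p = snd q then \<Sum>i<n. \<alpha> (fst p) i * \<alpha> (fst q) i else 0)"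
      by (auto simp: c_def)
    also have "(\<Sum>i<n. \<alpha> (fst p) i * \<alpha> (fst q) i) = (if fst p = fst q then 1 else 0)"
      using p q orthonormal_rows_imp_cols[OF F, of "fst p" "fst q"]
      by (subst \<alpha>sum) (auto simp: \<alpha>_def)
    finally show "(\<Sum>r\<in>?idx. c p r * c q r) = (if p = q then 1 else 0)"
      by (auto simp: prod_eq_iff)
  qed auto
  moreover have "(\<Sum>r\<in>?idx. c p r * x r) = rot j F x p" if "p \<in> ?idx" for p x
    unfolding c_def inner[OF that] using that by (subst \<alpha>sum) (auto simp: rot_def case_prod_unfold)
  ultimately show ?thesis
    using gauss_cong[of ?idx "\<lambda>p x. \<Sum>r\<in>?idx. c p r * x r" "\<lambda>p x. rot j F x p"] by auto
qed

text \<open>After the integrals are exchanged x is fixed, and the event says that z lies in a ball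
  of radius sqrt W / R times |x|. The small-ball bound turns this into the power of |x| with
  exponent card D, whose expectation is left symbolic.\<close>

lemma chi_ratio_tail:
  assumes I: "finite I" "I \<noteq> {}" and D: "finite D" "D \<noteq> {}" and W: "W \<ge> 0" and R: "R > 0"
  shows "(\<integral>\<^sup>+z. (\<integral>\<^sup>+x. indicator {x. W * (\<Sum>i\<in>I. (x i)\<^sup>2) \<ge> R\<^sup>2 * (\<Sum>i\<in>D. (z i)\<^sup>2)} x
            \<partial>(\<Pi>\<^sub>M i\<in>I. std_normal)) \<partial>(\<Pi>\<^sub>M i\<in>D. std_normal))
     \<le> ennreal (ball_const (card D) * (sqrt W / R) ^ card D) *
        (\<integral>\<^sup>+x. ennreal (sqrt (\<Sum>i\<in>I. (x i)\<^sup>2) ^ card D) \<partial>(\<Pi>\<^sub>M i\<in>I. std_normal))"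
proof -
  let ?X = "\<Pi>\<^sub>M i\<in>I. std_normal" and ?Z = "\<Pi>\<^sub>M i\<in>D. std_normal"
  interpret X: prob_space ?X by (rule prob_space_PiM_std_normal)
  interpret Z: prob_space ?Z by (rule prob_space_PiM_std_normal)
  interpret P: pair_sigma_finite ?Z ?X by standard
  let ?d = "card D"
  have eq: "(\<integral>\<^sup>+x. indicator {x. W * (\<Sum>i\<in>I. (x i)\<^sup>2) \<ge> R\<^sup>2 * (\<Sum>i\<in>D. (z i)\<^sup>2)} x \<partial>?X)
     = (\<integral>\<^sup>+x. indicator {p. W * (\<Sum>i\<in>I. (snd p i)\<^sup>2) \<ge> R\<^sup>2 * (\<Sum>i\<in>D. (fst p i)\<^sup>2)} (z, x) \<partial>?X)" for z
    by (intro nn_integral_cong) (auto simp: indicator_def)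
  have m: "(\<lambda>p. indicator {p. W * (\<Sum>i\<in>I. (snd p i)\<^sup>2) \<ge> R\<^sup>2 * (\<Sum>i\<in>D. (fst p i)\<^sup>2)} p :: ennreal)
     \<in> borel_measurable (?Z \<Otimes>\<^sub>M ?X)"
    by measurable
  have "(\<integral>\<^sup>+z. (\<integral>\<^sup>+x. indicator {x. W * (\<Sum>i\<in>I. (x i)\<^sup>2) \<ge> R\<^sup>2 * (\<Sum>i\<in>D. (z i)\<^sup>2)} x \<partial>?X) \<partial>?Z)
     = (\<integral>\<^sup>+x. (\<integral>\<^sup>+z. indicator {p. W * (\<Sum>i\<in>I. (snd p i)\<^sup>2) \<ge> R\<^sup>2 * (\<Sum>i\<in>D. (fst p i)\<^sup>2)} (z, x) \<partial>?Z) \<partial>?X)"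
    unfolding eq by (rule P.Fubini'[symmetric]) (use m in \<open>simp add: case_prod_unfold\<close>)
  also have "\<dots> \<le> (\<integral>\<^sup>+x. ennreal (ball_const ?d * (sqrt W / R) ^ ?d) * ennreal (sqrt (\<Sum>i\<in>I. (x i)\<^sup>2) ^ ?d) \<partial>?X)"
  proof (rule nn_integral_mono)
    fix x
    let ?t = "sqrt W / R * sqrt (\<Sum>i\<in>I. (x i)\<^sup>2)"
    have t0: "?t \<ge> 0" using W R by (simp add: sum_nonneg)
    have t2: "?t\<^sup>2 = W * (\<Sum>i\<in>I. (x i)\<^sup>2) / R\<^sup>2"
      using W by (simp add: power_mult_distrib power_divide sum_nonneg)
    have B: "{z \<in> space ?Z. (\<Sum>i\<in>D. (z i)\<^sup>2) \<le> ?t\<^sup>2} \<in> sets ?Z" by measurable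
    have "(\<integral>\<^sup>+z. indicator {p. W * (\<Sum>i\<in>I. (snd p i)\<^sup>2) \<ge> R\<^sup>2 * (\<Sum>i\<in>D. (fst p i)\<^sup>2)} (z, x) \<partial>?Z)
       = (\<integral>\<^sup>+z. indicator {z \<in> space ?Z. (\<Sum>i\<in>D. (z i)\<^sup>2) \<le> ?t\<^sup>2} z \<partial>?Z)"
      unfolding t2 using R by (intro nn_integral_cong) (auto simp: indicator_def field_simps)
    also have "\<dots> = emeasure ?Z {z \<in> space ?Z. (\<Sum>i\<in>D. (z i)\<^sup>2) \<le> ?t\<^sup>2}"
      using B by simp
    also have "\<dots> \<le> ennreal (ball_const ?d * ?t ^ ?d)"
      by (rule gauss_small_ball[OF D(1) t0 D(2)])
    also have "\<dots> = ennreal (ball_const ?d * (sqrt W / R) ^ ?d) * ennreal (sqrt (\<Sum>i\<in>I. (x i)\<^sup>2) ^ ?d)"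
      using W R by (subst ennreal_mult[symmetric])
        (auto simp: ball_const_nonneg power_mult_distrib power_divide sum_nonneg mult.assoc)
    finally show "(\<integral>\<^sup>+z. indicator {p. W * (\<Sum>i\<in>I. (snd p i)\<^sup>2) \<ge> R\<^sup>2 * (\<Sum>i\<in>D. (fst p i)\<^sup>2)} (z, x) \<partial>?Z) \<le> \<dots>" .
  qed
  also have "\<dots> = ennreal (ball_const ?d * (sqrt W / R) ^ ?d) * (\<integral>\<^sup>+x. ennreal (sqrt (\<Sum>i\<in>I. (x i)\<^sup>2) ^ ?d) \<partial>?X)"
    by (rule nn_integral_cmult) measurable
  finally show ?thesis .
qed

text \<open>The products of independent Gaussian rows with a fixed vector of squared norm H are sqrt
  H times independent standard normal variables.\<close>

lemma gauss_rows_times_vector: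
  fixes l :: nat and h :: "nat \<Rightarrow> real"
  assumes I: "finite I" and H: "H = (\<Sum>t<l. (h t)\<^sup>2)" "H > 0"
  shows "(\<integral>\<^sup>+b. indicator {b. (\<Sum>i\<in>I. (\<Sum>t<l. b (i, t) * h t)\<^sup>2) \<ge> r} b \<partial>(\<Pi>\<^sub>M p\<in>I \<times> {..<l}. std_normal))
     = (\<integral>\<^sup>+x. indicator {x. H * (\<Sum>i\<in>I. (x i)\<^sup>2) \<ge> r} x \<partial>(\<Pi>\<^sub>M i\<in>I. std_normal))"
proof -
  let ?J = "I \<times> {..<l}"
  define c where "c i p = (if fst p = i then h (snd p) / sqrt H else 0)" for i :: 'a and p :: "'a \<times> nat"
  have inner: "(\<Sum>p\<in>?J. c i p * x p) = (\<Sum>t<l. x (i, t) * h t) / sqrt H" if "i \<in> I" for i x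
  proof -
    have "(\<Sum>p\<in>?J. c i p * x p) = (\<Sum>k\<in>I. \<Sum>t<l. c i (k, t) * x (k, t))"
      by (simp add: sum.cartesian_product case_prod_unfold)
    also have "\<dots> = (\<Sum>k\<in>I. if k = i then \<Sum>t<l. h t / sqrt H * x (i, t) else 0)"
      by (intro sum.cong refl) (auto simp: c_def)
    also have "\<dots> = (\<Sum>t<l. h t / sqrt H * x (i, t))" using I that by simp
    finally show ?thesis by (simp add: sum_divide_distrib mult.commute)
  qed
  have g: "gauss (\<Pi>\<^sub>M p\<in>?J. std_normal) I (\<lambda>i b. \<Sum>p\<in>?J. c i p * b p)"
  proof (rule gauss_rotate[OF prob_space_PiM_std_normal gauss_PiM])
    fix i k assume i: "i \<in> I" and k: "k \<in> I"
    show "(\<Sum>p\<in>?J. c i p * c k p) = (if i = k then 1 else 0)"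
    proof (cases "i = k")
      case True
      have "(\<Sum>t<l. c k (i, t) * h t) = (\<Sum>t<l. (h t)\<^sup>2) / sqrt H"
        using True by (simp add: c_def power2_eq_square sum_divide_distrib)
      thus ?thesis unfolding inner[OF i] using True H by (simp add: real_div_sqrt)
    qed (auto simp: inner[OF i], auto simp: c_def)
  qed (use I in auto)
  let ?f = "\<lambda>x. indicator {x. H * (\<Sum>i\<in>I. (x i)\<^sup>2) \<ge> r} x :: ennreal"
  have "(\<integral>\<^sup>+x. ?f x \<partial>(\<Pi>\<^sub>M i\<in>I. std_normal))
     = (\<integral>\<^sup>+b. ?f (\<lambda>i\<in>I. \<Sum>p\<in>?J. c i p * b p) \<partial>(\<Pi>\<^sub>M p\<in>?J. std_normal))"
    by (rule gauss_nn_integral[OF g, symmetric]) measurable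
  also have "\<dots> = (\<integral>\<^sup>+b. indicator {b. (\<Sum>i\<in>I. (\<Sum>t<l. b (i, t) * h t)\<^sup>2) \<ge> r} b \<partial>(\<Pi>\<^sub>M p\<in>?J. std_normal))"
  proof (rule nn_integral_cong)
    fix b
    have "H * (\<Sum>i\<in>I. ((\<lambda>i\<in>I. \<Sum>p\<in>?J. c i p * b p) i)\<^sup>2) = H * (\<Sum>i\<in>I. ((\<Sum>t<l. b (i, t) * h t) / sqrt H)\<^sup>2)"
      by (intro arg_cong[where f="\<lambda>x. H * x"] sum.cong refl) (simp add: inner)
    also have "\<dots> = (\<Sum>i\<in>I. (\<Sum>t<l. b (i, t) * h t)\<^sup>2)"
      using H(2) by (simp add: power_divide sum_divide_distrib[symmetric])
    finally show "?f (\<lambda>i\<in>I. \<Sum>p\<in>?J. c i p * b p) = indicator {b. (\<Sum>i\<in>I. (\<Sum>t<l. b (i, t) * h t)\<^sup>2) \<ge> r} b"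
      by (simp add: indicator_def)
  qed
  finally show ?thesis by simp
qed

lemma sol_event_measurable:
  assumes "j \<le> n" "I \<subseteq> {j..<n}"
  shows "(\<lambda>x. indicator {x. (\<Sum>i\<in>I. (\<Sum>t<l. x (i, t) * sol j l x w t)\<^sup>2) \<ge> r} x :: ennreal)
     \<in> borel_measurable (\<Pi>\<^sub>M p\<in>{..<n} \<times> {..<l}. borel)"
proof -
  have c: "(\<lambda>x. x (a, t)) \<in> borel_measurable (\<Pi>\<^sub>M p\<in>{..<n} \<times> {..<l}. borel :: real measure)"
    if "a < n" "t < l" for a t
    using that by (intro measurable_component_singleton) auto
  have "(\<lambda>x. \<Sum>i\<in>I. (\<Sum>t<l. x (i, t) * sol j l x w t)\<^sup>2)
     \<in> borel_measurable (\<Pi>\<^sub>M p\<in>{..<n} \<times> {..<l}. borel)"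
    using assms
    by (intro borel_measurable_sum borel_measurable_power borel_measurable_times c sol_measurable) auto
  note [measurable] = this
  show ?thesis by measurable
qed

lemma chi_ratio_measurable:
  "(\<lambda>p. indicator {p. W * (\<Sum>i\<in>I. (snd p i)\<^sup>2) \<ge> R\<^sup>2 * (\<Sum>i\<in>D. (fst p i)\<^sup>2)} p :: ennreal)
     \<in> borel_measurable ((\<Pi>\<^sub>M i\<in>D. std_normal) \<Otimes>\<^sub>M (\<Pi>\<^sub>M i\<in>I. std_normal))"
  by measurable

text \<open>Rotating the first j rows we may take the right-hand side to be a multiple of a unit vector; then
  the norm of the solution is at most the reciprocal distance of one Gaussian row from the span of
  the others, which is the norm of a Gaussian vector in l - j + 1 dimensions.\<close>

lemma sol_tail_fixed_rhs:
  fixes w :: "nat \<Rightarrow> real"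
  assumes j: "0 < j" "j \<le> l" "j \<le> n" and I: "I \<subseteq> {j..<n}" "I \<noteq> {}" and R: "R > 0"
    and d: "d = l - j + 1"
  shows "(\<integral>\<^sup>+x. indicator {x. (\<Sum>i\<in>I. (\<Sum>t<l. x (i, t) * sol j l x w t)\<^sup>2) \<ge> R\<^sup>2} x
             \<partial>(\<Pi>\<^sub>M p\<in>{..<n} \<times> {..<l}. std_normal))
     \<le> ennreal (ball_const d * (sqrt (\<Sum>a<j. (w a)\<^sup>2) / R) ^ d) *
        (\<integral>\<^sup>+x. ennreal (sqrt (\<Sum>i\<in>I. (x i)\<^sup>2) ^ d) \<partial>(\<Pi>\<^sub>M i\<in>I. std_normal))"
proof -
  define W where "W = (\<Sum>a<j. (w a)\<^sup>2)"
  let ?T = "{..<l}"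
  let ?idx = "{..<n} \<times> ?T"
  let ?ev = "\<lambda>x. (\<Sum>i\<in>I. (\<Sum>t<l. x (i, t) * sol j l x w t)\<^sup>2) \<ge> R\<^sup>2"
  let ?f = "\<lambda>x. indicator {x. ?ev x} x :: ennreal"
  let ?C = "ennreal (ball_const d * (sqrt W / R) ^ d) *
        (\<integral>\<^sup>+x. ennreal (sqrt (\<Sum>i\<in>I. (x i)\<^sup>2) ^ d) \<partial>(\<Pi>\<^sub>M i\<in>I. std_normal))"
  have fI: "finite I" using I(1) finite_subset by auto
  have fm: "?f \<in> borel_measurable (\<Pi>\<^sub>M p\<in>?idx. borel)"
    by (rule sol_event_measurable[OF j(3) I(1)])
  have W0: "W \<ge> 0" by (simp add: W_def sum_nonneg)
  show ?thesis
  proof (cases "W = 0")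
    case True
    hence "w a = 0" if "a < j" for a
      using that sum_nonneg_eq_0_iff[of "{..<j}" "\<lambda>a. (w a)\<^sup>2"] by (auto simp: W_def)
    hence "sol j l x w t = 0" for x t by (simp add: sol_def coef_def)
    hence "?f x = 0" for x using R by (simp add: indicator_def)
    thus ?thesis by simp
  next
    case False
    hence Wp: "W > 0" using W0 by simp
    have "(\<Sum>t<j. (w t / sqrt W)\<^sup>2) = 1"
      using Wp by (simp add: power_divide sum_divide_distrib[symmetric] W_def[symmetric])
    from complete_to_orthonormal_rows[OF j(1) this] obtain F
      where F: "\<And>i k. i < j \<Longrightarrow> k < j \<Longrightarrow> (\<Sum>t<j. F i t * F k t) = (if i = k then 1 else 0)"
        and F0: "F 0 = (\<lambda>t. w t / sqrt W)" by metis
    let ?f' = "\<lambda>x. ?f (\<lambda>p\<in>?idx. rot j F x p)"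
    have eq: "(\<integral>\<^sup>+x. ?f x \<partial>(\<Pi>\<^sub>M p\<in>?idx. std_normal)) = (\<integral>\<^sup>+x. ?f' x \<partial>(\<Pi>\<^sub>M p\<in>?idx. std_normal))"
      by (rule gauss_nn_integral[OF gauss_rot[OF F j(3)] fm, symmetric])
    have rm: "(\<lambda>x. \<lambda>p\<in>?idx. rot j F x p) \<in> measurable (\<Pi>\<^sub>M p\<in>?idx. borel) (\<Pi>\<^sub>M p\<in>?idx. borel)"
      using gauss_restrict_measurable[OF gauss_rot[OF F j(3)], of l]
      by (simp add: measurable_cong_sets[OF sets_PiM_std_normal refl])
    have f'm: "?f' \<in> borel_measurable (\<Pi>\<^sub>M p\<in>?idx. borel)"
      by (rule measurable_compose[OF rm fm])
    \<comment> \<open>Order of integration: the solution does not involve the rows of I, so these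
      are integrated first, then row 0. All other rows, among them rows 1 to j - 1, stay frozen in
      z.\<close>
    define Z where "Z = ({1..<n} - I) \<times> ?T"
    define Ya where "Ya = {0::nat} \<times> ?T"
    define Yb where "Yb = I \<times> ?T"
    have fin: "finite Z" "finite Ya" "finite Yb" using fI by (auto simp: Z_def Ya_def Yb_def)
    have U: "?idx = (Z \<union> Ya) \<union> Yb" using I j by (auto simp: Z_def Ya_def Yb_def)
    have disj: "(Z \<union> Ya) \<inter> Yb = {}" "Z \<inter> Ya = {}" using I j by (auto simp: Z_def Ya_def Yb_def)
    have f'm2: "?f' \<in> borel_measurable (\<Pi>\<^sub>M p\<in>(Z \<union> Ya) \<union> Yb. std_normal)"
      using f'm unfolding U by measurable
    let ?J = "\<lambda>x0. \<integral>\<^sup>+b. ?f' (merge (Z \<union> Ya) Yb (x0, b)) \<partial>(\<Pi>\<^sub>M p\<in>Yb. std_normal)"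
    have "(\<integral>\<^sup>+x. ?f' x \<partial>(\<Pi>\<^sub>M p\<in>?idx. std_normal)) = (\<integral>\<^sup>+x0. ?J x0 \<partial>(\<Pi>\<^sub>M p\<in>Z \<union> Ya. std_normal))"
      by (subst (1) U, rule std_normal_PiM.product_nn_integral_fold[OF disj(1) _ fin(3) f'm2]) (use fin in auto)
    also have "\<dots> \<le> ?C"
    proof (rule nn_integral_PiM_le[OF disj(2) fin(1,2)])
      have "(\<lambda>p. ?f' (merge (Z \<union> Ya) Yb p)) \<in> borel_measurable ((\<Pi>\<^sub>M p\<in>Z \<union> Ya. std_normal) \<Otimes>\<^sub>M (\<Pi>\<^sub>M p\<in>Yb. std_normal))"
        by (rule measurable_compose[OF measurable_merge f'm2])
      hence "?J \<in> borel_measurable (\<Pi>\<^sub>M p\<in>Z \<union> Ya. std_normal)"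
        by (intro sigma_finite_measure.borel_measurable_nn_integral[OF prob_space_imp_sigma_finite[OF prob_space_PiM_std_normal]]) (simp add: case_prod_unfold)
      thus "?J \<in> borel_measurable (\<Pi>\<^sub>M p\<in>Z \<union> Ya. borel)"
        by (simp add: measurable_cong_sets[OF sets_PiM_std_normal refl])
    next
      fix z :: "nat \<times> nat \<Rightarrow> real"
      \<comment> \<open>Rows 1 to j - 1 leave at least l - (j - 1) = d free dimensions; q is an
        orthonormal frame orthogonal to them, and it depends on z alone.\<close>
      have "j - 1 + d \<le> l" using j d by simp
      from orthonormal_complement[OF this, of "\<lambda>i t. z (Suc i, t)"] obtain q
        where "\<forall>i<d. \<forall>k<d. (\<Sum>t<l. q i t * q k t) = (if i = k then 1 else 0)"
          "\<forall>i<j - 1. \<forall>k<d. (\<Sum>t<l. z (Suc i, t) * q k t) = 0" by blast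
      hence q: "\<And>i k. i < d \<Longrightarrow> k < d \<Longrightarrow> (\<Sum>t<l. q i t * q k t) = (if i = k then 1 else 0)"
        "\<And>i k. i < j - 1 \<Longrightarrow> k < d \<Longrightarrow> (\<Sum>t<l. z (Suc i, t) * q k t) = 0" by auto
      define \<zeta> where "\<zeta> i a = (\<Sum>t<l. q i t * a (0, t))" for i and a :: "nat \<times> nat \<Rightarrow> real"
      have inner: "?J (merge Z Ya (z, a)) \<le>
         (\<integral>\<^sup>+x. indicator {x. W * (\<Sum>i\<in>I. (x i)\<^sup>2) \<ge> R\<^sup>2 * (\<Sum>i<d. (\<zeta> i a)\<^sup>2)} x \<partial>(\<Pi>\<^sub>M i\<in>I. std_normal))"
         (is "_ \<le> ?rhs") for a
      proof -
        let ?x0 = "merge Z Ya (z, a)"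
        define g where "g = rot j F ?x0"
        define h where "h = sol j l g w"
        define H where "H = (\<Sum>t<l. (h t)\<^sup>2)"
        have x0: "?x0 (0, t) = a (0, t)" if "t < l" for t
          using that by (simp add: merge_def Z_def Ya_def)
        have xz: "?x0 (i, t) = z (i, t)" if "1 \<le> i" "i < j" "t < l" for i t
          using that I j by (auto simp: merge_def Z_def)
        have xm: "merge (Z \<union> Ya) Yb (?x0, b) (i, t) = ?x0 (i, t)" if "i < j" "t < l" for b i t
          using that I j by (auto simp: merge_def Z_def Ya_def)
        have xb: "merge (Z \<union> Ya) Yb (?x0, b) (i, t) = b (i, t)" if "i \<in> I" "t < l" for b i t
          using that I j by (auto simp: merge_def Z_def Ya_def Yb_def)
        have g_eq: "(\<lambda>p\<in>?idx. rot j F (merge (Z \<union> Ya) Yb (?x0, b)) p) (i, t) = g (i, t)" if "i < j" "t < l" for b i t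
          using that j xm by (simp add: g_def rot_def)
        have b_eq: "(\<lambda>p\<in>?idx. rot j F (merge (Z \<union> Ya) Yb (?x0, b)) p) (i, t) = b (i, t)" if "i \<in> I" "t < l" for b i t
        proof -
          have "\<not> i < j" "i < n" using that I by auto
          thus ?thesis using that xb by (simp add: rot_def)
        qed
        have f'_eq: "?f' (merge (Z \<union> Ya) Yb (?x0, b)) = indicator {b. (\<Sum>i\<in>I. (\<Sum>t<l. b (i, t) * h t)\<^sup>2) \<ge> R\<^sup>2} b" for b
        proof -
          let ?y = "\<lambda>p\<in>?idx. rot j F (merge (Z \<union> Ya) Yb (?x0, b)) p"
          have "sol j l ?y w t = h t" if "t < l" for t
            unfolding h_def by (rule sol_cong) (use g_eq that in auto)
          hence "(\<Sum>i\<in>I. (\<Sum>t<l. ?y (i, t) * sol j l ?y w t)\<^sup>2) = (\<Sum>i\<in>I. (\<Sum>t<l. b (i, t) * h t)\<^sup>2)"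
            using b_eq by (intro sum.cong refl arg_cong[where f="\<lambda>x. x\<^sup>2"]) auto
          thus ?thesis by (simp add: indicator_def)
        qed
        show ?thesis
        proof (cases "H = 0")
          case True
          \<comment> \<open>This case includes the default value of \<open>sol\<close> at a singular
            Gram matrix; the event is empty because R > 0.\<close>
          hence "h t = 0" if "t < l" for t
            using that sum_nonneg_eq_0_iff[of "{..<l}" "\<lambda>t. (h t)\<^sup>2"] by (auto simp: H_def)
          hence "?J ?x0 = 0" unfolding f'_eq using R by (simp add: indicator_def)
          thus ?thesis by simp
        next
          case False
          hence Hp: "H > 0" using sum_nonneg[of "{..<l}" "\<lambda>t. (h t)\<^sup>2"] by (auto simp: H_def)
          have det: "det (gram j l g) \<noteq> 0"
          proof
            assume "det (gram j l g) = 0"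
            hence "h t = 0" for t by (simp add: h_def sol_def coef_def)
            thus False using False by (simp add: H_def)
          qed
          \<comment> \<open>The projection of row 0 onto the span of q, which is the vector u asked
            for by \<open>sol_norm_bound\<close>.\<close>
          define u where "u t = (\<Sum>i<d. \<zeta> i a * q i t)" for t
          have gc: "(\<Sum>b<j. c b * g (b, t)) = (\<Sum>i<j. (\<Sum>b<j. F i b * c b) * ?x0 (i, t))" for c t
            unfolding g_def rot_def sum_distrib_right
            by (simp add: sum_distrib_left) (subst sum.swap, simp add: mult_ac)
          have uz: "(\<Sum>t<l. u t * ?x0 (i, t)) = 0" if "1 \<le> i" "i < j" for i
          proof -
            have "(\<Sum>t<l. u t * ?x0 (i, t)) = (\<Sum>k<d. \<zeta> k a * (\<Sum>t<l. z (i, t) * q k t))"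
              using that xz unfolding u_def sum_distrib_right sum_distrib_left
              by (subst sum.swap) (intro sum.cong refl, auto simp: mult_ac)
            also have "\<dots> = 0" using q(2)[of "i - 1"] that by (intro sum.neutral) auto
            finally show ?thesis .
          qed
          have U2: "(\<Sum>t<l. (u t)\<^sup>2) = (\<Sum>i<d. (\<zeta> i a)\<^sup>2)"
          proof -
            have "(\<Sum>t<l. (u t)\<^sup>2) = (\<Sum>t<l. \<Sum>i<d. \<Sum>k<d. \<zeta> i a * \<zeta> k a * (q i t * q k t))"
              by (simp add: u_def power2_eq_square sum_product mult_ac)
            also have "\<dots> = (\<Sum>i<d. \<Sum>k<d. \<zeta> i a * \<zeta> k a * (\<Sum>t<l. q i t * q k t))"
              unfolding sum_distrib_left by (subst sum.swap, rule sum.cong, simp, subst sum.swap, simp)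
            also have "\<dots> = (\<Sum>i<d. \<Sum>k<d. if k = i then (\<zeta> i a)\<^sup>2 else 0)"
              by (intro sum.cong refl) (auto simp: q(1) power2_eq_square)
            finally show ?thesis by simp
          qed
          have "H * (\<Sum>t<l. (u t)\<^sup>2) \<le> W" unfolding H_def h_def
          proof (rule sol_norm_bound[OF det W_def Wp, where r = "\<lambda>t. a (0, t)"])
            fix t assume t: "t < l"
            have "(\<Sum>b<j. w b * g (b, t)) / sqrt W = (\<Sum>b<j. (w b / sqrt W) * g (b, t))"
              by (simp add: sum_divide_distrib)
            also have "\<dots> = (\<Sum>i<j. (\<Sum>b<j. F i b * F 0 b) * ?x0 (i, t))"
              unfolding gc F0 ..
            also have "\<dots> = (\<Sum>i<j. if i = 0 then ?x0 (i, t) else 0)"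
              using F j by (intro sum.cong refl) auto
            also have "\<dots> = a (0, t)" using j x0[OF t] by simp
            finally show "a (0, t) = (\<Sum>b<j. w b * g (b, t)) / sqrt W" by simp
          next
            fix c assume c: "(\<Sum>b<j. c b * w b) = 0"
            define \<phi> where "\<phi> i = (\<Sum>b<j. F i b * c b)" for i
            have \<phi>0: "\<phi> 0 = 0"
              using c by (simp add: \<phi>_def F0 sum_divide_distrib[symmetric] mult.commute)
            have "(\<Sum>t<l. u t * (\<Sum>b<j. c b * g (b, t))) = (\<Sum>i<j. \<phi> i * (\<Sum>t<l. u t * ?x0 (i, t)))"
              unfolding gc \<phi>_def[symmetric] sum_distrib_left by (subst sum.swap) (simp add: mult_ac)
            also have "\<dots> = 0"
            proof (intro sum.neutral ballI)
              fix i assume "i \<in> {..<j}"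
              thus "\<phi> i * (\<Sum>t<l. u t * ?x0 (i, t)) = 0" using \<phi>0 uz[of i] by (cases "i = 0") auto
            qed
            finally show "(\<Sum>t<l. u t * (\<Sum>b<j. c b * g (b, t))) = 0" .
          next
            have "(\<Sum>t<l. u t * a (0, t)) = (\<Sum>i<d. \<zeta> i a * (\<Sum>t<l. q i t * a (0, t)))"
              unfolding u_def sum_distrib_right sum_distrib_left by (subst sum.swap) (simp add: mult_ac)
            also have "\<dots> = (\<Sum>t<l. (u t)\<^sup>2)" unfolding U2 by (simp add: \<zeta>_def power2_eq_square)
            finally show "(\<Sum>t<l. u t * a (0, t)) = (\<Sum>t<l. (u t)\<^sup>2)" .
          qed
          hence HU: "H * (\<Sum>i<d. (\<zeta> i a)\<^sup>2) \<le> W" unfolding U2 .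
          have "?J ?x0 = (\<integral>\<^sup>+x. indicator {x. H * (\<Sum>i\<in>I. (x i)\<^sup>2) \<ge> R\<^sup>2} x \<partial>(\<Pi>\<^sub>M i\<in>I. std_normal))"
            unfolding f'_eq unfolding Yb_def by (rule gauss_rows_times_vector[OF fI H_def Hp])
          also have "\<dots> \<le> ?rhs"
          proof (intro nn_integral_mono)
            fix x :: "nat \<Rightarrow> real"
            let ?s = "\<Sum>i\<in>I. (x i)\<^sup>2" and ?z = "\<Sum>i<d. (\<zeta> i a)\<^sup>2"
            have "R\<^sup>2 * ?z \<le> W * ?s" if "R\<^sup>2 \<le> H * ?s"
            proof -
              have "R\<^sup>2 * ?z \<le> H * ?s * ?z" using that by (intro mult_right_mono) (auto simp: sum_nonneg)
              also have "\<dots> = (H * ?z) * ?s" by simp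
              also have "\<dots> \<le> W * ?s" using HU by (intro mult_right_mono) (auto simp: sum_nonneg)
              finally show ?thesis .
            qed
            thus "indicator {x. H * (\<Sum>i\<in>I. (x i)\<^sup>2) \<ge> R\<^sup>2} x
               \<le> (indicator {x. W * (\<Sum>i\<in>I. (x i)\<^sup>2) \<ge> R\<^sup>2 * (\<Sum>i<d. (\<zeta> i a)\<^sup>2)} x :: ennreal)"
              by (auto simp: indicator_def)
          qed
          finally show ?thesis .
        qed
      qed
      have g: "gauss (\<Pi>\<^sub>M p\<in>Ya. std_normal) {..<d} (\<lambda>i a. \<Sum>p\<in>Ya. q i (snd p) * a p)"
      proof (rule gauss_rotate[OF prob_space_PiM_std_normal gauss_PiM fin(2)])
        fix i k assume "i \<in> {..<d}" "k \<in> {..<d}"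
        moreover have "(\<Sum>p\<in>Ya. q i (snd p) * q k (snd p)) = (\<Sum>t<l. q i t * q k t)"
          by (simp add: Ya_def sum.cartesian_product[symmetric] case_prod_unfold[symmetric])
             (simp add: sum.cartesian_product')
        ultimately show "(\<Sum>p\<in>Ya. q i (snd p) * q k (snd p)) = (if i = k then 1 else 0)"
          using q(1) by simp
      qed simp
      have \<zeta>_eq: "(\<Sum>p\<in>Ya. q i (snd p) * a p) = \<zeta> i a" for i a
        by (simp add: Ya_def \<zeta>_def sum.cartesian_product')
      let ?K = "\<lambda>y. \<integral>\<^sup>+x. indicator {x. W * (\<Sum>i\<in>I. (x i)\<^sup>2) \<ge> R\<^sup>2 * (\<Sum>i<d. (y i)\<^sup>2)} x \<partial>(\<Pi>\<^sub>M i\<in>I. std_normal)"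
      have Km: "?K \<in> borel_measurable (\<Pi>\<^sub>M i\<in>{..<d}. borel)"
      proof -
        have eq2: "?K = (\<lambda>y. \<integral>\<^sup>+x. indicator {p. W * (\<Sum>i\<in>I. (snd p i)\<^sup>2) \<ge> R\<^sup>2 * (\<Sum>i<d. (fst p i)\<^sup>2)} (y, x) \<partial>(\<Pi>\<^sub>M i\<in>I. std_normal))"
          by (intro ext nn_integral_cong) (auto simp: indicator_def)
        have "(\<lambda>p. indicator {p. W * (\<Sum>i\<in>I. (snd p i)\<^sup>2) \<ge> R\<^sup>2 * (\<Sum>i<d. (fst p i)\<^sup>2)} p :: ennreal)
           \<in> borel_measurable ((\<Pi>\<^sub>M i\<in>{..<d}. std_normal) \<Otimes>\<^sub>M (\<Pi>\<^sub>M i\<in>I. std_normal))"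
          by (rule chi_ratio_measurable)
        hence "?K \<in> borel_measurable (\<Pi>\<^sub>M i\<in>{..<d}. std_normal)" unfolding eq2
          by (intro sigma_finite_measure.borel_measurable_nn_integral[OF prob_space_imp_sigma_finite[OF prob_space_PiM_std_normal]])
             (simp add: case_prod_unfold)
        thus ?thesis by (simp add: measurable_cong_sets[OF sets_PiM_std_normal refl])
      qed
      have "(\<integral>\<^sup>+a. ?J (merge Z Ya (z, a)) \<partial>(\<Pi>\<^sub>M p\<in>Ya. std_normal))
         \<le> (\<integral>\<^sup>+a. ?K (\<lambda>i\<in>{..<d}. \<Sum>p\<in>Ya. q i (snd p) * a p) \<partial>(\<Pi>\<^sub>M p\<in>Ya. std_normal))"
        using inner by (intro nn_integral_mono) (simp add: \<zeta>_eq)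
      also have "\<dots> = (\<integral>\<^sup>+y. ?K y \<partial>(\<Pi>\<^sub>M i\<in>{..<d}. std_normal))"
        by (rule gauss_nn_integral[OF g Km])
      also have "\<dots> \<le> ?C"
        using chi_ratio_tail[OF fI I(2) _ _ W0 R, of "{..<d}"] d by (simp add: lessThan_empty_iff)
      finally show "(\<integral>\<^sup>+a. ?J (merge Z Ya (z, a)) \<partial>(\<Pi>\<^sub>M p\<in>Ya. std_normal)) \<le> ?C" .
    qed
    finally show ?thesis unfolding eq W_def[symmetric] .
  qed
qed

text \<open>A null vector v of the larger Gram matrix gives a vanishing combination s of the rows,
  since |s|^2 is the quadratic form at v. Nonsingularity of the smaller matrix forces the last entry
  of v to be nonzero, so row k lies in the span of the others.\<close>

lemma gram_singular_Suc:
  fixes g :: "nat \<times> nat \<Rightarrow> real"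
  assumes s: "det (gram (Suc k) l g) = 0" and ns: "det (gram k l g) \<noteq> 0"
    and q: "\<And>i. i < k \<Longrightarrow> (\<Sum>t<l. g (i, t) * q t) = 0"
  shows "(\<Sum>t<l. q t * g (k, t)) = 0"
proof -
  obtain v where v: "v \<in> carrier_vec (Suc k)" "v \<noteq> 0\<^sub>v (Suc k)" "gram (Suc k) l g *\<^sub>v v = 0\<^sub>v (Suc k)"
    using det_0_iff_vec_prod_zero_field[OF gram_carrier, of "Suc k" l g] s by auto
  define s where "s t = (\<Sum>a<Suc k. v $ a * g (a, t))" for t
  have gs: "(\<Sum>t<l. g (i, t) * s t) = 0" if "i < Suc k" for i
  proof -
    have "(gram (Suc k) l g *\<^sub>v v) $ i = 0" using v(3) that by simp
    hence "(\<Sum>a<Suc k. (\<Sum>t<l. g (i, t) * g (a, t)) * v $ a) = 0"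
      using v(1) that by (simp add: gram_def scalar_prod_def atLeast0LessThan)
    also have "(\<Sum>a<Suc k. (\<Sum>t<l. g (i, t) * g (a, t)) * v $ a) = (\<Sum>t<l. g (i, t) * s t)"
      unfolding s_def sum_distrib_right sum_distrib_left by (subst sum.swap) (simp add: mult_ac)
    finally show ?thesis .
  qed
  have "(\<Sum>t<l. (s t)\<^sup>2) = (\<Sum>a<Suc k. v $ a * (\<Sum>t<l. g (a, t) * s t))"
    unfolding power2_eq_square by (subst (1) s_def)
      (simp only: sum_distrib_right sum_distrib_left, subst sum.swap, simp only: mult.assoc)
  hence "(\<Sum>t<l. (s t)\<^sup>2) = 0" using gs by simp
  hence s0: "s t = 0" if "t < l" for t
    using that sum_nonneg_eq_0_iff[of "{..<l}" "\<lambda>t. (s t)\<^sup>2"] by auto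
  have vk: "v $ k \<noteq> 0"
  proof
    assume vk: "v $ k = 0"
    define v' where "v' = Matrix.vec k (\<lambda>i. v $ i)"
    have "v' \<noteq> 0\<^sub>v k"
    proof
      assume z: "v' = 0\<^sub>v k"
      have "v $ i = 0" if "i < Suc k" for i
        using z vk that by (cases "i = k") (auto simp: v'_def dest: arg_cong[where f="\<lambda>x. x $ i"])
      thus False using v by (auto simp: eq_vecI)
    qed
    moreover have "gram k l g *\<^sub>v v' = 0\<^sub>v k"
    proof (rule eq_vecI)
      fix i assume i: "i < dim_vec (0\<^sub>v k :: real vec)"
      have "(\<Sum>a<k. (\<Sum>t<l. g (i, t) * g (a, t)) * v $ a) = (\<Sum>t<l. g (i, t) * s t)"
        unfolding s_def sum_distrib_right sum_distrib_left by (subst sum.swap) (simp add: mult_ac vk)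
      also have "\<dots> = 0" using i by (intro gs) simp
      finally show "(gram k l g *\<^sub>v v') $ i = 0\<^sub>v k $ i"
        using i by (simp add: gram_def v'_def scalar_prod_def atLeast0LessThan)
    qed (simp add: gram_def)
    moreover have "v' \<in> carrier_vec k" by (simp add: v'_def)
    ultimately show False
      using det_0_iff_vec_prod_zero_field[OF gram_carrier, of k l g] ns by blast
  qed
  have "0 = (\<Sum>t<l. q t * s t)" using s0 by simp
  also have "\<dots> = (\<Sum>a<Suc k. v $ a * (\<Sum>t<l. g (a, t) * q t))"
    unfolding s_def sum_distrib_left by (subst sum.swap) (simp only: mult_ac)
  also have "\<dots> = v $ k * (\<Sum>t<l. g (k, t) * q t)" using q by simp
  finally show ?thesis using vk by (simp add: mult.commute)
qed

lemma std_normal_singleton_integral: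
  assumes "f \<in> borel_measurable borel"
  shows "(\<integral>\<^sup>+x. f (x i) \<partial>(\<Pi>\<^sub>M i\<in>{i}. std_normal)) = (\<integral>\<^sup>+y. f y \<partial>std_normal)"
  by (rule std_normal_PiM.product_nn_integral_singleton) (use assms in simp)

lemma gauss_direction:
  fixes c :: "'i \<Rightarrow> real"
  assumes M: "prob_space M" and g: "gauss M R X" and R: "finite R" and c: "(\<Sum>r\<in>R. (c r)\<^sup>2) = 1"
    and f: "f \<in> borel_measurable borel"
  shows "(\<integral>\<^sup>+\<omega>. f (\<Sum>r\<in>R. c r * X r \<omega>) \<partial>M) = (\<integral>\<^sup>+y. f y \<partial>std_normal)"
proof -
  have g1: "gauss M {()} (\<lambda>_ \<omega>. \<Sum>r\<in>R. c r * X r \<omega>)"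
    by (rule gauss_rotate[OF M g R]) (use c in \<open>auto simp: power2_eq_square\<close>)
  have fm: "(\<lambda>x. f (x ())) \<in> borel_measurable (\<Pi>\<^sub>M i\<in>{()}. borel)" using f by measurable
  have "(\<integral>\<^sup>+\<omega>. f (\<Sum>r\<in>R. c r * X r \<omega>) \<partial>M)
      = (\<integral>\<^sup>+\<omega>. f ((\<lambda>i\<in>{()}. \<Sum>r\<in>R. c r * X r \<omega>) ()) \<partial>M)" by simp
  also have "\<dots> = (\<integral>\<^sup>+x. f (x ()) \<partial>(\<Pi>\<^sub>M i\<in>{()}. std_normal))"
    by (rule gauss_nn_integral[OF g1 fm])
  also have "\<dots> = (\<integral>\<^sup>+y. f y \<partial>std_normal)" by (rule std_normal_singleton_integral[OF f])
  finally show ?thesis .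
qed

text \<open>Rows are added one at a time. With all rows but row k frozen, some unit vector q is
  orthogonal to the first k rows because k < l; singularity at this step forces the product of q
  with row k, a standard normal variable, to be exactly 0.\<close>

lemma gram_singular_null:
  assumes "k \<le> l" "k \<le> n"
  shows "(\<integral>\<^sup>+x. indicator {x. det (gram k l x) = 0} x \<partial>(\<Pi>\<^sub>M p\<in>{..<n} \<times> {..<l}. std_normal)) = 0"
  using assms
proof (induction k)
  case 0
  have "det (gram 0 l x) = 1" for x by (rule det_dim_zero) (rule gram_carrier)
  thus ?case by simp
next
  case (Suc k)
  let ?idx = "{..<n} \<times> {..<l}"
  let ?P = "\<Pi>\<^sub>M p\<in>?idx. std_normal"
  have cm: "(\<lambda>x. x (a, t)) \<in> borel_measurable (\<Pi>\<^sub>M p\<in>?idx. borel :: real measure)"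
    if "a < n" "t < l" for a t
    using that by (intro measurable_component_singleton) auto
  have dm: "(\<lambda>x. det (gram m l x)) \<in> borel_measurable (\<Pi>\<^sub>M p\<in>?idx. borel)" if "m \<le> n" for m
    using that by (intro gram_measurable cm) auto
  have [measurable]: "(\<lambda>x. det (gram k l x)) \<in> borel_measurable (\<Pi>\<^sub>M p\<in>?idx. borel)"
    "(\<lambda>x. det (gram (Suc k) l x)) \<in> borel_measurable (\<Pi>\<^sub>M p\<in>?idx. borel)"
    using Suc.prems by (auto intro!: dm)
  let ?f = "\<lambda>x. indicator {x. det (gram (Suc k) l x) = 0 \<and> det (gram k l x) \<noteq> 0} x :: ennreal"
  have fm: "?f \<in> borel_measurable (\<Pi>\<^sub>M p\<in>?idx. borel)" by measurable
  define Z where "Z = ({..<n} - {k}) \<times> {..<l}"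
  define Y where "Y = {k} \<times> {..<l}"
  have U: "?idx = Z \<union> Y" using Suc.prems by (auto simp: Z_def Y_def)
  have disj: "Z \<inter> Y = {}" "finite Z" "finite Y" by (auto simp: Z_def Y_def)
  have "(\<integral>\<^sup>+x. ?f x \<partial>(\<Pi>\<^sub>M p\<in>Z \<union> Y. std_normal)) \<le> 0"
  proof (rule nn_integral_PiM_le[OF disj])
    show "?f \<in> borel_measurable (\<Pi>\<^sub>M i\<in>Z \<union> Y. borel)" using fm unfolding U .
    fix z :: "nat \<times> nat \<Rightarrow> real"
    obtain q where q: "(\<Sum>t<l. (q t)\<^sup>2) = 1" "\<And>i. i < k \<Longrightarrow> (\<Sum>t<l. z (i, t) * q t) = 0"
      using orthogonal_unit_vector[of k l "\<lambda>i t. z (i, t)"] Suc.prems by auto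
    have "(\<integral>\<^sup>+y. ?f (merge Z Y (z, y)) \<partial>(\<Pi>\<^sub>M p\<in>Y. std_normal))
       \<le> (\<integral>\<^sup>+y. indicator {0} (\<Sum>p\<in>Y. q (snd p) * y p) \<partial>(\<Pi>\<^sub>M p\<in>Y. std_normal))"
    proof (rule nn_integral_mono)
      fix y
      let ?x = "merge Z Y (z, y)"
      have xz: "?x (i, t) = z (i, t)" if "i < k" "t < l" for i t
        using that Suc.prems by (auto simp: merge_def Z_def)
      have xy: "?x (k, t) = y (k, t)" if "t < l" for t
        using that by (auto simp: merge_def Z_def Y_def)
      have "(\<Sum>p\<in>Y. q (snd p) * y p) = (\<Sum>t<l. q t * y (k, t))"
        by (simp add: Y_def sum.cartesian_product')
      also have "\<dots> = (\<Sum>t<l. q t * ?x (k, t))" using xy by simp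
      finally have "(\<Sum>p\<in>Y. q (snd p) * y p) = (\<Sum>t<l. q t * ?x (k, t))" .
      moreover have "(\<Sum>t<l. q t * ?x (k, t)) = 0"
        if "det (gram (Suc k) l ?x) = 0" "det (gram k l ?x) \<noteq> 0"
      proof (rule gram_singular_Suc[OF that])
        fix i assume "i < k"
        thus "(\<Sum>t<l. ?x (i, t) * q t) = 0" using q(2)[of i] xz by simp
      qed
      ultimately show "?f ?x \<le> indicator {0} (\<Sum>p\<in>Y. q (snd p) * y p)"
        by (auto simp: indicator_def)
    qed
    also have "\<dots> = (\<integral>\<^sup>+y. indicator {0} y \<partial>std_normal)"
      by (rule gauss_direction[OF prob_space_PiM_std_normal gauss_PiM disj(3)])
         (use q(1) in \<open>simp_all add: Y_def sum.cartesian_product'\<close>)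
    also have "\<dots> = (\<integral>\<^sup>+y. ennreal (std_normal_density y) * indicator {0} y \<partial>lborel)"
      by (subst nn_integral_density) auto
    also have "\<dots> = 0"
    proof -
      have "AE y in lborel. ennreal (std_normal_density y) * indicator {0} y = 0"
        using AE_lborel_singleton[of "0::real"] by eventually_elim auto
      thus ?thesis by (subst nn_integral_0_iff_AE) auto
    qed
    finally show "(\<integral>\<^sup>+y. ?f (merge Z Y (z, y)) \<partial>(\<Pi>\<^sub>M p\<in>Y. std_normal)) \<le> 0" .
  qed
  hence f0: "(\<integral>\<^sup>+x. ?f x \<partial>?P) = 0" unfolding U by simp
  have "(\<integral>\<^sup>+x. indicator {x. det (gram (Suc k) l x) = 0} x \<partial>?P)
     \<le> (\<integral>\<^sup>+x. indicator {x. det (gram k l x) = 0} x + ?f x \<partial>?P)"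
    by (intro nn_integral_mono) (auto simp: indicator_def)
  also have "\<dots> = (\<integral>\<^sup>+x. indicator {x. det (gram k l x) = 0} x \<partial>?P) + (\<integral>\<^sup>+x. ?f x \<partial>?P)"
    by (rule nn_integral_add) measurable
  also have "\<dots> = 0" using f0 Suc by simp
  finally show ?case by simp
qed

text \<open>The factor exp (d / 2) = sqrt e ^ d in 1 / p joins sqrt (e / d) ^ d from
  \<open>ball_const_le\<close> and 1 / sqrt d ^ d from the threshold; together they form (e / d) ^
  d.\<close>

lemma block_constant:
  fixes d :: nat and a b Y :: real
  assumes d: "d \<ge> 2" and Y: "Y > 0" and ab: "a \<ge> 0" "b \<ge> 0"
  defines "p \<equiv> sqrt (2 / pi) * exp (- (sqrt (real d))\<^sup>2 / 2) * sqrt (real d) / ((sqrt (real d))\<^sup>2 + 1)"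
  shows "ball_const d / (sqrt (real d) * sqrt Y) ^ d * sqrt a ^ d * sqrt b ^ d / p
     \<le> (exp 1 / real d) ^ d * (sqrt (pi / 2) * (real d + 1) / (exp 1 * sqrt (real d))) * sqrt (a * b / Y) ^ d"
proof -
  have dp: "real d > 0" using d by simp
  have e: "exp (real d / 2) = sqrt (exp 1) ^ d"
  proof -
    have "sqrt (exp 1) = exp (1 / 2 :: real)"
      by (rule real_sqrt_unique) (simp_all add: exp_double[symmetric])
    thus ?thesis by (simp add: exp_of_nat_mult[symmetric])
  qed
  have p: "1 / p = sqrt (pi / 2) * (real d + 1) / sqrt (real d) * sqrt (exp 1) ^ d"
    unfolding p_def e[symmetric] using dp
    by (simp add: exp_minus real_sqrt_divide field_simps)
  have pp: "p > 0" unfolding p_def using dp by (auto intro!: divide_pos_pos mult_pos_pos add_pos_pos)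
  have "ball_const d / (sqrt (real d) * sqrt Y) ^ d * sqrt a ^ d * sqrt b ^ d / p
      = ball_const d * (sqrt a ^ d * sqrt b ^ d / (sqrt (real d) * sqrt Y) ^ d * (1 / p))" by simp
  also have "\<dots> \<le> sqrt (exp 1 / real d) ^ d / exp 1 * (sqrt a ^ d * sqrt b ^ d / (sqrt (real d) * sqrt Y) ^ d * (1 / p))"
    using ab Y pp by (intro mult_right_mono ball_const_le[OF d]) auto
  also have "\<dots> = (sqrt (exp 1 / real d) * sqrt (exp 1) / sqrt (real d)) ^ d * (sqrt (pi / 2) * (real d + 1) / (exp 1 * sqrt (real d)))
      * (sqrt a * sqrt b / sqrt Y) ^ d"
    unfolding p using dp Y by (simp add: power_mult_distrib power_divide mult_ac)
  also have "sqrt (exp 1 / real d) * sqrt (exp 1) / sqrt (real d) = exp 1 / real d"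
  proof -
    have "sqrt (exp 1 / real d) * sqrt (exp 1) / sqrt (real d) = (sqrt (exp 1) * sqrt (exp 1)) / (sqrt (real d) * sqrt (real d))"
      by (simp add: real_sqrt_divide)
    thus ?thesis using dp by simp
  qed
  also have "sqrt a * sqrt b / sqrt Y = sqrt (a * b / Y)" by (simp add: real_sqrt_mult real_sqrt_divide)
  finally show ?thesis .
qed

text \<open>Passage from one right-hand side to all of them: average over an auxiliary Gaussian right-hand
  side. If \<open>G' sol\<close> is large at a single unit vector, it is large outside a slab of right-hand sides, a set whose
  Gaussian mass is bounded below by a Mills-type estimate.\<close>

lemma gauss_block_bound:
  fixes X :: "nat \<times> nat \<Rightarrow> 'w \<Rightarrow> real"
  assumes M: "prob_space M" and g: "gauss M ({..<n} \<times> {..<l}) X"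
    and j: "0 < j" "j < l" "j \<le> n" and I: "I \<subseteq> {j..<n}" "I \<noteq> {}" and Y: "Y > 0"
    and d: "d = l - j + 1"
  defines "S \<equiv> \<lambda>\<omega> w. \<Sum>i\<in>I. (\<Sum>t<l. X (i, t) \<omega> * sol j l (\<lambda>p. X p \<omega>) w t)\<^sup>2"
  shows "\<exists>E\<in>sets M. emeasure M (space M - E) \<le> ennreal ((exp 1 / real d) ^ d *
       (sqrt (pi / 2) * (real d + 1) / (exp 1 * sqrt (real d))) *
       sqrt ((real j + (real d - 1) / 2) * (real (card I) + (real d - 1) / 2) / Y) ^ d) \<and>
     (\<forall>\<omega>\<in>E. \<forall>e. S \<omega> e \<le> Y * (\<Sum>a<j. (e a)\<^sup>2))"
proof -
  interpret prob_space M by fact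
  let ?idx = "{..<n} \<times> {..<l}"
  let ?\<mu> = "\<Pi>\<^sub>M a\<in>{..<j}. std_normal"
  interpret P: pair_sigma_finite M ?\<mu> by standard
  have fI: "finite I" using I(1) finite_subset by auto
  have d2: "d \<ge> 2" using d j by simp
  \<comment> \<open>The threshold is a free parameter; s = sqrt d minimises s ^ (- d) * exp (s^2 /
    2), the dominant part of R ^ (- d) / p.\<close>
  define s where "s = sqrt (real d)"
  define R where "R = s * sqrt Y"
  have s1: "s \<ge> 1" using d2 by (simp add: s_def)
  have R: "R > 0" using s1 Y by (simp add: R_def)
  have R2: "R\<^sup>2 = s\<^sup>2 * Y" using Y by (simp add: R_def power_mult_distrib)
  define p where "p = sqrt (2 / pi) * exp (- s\<^sup>2 / 2) * s / (s\<^sup>2 + 1)"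
  have pp: "p > 0" unfolding p_def using s1 by (auto intro!: divide_pos_pos mult_pos_pos add_pos_pos)
  have Xm: "X q \<in> borel_measurable M" if "q \<in> ?idx" for q by (rule gauss_measurable[OF g that])
  have Sm: "(\<lambda>q. S (fst q) (snd q)) \<in> borel_measurable (M \<Otimes>\<^sub>M ?\<mu>)"
  proof -
    have x: "(\<lambda>q. X (a, t) (fst q)) \<in> borel_measurable (M \<Otimes>\<^sub>M ?\<mu>)" if "a < n" "t < l" for a t
      using that by (intro measurable_compose[OF measurable_fst Xm]) auto
    have w: "(\<lambda>q. snd q b) \<in> borel_measurable (M \<Otimes>\<^sub>M ?\<mu>)" if "b < j" for b
    proof (rule measurable_compose[OF measurable_snd])
      show "(\<lambda>w. w b) \<in> borel_measurable ?\<mu>"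
        using gauss_measurable[OF gauss_PiM, of b "{..<j}"] that by simp
    qed
    show ?thesis unfolding S_def
      using I j by (intro borel_measurable_sum borel_measurable_power borel_measurable_times x sol_measurable w) auto
  qed
  let ?ind = "\<lambda>\<omega> w. indicator {q. S (fst q) (snd q) \<ge> R\<^sup>2} (\<omega>, w) :: ennreal"
  have im: "(\<lambda>q. indicator {q. S (fst q) (snd q) \<ge> R\<^sup>2} q :: ennreal) \<in> borel_measurable (M \<Otimes>\<^sub>M ?\<mu>)"
    using Sm by measurable
  define \<Phi> where "\<Phi> \<omega> = (\<integral>\<^sup>+w. ?ind \<omega> w \<partial>?\<mu>)" for \<omega>
  have \<Phi>m[measurable]: "\<Phi> \<in> borel_measurable M"
    unfolding \<Phi>_def by (intro sigma_finite_measure.borel_measurable_nn_integral[OF prob_space_imp_sigma_finite[OF prob_space_PiM_std_normal]]) (use im in \<open>simp add: case_prod_unfold\<close>)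
  let ?K = "\<integral>\<^sup>+x. ennreal (sqrt (\<Sum>i\<in>I. (x i)\<^sup>2) ^ d) \<partial>(\<Pi>\<^sub>M i\<in>I. std_normal)"
  let ?a = "real j + (real d - 1) / 2" and ?b = "real (card I) + (real d - 1) / 2"
  have K: "?K \<le> ennreal (sqrt ?b ^ d)" by (rule gauss_norm_moment[OF fI I(2)]) (use d2 in simp)
  have a0: "?a \<ge> 0" "?b \<ge> 0" using d2 by auto
  have \<Phi>int: "(\<integral>\<^sup>+\<omega>. \<Phi> \<omega> \<partial>M) \<le> ennreal (ball_const d / R ^ d * sqrt ?a ^ d * sqrt ?b ^ d)"
  proof -
    have "(\<integral>\<^sup>+\<omega>. \<Phi> \<omega> \<partial>M) = (\<integral>\<^sup>+w. (\<integral>\<^sup>+\<omega>. ?ind \<omega> w \<partial>M) \<partial>?\<mu>)"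
      unfolding \<Phi>_def by (rule P.Fubini'[symmetric]) (use im in \<open>simp add: case_prod_unfold\<close>)
    also have "\<dots> \<le> (\<integral>\<^sup>+w. ennreal (ball_const d / R ^ d * sqrt ?b ^ d) * ennreal (sqrt (\<Sum>a<j. (w a)\<^sup>2) ^ d) \<partial>?\<mu>)"
    proof (rule nn_integral_mono)
      fix w
      let ?f = "\<lambda>x. indicator {x. (\<Sum>i\<in>I. (\<Sum>t<l. x (i, t) * sol j l x w t)\<^sup>2) \<ge> R\<^sup>2} x :: ennreal"
      have fm: "?f \<in> borel_measurable (\<Pi>\<^sub>M p\<in>?idx. borel)"
        by (rule sol_event_measurable[OF j(3) I(1)])
      have "(\<integral>\<^sup>+\<omega>. ?ind \<omega> w \<partial>M) = (\<integral>\<^sup>+\<omega>. ?f (\<lambda>p\<in>?idx. X p \<omega>) \<partial>M)"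
      proof (rule nn_integral_cong)
        fix \<omega>
        let ?x = "\<lambda>p\<in>?idx. X p \<omega>"
        have "sol j l ?x w t = sol j l (\<lambda>p. X p \<omega>) w t" if "t < l" for t
          by (rule sol_cong) (use that j in auto)
        hence "(\<Sum>i\<in>I. (\<Sum>t<l. ?x (i, t) * sol j l ?x w t)\<^sup>2) = S \<omega> w"
          unfolding S_def using I by (intro sum.cong refl arg_cong[where f="\<lambda>x. x\<^sup>2"]) auto
        thus "?ind \<omega> w = ?f ?x" by (simp add: indicator_def)
      qed
      also have "\<dots> = (\<integral>\<^sup>+x. ?f x \<partial>(\<Pi>\<^sub>M p\<in>?idx. std_normal))"
        by (rule gauss_nn_integral[OF g fm])
      also have "\<dots> \<le> ennreal (ball_const d * (sqrt (\<Sum>a<j. (w a)\<^sup>2) / R) ^ d) * ?K"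
        by (rule sol_tail_fixed_rhs[OF j(1) _ j(3) I R d]) (use j in simp)
      also have "\<dots> \<le> ennreal (ball_const d * (sqrt (\<Sum>a<j. (w a)\<^sup>2) / R) ^ d) * ennreal (sqrt ?b ^ d)"
        by (intro mult_left_mono K) simp
      also have "\<dots> = ennreal (ball_const d / R ^ d * sqrt ?b ^ d) * ennreal (sqrt (\<Sum>a<j. (w a)\<^sup>2) ^ d)"
        using a0 R by (subst (1 2) ennreal_mult[symmetric])
          (auto simp: ball_const_nonneg sum_nonneg power_divide mult_ac)
      finally show "(\<integral>\<^sup>+\<omega>. ?ind \<omega> w \<partial>M) \<le> \<dots>" .
    qed
    also have "\<dots> = ennreal (ball_const d / R ^ d * sqrt ?b ^ d) * (\<integral>\<^sup>+w. ennreal (sqrt (\<Sum>a<j. (w a)\<^sup>2) ^ d) \<partial>?\<mu>)"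
      by (rule nn_integral_cmult) measurable
    also have "\<dots> \<le> ennreal (ball_const d / R ^ d * sqrt ?b ^ d) * ennreal (sqrt ?a ^ d)"
      using gauss_norm_moment[of "{..<j}" d] j d2 by (intro mult_left_mono) (auto simp: lessThan_empty_iff)
    also have "\<dots> = ennreal (ball_const d / R ^ d * sqrt ?a ^ d * sqrt ?b ^ d)"
      using a0 R by (subst ennreal_mult[symmetric]) (auto simp: ball_const_nonneg mult_ac)
    finally show ?thesis .
  qed
  \<comment> \<open>Outside E at least the fraction p of all right-hand sides w is bad, and Markov's
    inequality for \<Phi> bounds the probability of this.\<close>
  define E where "E = {\<omega> \<in> space M. \<Phi> \<omega> < ennreal p}"
  have Em: "E \<in> sets M" unfolding E_def by measurable
  have "emeasure M (space M - E) \<le> ennreal (ball_const d / R ^ d * sqrt ?a ^ d * sqrt ?b ^ d / p)"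
  proof -
    have "space M - E = {\<omega> \<in> space M. 1 \<le> ennreal (1 / p) * \<Phi> \<omega>}"
    proof -
      have iff: "(ennreal p \<le> x) = (1 \<le> ennreal (1 / p) * x)" for x
      proof
        assume "ennreal p \<le> x"
        hence "ennreal (1 / p) * ennreal p \<le> ennreal (1 / p) * x" by (intro mult_left_mono) auto
        thus "1 \<le> ennreal (1 / p) * x" using pp by (simp add: ennreal_mult[symmetric])
      next
        assume "1 \<le> ennreal (1 / p) * x"
        hence "ennreal p * 1 \<le> ennreal p * (ennreal (1 / p) * x)" by (intro mult_left_mono) auto
        also have "\<dots> = x" using pp by (simp add: mult.assoc[symmetric] ennreal_mult[symmetric])
        finally show "ennreal p \<le> x" by simp
      qed
      have "space M - E = {\<omega> \<in> space M. ennreal p \<le> \<Phi> \<omega>}" by (auto simp: E_def not_less)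
      thus ?thesis unfolding iff .
    qed
    also have "emeasure M \<dots> \<le> ennreal (1 / p) * (\<integral>\<^sup>+\<omega>. \<Phi> \<omega> * indicator (space M) \<omega> \<partial>M)"
      by (rule nn_integral_Markov_inequality) auto
    also have "(\<integral>\<^sup>+\<omega>. \<Phi> \<omega> * indicator (space M) \<omega> \<partial>M) = (\<integral>\<^sup>+\<omega>. \<Phi> \<omega> \<partial>M)"
      by (intro nn_integral_cong) auto
    also have "ennreal (1 / p) * \<dots> \<le> ennreal (1 / p) * ennreal (ball_const d / R ^ d * sqrt ?a ^ d * sqrt ?b ^ d)"
      by (intro mult_left_mono \<Phi>int) simp
    also have "\<dots> = ennreal (ball_const d / R ^ d * sqrt ?a ^ d * sqrt ?b ^ d / p)"
      using pp a0 R by (subst ennreal_mult[symmetric]) (auto simp: ball_const_nonneg)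
    finally show ?thesis .
  qed
  also have "\<dots> \<le> ennreal ((exp 1 / real d) ^ d *
       (sqrt (pi / 2) * (real d + 1) / (exp 1 * sqrt (real d))) * sqrt (?a * ?b / Y) ^ d)"
    using block_constant[OF d2 Y a0] unfolding p_def R_def s_def by (intro ennreal_leI)
  finally have P1: "emeasure M (space M - E) \<le> \<dots>" .
  moreover have "S \<omega> e \<le> Y * (\<Sum>a<j. (e a)\<^sup>2)" if \<omega>: "\<omega> \<in> E" for \<omega> e
  proof (rule ccontr)
    assume "\<not> S \<omega> e \<le> Y * (\<Sum>a<j. (e a)\<^sup>2)"
    hence gt: "S \<omega> e > Y * (\<Sum>a<j. (e a)\<^sup>2)" by simp
    define \<beta> where "\<beta> i b = (\<Sum>t<l. X (i, t) \<omega> * sol j l (\<lambda>p. X p \<omega>) (\<lambda>c. if c = b then 1 else 0) t)" for i b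
    have B: "(\<Sum>t<l. X (i, t) \<omega> * sol j l (\<lambda>p. X p \<omega>) w t) = (\<Sum>b<j. w b * \<beta> i b)" for i w
      unfolding \<beta>_def sum_distrib_left by (subst sol_linear, subst sum.swap)
        (simp add: sum_distrib_left mult_ac)
    have S: "S \<omega> w = (\<Sum>i\<in>I. (\<Sum>b<j. w b * \<beta> i b)\<^sup>2)" for w by (simp add: S_def B)
    define z where "z i = (\<Sum>b<j. e b * \<beta> i b)" for i
    define N where "N = (\<Sum>i\<in>I. (z i)\<^sup>2)"
    have NS: "N = S \<omega> e" by (simp add: N_def z_def S)
    \<comment> \<open>c is the transpose of the matrix \<beta> applied to the image z of e. So (c .
      w)^2 <= N * S \<omega> w, while c . e = N and the assumption on e force |c|^2 >= N Y. Every w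
      whose component along c is at least s in absolute value is therefore bad.\<close>
    define c where "c b = (\<Sum>i\<in>I. z i * \<beta> i b)" for b
    have cw: "(\<Sum>b<j. c b * w b) = (\<Sum>i\<in>I. z i * (\<Sum>b<j. w b * \<beta> i b))" for w
      unfolding c_def sum_distrib_left sum_distrib_right by (subst sum.swap) (simp add: mult_ac)
    have e0: "(\<Sum>a<j. (e a)\<^sup>2) \<ge> 0" by (simp add: sum_nonneg)
    have Np: "N > 0" using gt e0 Y unfolding NS[symmetric] by (smt (verit) mult_nonneg_nonneg)
    define C where "C = (\<Sum>b<j. (c b)\<^sup>2)"
    have "(\<Sum>b<j. c b * e b) = N" unfolding cw N_def by (simp add: z_def[symmetric] power2_eq_square)
    hence NC: "N * N \<le> C * (\<Sum>a<j. (e a)\<^sup>2)"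
      using sum_square_Cauchy[of c e "{..<j}"] by (simp add: C_def power2_eq_square)
    have C0: "C \<ge> 0" by (simp add: C_def sum_nonneg)
    have "C \<noteq> 0" using NC Np by (auto simp: mult_le_0_iff)
    hence Cp: "C > 0" using C0 by simp
    have CN: "C \<ge> N * Y"
    proof (rule ccontr)
      assume "\<not> C \<ge> N * Y"
      hence "C * (\<Sum>a<j. (e a)\<^sup>2) \<le> N * Y * (\<Sum>a<j. (e a)\<^sup>2)" using e0 by (intro mult_right_mono) auto
      also have "\<dots> = N * (Y * (\<Sum>a<j. (e a)\<^sup>2))" by simp
      also have "\<dots> < N * N" using gt Np by (simp add: NS)
      finally show False using NC by simp
    qed
    have key: "indicator {x. \<bar>x\<bar> \<ge> s} (\<Sum>b<j. c b / sqrt C * w b) \<le> ?ind \<omega> w" for w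
    proof -
      have "S \<omega> w \<ge> R\<^sup>2" if "\<bar>\<Sum>b<j. c b / sqrt C * w b\<bar> \<ge> s"
      proof -
        have "s\<^sup>2 \<le> (\<Sum>b<j. c b / sqrt C * w b)\<^sup>2" using that s1
          by (metis abs_le_square_iff abs_of_nonneg order_trans zero_le_one)
        also have "(\<Sum>b<j. c b / sqrt C * w b) = (\<Sum>b<j. c b * w b) / sqrt C"
          by (simp add: sum_divide_distrib)
        also have "\<dots>\<^sup>2 = (\<Sum>b<j. c b * w b)\<^sup>2 / C" using Cp by (simp add: power_divide)
        finally have 1: "s\<^sup>2 * C \<le> (\<Sum>b<j. c b * w b)\<^sup>2" using Cp by (simp add: field_simps)
        have "s\<^sup>2 * (N * Y) \<le> s\<^sup>2 * C" using CN by (intro mult_left_mono) auto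
        also note 1
        also have "(\<Sum>b<j. c b * w b)\<^sup>2 \<le> N * S \<omega> w"
          unfolding cw S N_def by (rule sum_square_Cauchy)
        finally have "N * (s\<^sup>2 * Y) \<le> N * S \<omega> w" by (simp add: mult_ac)
        thus ?thesis using Np by (simp add: R2)
      qed
      thus ?thesis by (auto simp: indicator_def)
    qed
    have "(\<Sum>b<j. (c b / sqrt C)\<^sup>2) = 1"
      using Cp by (simp add: power_divide sum_divide_distrib[symmetric] C_def[symmetric])
    have "ennreal p \<le> emeasure std_normal {x. \<bar>x\<bar> \<ge> s}"
      unfolding p_def by (rule std_normal_tail_lower[OF s1])
    also have "\<dots> = (\<integral>\<^sup>+y. indicator {x. \<bar>x\<bar> \<ge> s} y \<partial>std_normal)" by simp
    also have "\<dots> = (\<integral>\<^sup>+w. indicator {x. \<bar>x\<bar> \<ge> s} (\<Sum>b<j. c b / sqrt C * w b) \<partial>?\<mu>)"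
      by (rule gauss_direction[OF prob_space_PiM_std_normal gauss_PiM, symmetric])
         (use \<open>(\<Sum>b<j. (c b / sqrt C)\<^sup>2) = 1\<close> in auto)
    also have "\<dots> \<le> \<Phi> \<omega>" unfolding \<Phi>_def by (intro nn_integral_mono key)
    finally show False using \<omega> by (auto simp: E_def dest: leD)
  qed
  ultimately show ?thesis using Em by blast
qed

section \<open>Numerical estimates behind the constants of the good event\<close>

lemma geometric_decay:
  fixes q :: real
  assumes "d \<ge> 2" "0 \<le> q" "q \<le> 1 / 4"
  shows "(real d + 1) * sqrt q ^ d \<le> 3 * q"
  using assms(1)
proof (induction d rule: nat_induct_at_least)
  case base
  thus ?case using assms by simp
next
  case (Suc d)
  have s: "0 \<le> sqrt q" "sqrt q \<le> 1 / 2"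
  proof -
    have "sqrt q \<le> sqrt ((1 / 2)\<^sup>2)" using assms by (intro real_sqrt_le_mono) (simp add: power2_eq_square)
    thus "sqrt q \<le> 1 / 2" by simp
  qed (use assms in simp)
  \<comment> \<open>Equality holds for d = 2; increasing d by one costs the factor (d + 2) / (d + 1)
    * sqrt q, and sqrt q <= 1 / 2 keeps it below 1.\<close>
  have "(real (Suc d) + 1) * sqrt q ^ Suc d = ((real d + 2) * sqrt q) * sqrt q ^ d" by simp
  also have "\<dots> \<le> ((real d + 2) * (1 / 2)) * sqrt q ^ d"
    using s by (intro mult_right_mono mult_left_mono) auto
  also have "\<dots> \<le> (real d + 1) * sqrt q ^ d" using s by (intro mult_right_mono) auto
  finally show ?case using Suc.IH by simp
qed

text \<open>Follows from pi <= 16 / 5 and e >= 27 / 10, for which 27 * (16 / 5) = 32 * (27 / 10) is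
  an equality. If pi were larger, cos (8 / 5) would be positive, but its Taylor expansion with
  remainder of order 4 shows that it is negative.\<close>

lemma pi_exp_bound: "pi * 27 \<le> 32 * exp (1::real)"
proof -
  have "pi \<le> 16 / 5"
  proof (rule ccontr)
    assume "\<not> pi \<le> 16 / 5"
    hence pos: "cos (8 / 5 :: real) > 0" by (intro cos_gt_zero) auto
    obtain t where t: "cos (8 / 5 :: real) = (\<Sum>m<4. cos_coeff m * (8 / 5) ^ m) + cos (t + 1 / 2 * real 4 * pi) / fact 4 * (8 / 5) ^ 4"
      using Maclaurin_cos_expansion2[of "8 / 5" 4] by auto
    have "cos (t + 1 / 2 * real 4 * pi) / fact 4 * (8 / 5) ^ 4 \<le> 1 / fact 4 * (8 / 5 :: real) ^ 4"
      by (intro mult_right_mono divide_right_mono cos_le_one) auto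
    moreover have "(\<Sum>m<4. cos_coeff m * (8 / 5 :: real) ^ m) = 1 - (8 / 5)\<^sup>2 / 2"
    proof -
      have "{..<4::nat} = {0, 1, 2, 3}" by auto
      thus ?thesis by (simp add: cos_coeff_def)
    qed
    moreover have "1 - (8 / 5 :: real)\<^sup>2 / 2 + 1 / fact 4 * (8 / 5) ^ 4 < 0"
      by (simp add: power2_eq_square fact_numeral eval_nat_numeral)
    ultimately show False using pos t by linarith
  qed
  moreover have "exp (1::real) \<ge> 27 / 10" 
  proof -
    have "\<bar>exp 1 - 5837465777 / 2147483648\<bar> \<le> (1 / 100 :: real)"
      by (rule order_trans[OF e_approx_32]) simp
    thus ?thesis unfolding abs_le_iff by simp
  qed
  ultimately show ?thesis by simp
qed

text \<open>Each block costs 3 q pi / e times the allowed probability, with q = 3 / 16 and q = 3 /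
  32: \<open>geometric_decay\<close> supplies 3 q, and sqrt (pi / 2) = pi / sqrt (2 pi) supplies pi.
  The total 27 pi / (32 e) is at most 1 by \<open>pi_exp_bound\<close>.\<close>

lemma block_probability_bound:
  fixes d :: nat and \<beta> :: real
  assumes d: "d \<ge> 2" and \<beta>: "\<beta> > 0"
    and xy: "x \<ge> 0" "y \<ge> 0" and x: "x \<le> 3 / 16 / \<beta>\<^sup>2" and y: "y \<le> 3 / 32 / \<beta>\<^sup>2"
  defines "c \<equiv> (exp 1 / real d) ^ d * (sqrt (pi / 2) * (real d + 1) / (exp 1 * sqrt (real d)))"
  shows "c * sqrt x ^ d + c * sqrt y ^ d \<le> 1 / sqrt (2 * pi * real d) * (exp 1 / (real d * \<beta>)) ^ d"
proof -
  have dp: "real d > 0" using d by simp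
  have c0: "c \<ge> 0" unfolding c_def by (intro mult_nonneg_nonneg divide_nonneg_nonneg) auto
  have pow: "c * sqrt u ^ d \<le> (exp 1 / (real d * \<beta>)) ^ d / sqrt (2 * pi * real d) * (pi / exp 1 * (3 * q))"
    if u0: "u \<ge> 0" and u: "u \<le> q / \<beta>\<^sup>2" and q: "0 \<le> q" "q \<le> 1 / 4" for u q
  proof -
    have "sqrt u \<le> sqrt q / \<beta>" using u \<beta> real_sqrt_le_mono[OF u] by (simp add: real_sqrt_divide)
    hence "sqrt u ^ d \<le> (sqrt q / \<beta>) ^ d" using u0 by (intro power_mono) auto
    hence su: "sqrt u ^ d \<le> sqrt q ^ d / \<beta> ^ d" by (simp add: power_divide)
    have "c * sqrt u ^ d \<le> c * (sqrt q ^ d / \<beta> ^ d)" using su c0 by (intro mult_left_mono)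
    also have "\<dots> = (exp 1 / (real d * \<beta>)) ^ d * (sqrt (pi / 2) / (exp 1 * sqrt (real d))) * ((real d + 1) * sqrt q ^ d)"
      by (simp add: c_def power_divide power_mult_distrib mult_ac)
    also have "\<dots> \<le> (exp 1 / (real d * \<beta>)) ^ d * (sqrt (pi / 2) / (exp 1 * sqrt (real d))) * (3 * q)"
      using \<beta> by (intro mult_left_mono geometric_decay d q mult_nonneg_nonneg) auto
    also have "sqrt (pi / 2) / (exp 1 * sqrt (real d)) = 1 / sqrt (2 * pi * real d) * (pi / exp 1)"
    proof -
      have "sqrt (pi / 2) * sqrt (2 * pi) = pi"
        by (simp add: real_sqrt_mult[symmetric])
      hence "sqrt (pi / 2) = pi / sqrt (2 * pi)" by (simp add: field_simps)
      thus ?thesis by (simp add: real_sqrt_mult)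
    qed
    finally show ?thesis by (simp add: mult_ac)
  qed
  let ?K = "(exp 1 / (real d * \<beta>)) ^ d / sqrt (2 * pi * real d)"
  have K0: "?K \<ge> 0" using \<beta> dp by simp
  have "c * sqrt x ^ d + c * sqrt y ^ d \<le> ?K * (pi / exp 1 * (3 * (3 / 16))) + ?K * (pi / exp 1 * (3 * (3 / 32)))"
    using pow[OF xy(1) x] pow[OF xy(2) y] by (intro add_mono) auto
  also have "\<dots> = ?K * (pi * 27 / (32 * exp 1))" by (simp add: field_simps)
  also have "\<dots> \<le> ?K * 1" using pi_exp_bound K0 by (intro mult_left_mono) (auto simp: field_simps)
  finally show ?thesis by simp
qed

text \<open>8 and 16 / 3 are the constants that \<open>error_bound\<close> can afford. With them the
  quantities fed into \<open>block_probability_bound\<close> are at most 3 / 32 and 3 / 16 over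
  \<beta>^2. The event \<open>E0\<close> removes the null set of singular Gram matrices, where
  \<open>sol\<close> need not solve the system.\<close>

lemma gauss_good_event:
  fixes X :: "nat \<times> nat \<Rightarrow> 'w \<Rightarrow> real"
  assumes M: "prob_space M" and g: "gauss M ({..<n} \<times> {..<l}) X"
    and j: "0 < j" "j < k" and kl: "k \<le> l" "l \<le> n - k" and \<beta>: "\<beta> > 1" and \<gamma>: "\<gamma> > 1"
    and d: "d = l - j + 1"
  shows "\<exists>E\<in>sets M. measure M E \<ge> 1 - 1 / sqrt (2 * pi * real d) * (exp 1 / (real d * \<beta>)) ^ d \<and>
     (\<forall>\<omega>\<in>E. \<forall>e. \<exists>h. (\<forall>i<j. (\<Sum>t<l. X (i, t) \<omega> * h t) = e i) \<and>
        (\<Sum>i\<in>{j..<k}. (\<Sum>t<l. X (i, t) \<omega> * h t)\<^sup>2) \<le> 8 * (real l)\<^sup>2 * \<beta>\<^sup>2 * \<gamma>\<^sup>2 * (\<Sum>i<j. (e i)\<^sup>2) \<and>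
        (\<Sum>i\<in>{k..<n}. (\<Sum>t<l. X (i, t) \<omega> * h t)\<^sup>2) \<le> 16 / 3 * real l * real (n - k) * \<beta>\<^sup>2 * \<gamma>\<^sup>2 * (\<Sum>i<j. (e i)\<^sup>2))"
proof -
  interpret prob_space M by fact
  have l0: "l > 0" "n - k > 0" "k < n" "j < l" "j \<le> n" "d \<ge> 2" using j kl d by auto
  define Y2 where "Y2 = 8 * (real l)\<^sup>2 * \<beta>\<^sup>2 * \<gamma>\<^sup>2"
  define Y3 where "Y3 = 16 / 3 * real l * real (n - k) * \<beta>\<^sup>2 * \<gamma>\<^sup>2"
  have Y: "Y2 > 0" "Y3 > 0" using l0 \<beta> \<gamma> by (auto simp: Y2_def Y3_def)
  define c where "c = (exp 1 / real d) ^ d * (sqrt (pi / 2) * (real d + 1) / (exp 1 * sqrt (real d)))"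
  define a where "a = real j + (real d - 1) / 2"
  let ?S = "\<lambda>I \<omega> w. \<Sum>i\<in>I. (\<Sum>t<l. X (i, t) \<omega> * sol j l (\<lambda>p. X p \<omega>) w t)\<^sup>2"
  let ?x3 = "a * (real (n - k) + (real d - 1) / 2) / Y3" and ?x2 = "a * (real (k - j) + (real d - 1) / 2) / Y2"
  obtain E2 where E2: "E2 \<in> sets M" "emeasure M (space M - E2) \<le> ennreal (c * sqrt ?x2 ^ d)"
     "\<And>\<omega> e. \<omega> \<in> E2 \<Longrightarrow> ?S {j..<k} \<omega> e \<le> Y2 * (\<Sum>a<j. (e a)\<^sup>2)"
    using gauss_block_bound[OF M g j(1) l0(4,5), of "{j..<k}" Y2 d] j kl l0 Y d
    unfolding c_def a_def by auto
  obtain E3 where E3: "E3 \<in> sets M" "emeasure M (space M - E3) \<le> ennreal (c * sqrt ?x3 ^ d)"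
     "\<And>\<omega> e. \<omega> \<in> E3 \<Longrightarrow> ?S {k..<n} \<omega> e \<le> Y3 * (\<Sum>a<j. (e a)\<^sup>2)"
    using gauss_block_bound[OF M g j(1) l0(4,5), of "{k..<n}" Y3 d] j kl l0 Y d
    unfolding c_def a_def by auto
  define E0 where "E0 = {\<omega> \<in> space M. det (gram j l (\<lambda>p. X p \<omega>)) \<noteq> 0}"
  have dm[measurable]: "(\<lambda>\<omega>. det (gram j l (\<lambda>p. X p \<omega>))) \<in> borel_measurable M"
    using l0 by (intro gram_measurable gauss_measurable[OF g]) auto
  have E0: "E0 \<in> sets M" unfolding E0_def by measurable
  have E0n: "emeasure M (space M - E0) = 0"
  proof -
    have fm: "(\<lambda>x. indicator {x. det (gram j l x) = 0} x :: ennreal) \<in> borel_measurable (\<Pi>\<^sub>M p\<in>{..<n} \<times> {..<l}. borel)"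
    proof -
      have "(\<lambda>x. det (gram j l x)) \<in> borel_measurable (\<Pi>\<^sub>M p\<in>{..<n} \<times> {..<l}. borel)"
        using l0 by (intro gram_measurable measurable_component_singleton) auto
      thus ?thesis by measurable
    qed
    have "emeasure M (space M - E0) = (\<integral>\<^sup>+\<omega>. indicator (space M - E0) \<omega> \<partial>M)"
      using E0 by simp
    also have "\<dots> = (\<integral>\<^sup>+\<omega>. indicator {x. det (gram j l x) = 0} (\<lambda>p\<in>{..<n} \<times> {..<l}. X p \<omega>) \<partial>M)"
    proof (rule nn_integral_cong)
      fix \<omega> assume "\<omega> \<in> space M"
      moreover have "gram j l (\<lambda>p\<in>{..<n} \<times> {..<l}. X p \<omega>) = gram j l (\<lambda>p. X p \<omega>)"
        using l0 by (intro gram_cong) auto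
      ultimately show "indicator (space M - E0) \<omega> = (indicator {x. det (gram j l x) = 0} (\<lambda>p\<in>{..<n} \<times> {..<l}. X p \<omega>) :: ennreal)"
        by (auto simp: E0_def indicator_def)
    qed
    also have "\<dots> = 0" unfolding gauss_nn_integral[OF g fm] using l0 by (intro gram_singular_null) auto
    finally show ?thesis .
  qed
  define E where "E = E0 \<inter> E2 \<inter> E3"
  have Em: "E \<in> sets M" using E0 E2 E3 by (auto simp: E_def)
  have v: "(real d - 1) / 2 = (real l - real j) / 2" using d l0 by (simp add: of_nat_diff)
  have x3: "?x3 \<le> 3 / 16 / \<beta>\<^sup>2"
  proof -
    \<comment> \<open>Here a = (l + j) / 2 = l - u. Moving u from the factor l to the factor n - k,
      which is at least as large, does not increase the product.\<close>
    define u where "u = (real l - real j) / 2"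
    have v0: "u \<ge> 0" using l0 by (simp add: u_def)
    have au: "a = real l - u" unfolding a_def v u_def by (simp add: field_simps)
    have "a * (real (n - k) + (real d - 1) / 2) = (real l - u) * (real (n - k) + u)"
      unfolding au v u_def[symmetric] ..
    also have "\<dots> = real l * real (n - k) - u * (real (n - k) - real l) - u * u"
      by (simp add: algebra_simps)
    also have "\<dots> \<le> real l * real (n - k)"
    proof -
      have "u * (real (n - k) - real l) \<ge> 0" using v0 of_nat_mono[OF kl(2), where ?'a=real]
        by (intro mult_nonneg_nonneg) auto
      moreover have "u * u \<ge> 0" by simp
      ultimately show ?thesis by linarith
    qed
    finally have "?x3 \<le> real l * real (n - k) / Y3" using Y by (intro divide_right_mono) auto
    also have "\<dots> = 3 / 16 / \<beta>\<^sup>2 / \<gamma>\<^sup>2" using l0 \<beta> \<gamma> by (simp add: Y3_def field_simps)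
    also have "\<dots> \<le> 3 / 16 / \<beta>\<^sup>2 / 1" using \<gamma> \<beta> by (intro divide_left_mono) (auto simp: power_le_one_iff one_le_power less_imp_le)
    finally show ?thesis by simp
  qed
  have x2: "?x2 \<le> 3 / 32 / \<beta>\<^sup>2"
  proof -
    define u where "u = (real l - real j) / 2"
    have au: "a = real l - u" unfolding a_def v u_def by (simp add: field_simps)
    have a0: "a \<ge> 0" using l0 by (simp add: a_def)
    \<comment> \<open>Since k <= l, the block has at most 2 u rows; 3 u (l - u) is largest at u = l
      / 2, with value 3 l^2 / 4.\<close>
    have "real (k - j) \<le> 2 * u" using j kl by (simp add: of_nat_diff u_def)
    hence "a * (real (k - j) + (real d - 1) / 2) \<le> a * (3 * u)"
      unfolding v u_def[symmetric] using a0 by (intro mult_left_mono) auto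
    also have "\<dots> = 3 / 4 * (real l)\<^sup>2 - 3 * (u - real l / 2)\<^sup>2"
      unfolding au by (simp add: power2_eq_square field_simps)
    also have "\<dots> \<le> 3 / 4 * (real l)\<^sup>2" by simp
    finally have "?x2 \<le> 3 / 4 * (real l)\<^sup>2 / Y2" using Y by (intro divide_right_mono) auto
    also have "\<dots> = 3 / 32 / \<beta>\<^sup>2 / \<gamma>\<^sup>2" using l0 \<beta> \<gamma> by (simp add: Y2_def field_simps)
    also have "\<dots> \<le> 3 / 32 / \<beta>\<^sup>2 / 1" using \<gamma> \<beta> by (intro divide_left_mono) (auto simp: one_le_power less_imp_le)
    finally show ?thesis by simp
  qed
  have c0: "c \<ge> 0" unfolding c_def by (intro mult_nonneg_nonneg divide_nonneg_nonneg) auto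
  have pos: "?x2 \<ge> 0" "?x3 \<ge> 0" using Y l0 unfolding a_def v by (auto intro!: divide_nonneg_pos mult_nonneg_nonneg)
  have "emeasure M (space M - E) \<le> emeasure M (space M - E0 \<union> (space M - E2) \<union> (space M - E3))"
    using E0 E2 E3 by (intro emeasure_mono) (auto simp: E_def)
  also have "\<dots> \<le> emeasure M (space M - E0) + emeasure M (space M - E2) + emeasure M (space M - E3)"
    using E0 E2 E3 by (intro order_trans[OF emeasure_subadditive] add_mono order_refl) auto
  also have "\<dots> \<le> 0 + ennreal (c * sqrt ?x2 ^ d) + ennreal (c * sqrt ?x3 ^ d)"
    using E0n E2 E3 by (intro add_mono) auto
  also have "\<dots> = ennreal (c * sqrt ?x3 ^ d + c * sqrt ?x2 ^ d)"
    using c0 pos by (simp add: ennreal_plus add.commute)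
  also have "\<dots> \<le> ennreal (1 / sqrt (2 * pi * real d) * (exp 1 / (real d * \<beta>)) ^ d)"
    unfolding c_def by (intro ennreal_leI block_probability_bound l0 x2 x3 pos) (use \<beta> in simp)
  finally have "measure M (space M - E) \<le> 1 / sqrt (2 * pi * real d) * (exp 1 / (real d * \<beta>)) ^ d"
    unfolding emeasure_eq_measure using \<beta> by (subst (asm) ennreal_le_iff) auto
  hence "measure M E \<ge> 1 - 1 / sqrt (2 * pi * real d) * (exp 1 / (real d * \<beta>)) ^ d"
    using prob_compl[OF Em] by simp
  moreover have "\<exists>h. (\<forall>i<j. (\<Sum>t<l. X (i, t) \<omega> * h t) = e i) \<and>
        (\<Sum>i\<in>{j..<k}. (\<Sum>t<l. X (i, t) \<omega> * h t)\<^sup>2) \<le> 8 * (real l)\<^sup>2 * \<beta>\<^sup>2 * \<gamma>\<^sup>2 * (\<Sum>i<j. (e i)\<^sup>2) \<and>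
        (\<Sum>i\<in>{k..<n}. (\<Sum>t<l. X (i, t) \<omega> * h t)\<^sup>2) \<le> 16 / 3 * real l * real (n - k) * \<beta>\<^sup>2 * \<gamma>\<^sup>2 * (\<Sum>i<j. (e i)\<^sup>2)"
    if "\<omega> \<in> E" for \<omega> e
    using that E2(3)[of \<omega> e] E3(3)[of \<omega> e] sol_solves[of j l "\<lambda>p. X p \<omega>" _ e]
    by (intro exI[of _ "sol j l (\<lambda>p. X p \<omega>) e"]) (auto simp: E_def E0_def Y2_def Y3_def)
  ultimately show ?thesis using Em by blast
qed

section \<open>Singular value decomposition\<close>

lemma scalar_prod_sum: "y \<in> carrier_vec n \<Longrightarrow> x \<bullet> y = (\<Sum>t<n. x $ t * y $ t)"
  by (simp add: scalar_prod_def atLeast0LessThan)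

text \<open>The complex characteristic polynomial has a root. The Hermitian form at its eigenvector
  is real, hence so is the root; real and imaginary parts of the eigenvector then satisfy the same
  equation, and one of them is nonzero.\<close>

lemma symmetric_real_eigenvector:
  fixes b :: "nat \<Rightarrow> nat \<Rightarrow> real"
  assumes r: "r > 0" and sym: "\<And>i k. i < r \<Longrightarrow> k < r \<Longrightarrow> b i k = b k i"
  shows "\<exists>\<nu> w. (\<Sum>t<r. (w t)\<^sup>2) > 0 \<and> (\<forall>i<r. (\<Sum>k<r. b i k * w k) = \<nu> * w i)"
proof -
  define C where "C = mat r r (\<lambda>(i, k). complex_of_real (b i k))"
  have C: "C \<in> carrier_mat r r" by (simp add: C_def)
  have "degree (char_poly C) = r" using degree_monic_char_poly[OF C] by simp
  hence "\<not> constant (poly (char_poly C))" using r by (simp add: constant_degree)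
  then obtain z where "poly (char_poly C) z = 0" using fundamental_theorem_of_algebra by blast
  hence "eigenvalue C z" using eigenvalue_root_char_poly[OF C] by simp
  then obtain x where x: "x \<in> carrier_vec r" "x \<noteq> 0\<^sub>v r" "C *\<^sub>v x = z \<cdot>\<^sub>v x"
    unfolding eigenvalue_def eigenvector_def using C by auto
  have eq: "(\<Sum>k<r. complex_of_real (b i k) * x $ k) = z * x $ i" if "i < r" for i
  proof -
    have "(C *\<^sub>v x) $ i = (z \<cdot>\<^sub>v x) $ i" using x by simp
    thus ?thesis using that x by (simp add: C_def scalar_prod_def atLeast0LessThan)
  qed
  define S where "S = (\<Sum>i<r. cnj (x $ i) * (\<Sum>k<r. complex_of_real (b i k) * x $ k))"
  have "cnj S = S"
  proof -
    have "cnj S = (\<Sum>i<r. \<Sum>k<r. x $ i * complex_of_real (b i k) * cnj (x $ k))"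
      by (simp add: S_def sum_distrib_left mult_ac)
    also have "\<dots> = (\<Sum>k<r. \<Sum>i<r. x $ i * complex_of_real (b i k) * cnj (x $ k))" by (rule sum.swap)
    also have "\<dots> = S" unfolding S_def sum_distrib_left
      by (intro sum.cong refl) (auto simp: sym mult_ac)
    finally show ?thesis .
  qed
  define N where "N = (\<Sum>i<r. (cmod (x $ i))\<^sup>2)"
  have "S = (\<Sum>i<r. cnj (x $ i) * (z * x $ i))" unfolding S_def by (intro sum.cong refl) (simp add: eq)
  also have "\<dots> = z * complex_of_real N"
    by (simp add: N_def sum_distrib_left complex_norm_square mult_ac flip: of_real_power)
  finally have SN: "S = z * complex_of_real N" .
  have "\<exists>i<r. x $ i \<noteq> 0" using x by (metis eq_vecI carrier_vecD index_zero_vec)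
  hence Np: "N > 0" unfolding N_def by (auto intro!: sum_pos2)
  have "cnj z = z" using \<open>cnj S = S\<close> Np unfolding SN by simp
  hence zr: "z = complex_of_real (Re z)" by (simp add: complex_eq_iff)
  have re: "(\<Sum>k<r. b i k * Re (x $ k)) = Re z * Re (x $ i)" if "i < r" for i
  proof -
    have "Re (\<Sum>k<r. complex_of_real (b i k) * x $ k) = (\<Sum>k<r. b i k * Re (x $ k))" by simp
    moreover have "Re (z * x $ i) = Re z * Re (x $ i)" by (subst zr) simp
    ultimately show ?thesis using eq[OF that] by simp
  qed
  have im: "(\<Sum>k<r. b i k * Im (x $ k)) = Re z * Im (x $ i)" if "i < r" for i
  proof -
    have "Im (\<Sum>k<r. complex_of_real (b i k) * x $ k) = (\<Sum>k<r. b i k * Im (x $ k))" by simp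
    moreover have "Im (z * x $ i) = Re z * Im (x $ i)" by (subst zr) simp
    ultimately show ?thesis using eq[OF that] by simp
  qed
  have "N = (\<Sum>i<r. (Re (x $ i))\<^sup>2) + (\<Sum>i<r. (Im (x $ i))\<^sup>2)"
    by (simp add: N_def cmod_power2 sum.distrib)
  hence "(\<Sum>i<r. (Re (x $ i))\<^sup>2) > 0 \<or> (\<Sum>i<r. (Im (x $ i))\<^sup>2) > 0" using Np by linarith
  thus ?thesis
  proof
    assume "(\<Sum>i<r. (Re (x $ i))\<^sup>2) > 0"
    thus ?thesis using re by (intro exI[of _ "Re z"] exI[of _ "\<lambda>k. Re (x $ k)"]) auto
  next
    assume "(\<Sum>i<r. (Im (x $ i))\<^sup>2) > 0"
    thus ?thesis using im by (intro exI[of _ "Re z"] exI[of _ "\<lambda>k. Im (x $ k)"]) auto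
  qed
qed

lemma orthonormal_expansion:
  fixes u :: "nat \<Rightarrow> nat \<Rightarrow> real"
  assumes "\<And>i k. i < n \<Longrightarrow> k < n \<Longrightarrow> (\<Sum>t<n. u i t * u k t) = (if i = k then 1 else 0)" and "t < n"
  shows "x t = (\<Sum>i<n. (\<Sum>s<n. u i s * x s) * u i t)"
proof -
  have "(\<Sum>i<n. (\<Sum>s<n. u i s * x s) * u i t) = (\<Sum>s<n. x s * (\<Sum>i<n. u i s * u i t))"
    unfolding sum_distrib_left sum_distrib_right by (subst sum.swap) (simp add: mult_ac)
  also have "\<dots> = (\<Sum>s<n. if s = t then x s else 0)"
    using assms by (intro sum.cong refl) (auto simp: orthonormal_rows_imp_cols[OF assms(1)])
  also have "\<dots> = x t" using assms(2) by simp
  finally show ?thesis by simp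
qed

lemma orthonormal_parseval:
  fixes u :: "nat \<Rightarrow> nat \<Rightarrow> real"
  assumes "\<And>i k. i < n \<Longrightarrow> k < n \<Longrightarrow> (\<Sum>t<n. u i t * u k t) = (if i = k then 1 else 0)"
  shows "(\<Sum>t<n. x t * y t) = (\<Sum>i<n. (\<Sum>t<n. u i t * x t) * (\<Sum>t<n. u i t * y t))"
proof -
  have "(\<Sum>t<n. x t * y t) = (\<Sum>t<n. (\<Sum>i<n. (\<Sum>s<n. u i s * x s) * u i t) * y t)"
    by (intro sum.cong refl) (use orthonormal_expansion[OF assms, of _ x] in auto)
  also have "\<dots> = (\<Sum>i<n. \<Sum>t<n. (\<Sum>s<n. u i s * x s) * (u i t * y t))"
    unfolding sum_distrib_right[of _ _ "y _"] by (subst sum.swap) (simp only: mult.assoc)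
  also have "\<dots> = (\<Sum>i<n. (\<Sum>t<n. u i t * x t) * (\<Sum>t<n. u i t * y t))"
    by (simp only: sum_distrib_left)
  finally show ?thesis .
qed

text \<open>The matrix is compressed to the orthogonal complement of the eigenvectors found so far,
  spanned by q, and an eigenvector of the compression b is lifted. It is an eigenvector of the whole
  matrix because symmetry keeps the complement invariant.\<close>

lemma symmetric_orthonormal_eigenvectors:
  fixes a :: "nat \<Rightarrow> nat \<Rightarrow> real"
  assumes sym: "\<And>i k. i < n \<Longrightarrow> k < n \<Longrightarrow> a i k = a k i" and "m \<le> n"
  shows "\<exists>v \<nu>. (\<forall>i<m. \<forall>k<m. (\<Sum>t<n. v i t * v k t) = (if i = k then 1 else 0)) \<and>
     (\<forall>i<m. \<forall>s<n. (\<Sum>t<n. a s t * v i t) = \<nu> i * v i s)"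
  using \<open>m \<le> n\<close>
proof (induction m)
  case (Suc m)
  then obtain v \<nu> where "\<forall>i<m. \<forall>k<m. (\<Sum>t<n. v i t * v k t) = (if i = k then 1 else 0)"
      "\<forall>i<m. \<forall>s<n. (\<Sum>t<n. a s t * v i t) = \<nu> i * v i s" by auto
  hence v: "\<And>i k. i < m \<Longrightarrow> k < m \<Longrightarrow> (\<Sum>t<n. v i t * v k t) = (if i = k then 1 else 0)"
     and ev: "\<And>i s. i < m \<Longrightarrow> s < n \<Longrightarrow> (\<Sum>t<n. a s t * v i t) = \<nu> i * v i s" by auto
  define r where "r = n - m"
  have r: "r > 0" "m + r = n" using Suc.prems by (auto simp: r_def)
  from orthonormal_complement[of m r n v] r obtain q
    where "\<forall>i<r. \<forall>k<r. (\<Sum>t<n. q i t * q k t) = (if i = k then 1 else 0)"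
      "\<forall>i<m. \<forall>k<r. (\<Sum>t<n. v i t * q k t) = 0" by auto
  hence q: "\<And>i k. i < r \<Longrightarrow> k < r \<Longrightarrow> (\<Sum>t<n. q i t * q k t) = (if i = k then 1 else 0)"
      and vq: "\<And>i k. i < m \<Longrightarrow> k < r \<Longrightarrow> (\<Sum>t<n. v i t * q k t) = 0" by auto
  define b where "b i k = (\<Sum>s<n. q i s * (\<Sum>t<n. a s t * q k t))" for i k
  have bsym: "b i k = b k i" for i k
  proof -
    have "b i k = (\<Sum>s<n. \<Sum>t<n. q i s * (a s t * q k t))" by (simp add: b_def sum_distrib_left)
    also have "\<dots> = (\<Sum>t<n. \<Sum>s<n. q i s * (a s t * q k t))" by (rule sum.swap)
    also have "\<dots> = (\<Sum>t<n. \<Sum>s<n. q k t * (a t s * q i s))"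
      by (intro sum.cong refl) (auto simp: sym)
    also have "\<dots> = b k i" by (simp add: b_def sum_distrib_left)
    finally show ?thesis .
  qed
  from symmetric_real_eigenvector[OF r(1), of b] bsym obtain \<mu> w
    where "(\<Sum>t<r. (w t)\<^sup>2) > 0" "\<forall>i<r. (\<Sum>k<r. b i k * w k) = \<mu> * w i" by auto
  hence w: "(\<Sum>t<r. (w t)\<^sup>2) > 0" "\<And>i. i < r \<Longrightarrow> (\<Sum>k<r. b i k * w k) = \<mu> * w i" by auto
  define W where "W = (\<Sum>t<r. (w t)\<^sup>2)"
  define x where "x t = (\<Sum>k<r. w k / sqrt W * q k t)" for t
  define B where "B i = (if i < m then v i else q (i - m))" for i
  have B: "(\<Sum>t<n. B i t * B k t) = (if i = k then 1 else 0)" if "i < n" "k < n" for i k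
    using v[of i k] q[of "i - m" "k - m"] vq[of i "k - m"] vq[of k "i - m"] that r
    by (auto simp: B_def mult.commute)
  have xq: "(\<Sum>t<n. q i t * x t) = w i / sqrt W" if "i < r" for i
  proof -
    have "(\<Sum>t<n. q i t * x t) = (\<Sum>k<r. w k / sqrt W * (\<Sum>t<n. q i t * q k t))"
      unfolding x_def sum_distrib_left by (subst sum.swap) (simp add: mult_ac)
    also have "\<dots> = (\<Sum>k<r. if k = i then w k / sqrt W else 0)"
      using that q by (intro sum.cong refl) auto
    finally show ?thesis using that by simp
  qed
  have xv: "(\<Sum>t<n. v i t * x t) = 0" if "i < m" for i
  proof -
    have "(\<Sum>t<n. v i t * x t) = (\<Sum>k<r. w k / sqrt W * (\<Sum>t<n. v i t * q k t))"
      unfolding x_def sum_distrib_left by (subst sum.swap) (simp add: mult_ac)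
    thus ?thesis using vq that by simp
  qed
  have x1: "(\<Sum>t<n. x t * x t) = 1"
  proof -
    have "(\<Sum>t<n. x t * x t) = (\<Sum>t<n. (\<Sum>k<r. w k / sqrt W * q k t) * x t)"
      by (intro sum.cong refl arg_cong2[where f="(*)"] x_def)
    also have "\<dots> = (\<Sum>k<r. w k / sqrt W * (\<Sum>t<n. q k t * x t))"
      unfolding sum_distrib_right sum_distrib_left by (subst sum.swap) (simp only: mult.assoc)
    also have "\<dots> = (\<Sum>k<r. (w k)\<^sup>2) / W"
    proof -
      have "W > 0" using w(1) by (simp add: W_def)
      thus ?thesis using xq by (simp add: power2_eq_square sum_divide_distrib)
    qed
    finally show ?thesis using w(1) by (simp add: W_def)
  qed
  have Ax: "(\<Sum>t<n. a s t * x t) = \<mu> * x s" if s: "s < n" for s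
  proof -
    let ?y = "\<lambda>s. \<Sum>t<n. a s t * x t"
    have yq: "(\<Sum>s<n. q i s * ?y s) = \<mu> * (w i / sqrt W)" if "i < r" for i
    proof -
      have "(\<Sum>s<n. q i s * ?y s) = (\<Sum>k<r. w k / sqrt W * b i k)"
      proof -
        have y: "?y s = (\<Sum>k<r. w k / sqrt W * (\<Sum>t<n. a s t * q k t))" for s
          unfolding x_def sum_distrib_left by (subst sum.swap) (simp only: mult_ac)
        show ?thesis unfolding y b_def
          unfolding sum_distrib_left[of "q i _"] sum_distrib_left[of "w _ / sqrt W"]
          by (subst sum.swap) (simp only: sum_distrib_left mult_ac)
      qed
      also have "\<dots> = (\<Sum>k<r. b i k * w k) / sqrt W" by (simp add: sum_divide_distrib mult.commute)
      finally show ?thesis using w(2)[OF that] by simp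
    qed
    have yv: "(\<Sum>s<n. v i s * ?y s) = 0" if "i < m" for i
    proof -
      have "(\<Sum>s<n. v i s * ?y s) = (\<Sum>t<n. \<Sum>s<n. a t s * v i s * x t)"
        unfolding sum_distrib_left by (subst sum.swap) (intro sum.cong refl, auto simp: sym mult_ac)
      also have "\<dots> = (\<Sum>t<n. (\<Sum>s<n. a t s * v i s) * x t)" by (simp add: sum_distrib_right)
      also have "\<dots> = (\<Sum>t<n. \<nu> i * v i t * x t)" using ev that by (intro sum.cong) auto
      also have "\<dots> = \<nu> i * (\<Sum>t<n. v i t * x t)" by (simp add: sum_distrib_left mult.assoc)
      finally show ?thesis using xv that by simp
    qed
    \<comment> \<open>Comparison in the basis B: the components along v vanish on both sides, and
      those along q agree by the eigenvalue equation for b.\<close>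
    have "?y s = (\<Sum>i<n. (\<Sum>s<n. B i s * ?y s) * B i s)"
      by (rule orthonormal_expansion[OF B s])
    also have "\<dots> = (\<Sum>i<n. (\<mu> * (\<Sum>s<n. B i s * x s)) * B i s)"
    proof (intro sum.cong refl arg_cong2[where f="(*)"])
      fix i assume "i \<in> {..<n}"
      thus "(\<Sum>s<n. B i s * ?y s) = \<mu> * (\<Sum>s<n. B i s * x s)"
        using yv[of i] yq[of "i - m"] xv[of i] xq[of "i - m"] r by (auto simp: B_def)
    qed
    also have "\<dots> = \<mu> * (\<Sum>i<n. (\<Sum>s<n. B i s * x s) * B i s)"
      by (simp only: mult.assoc sum_distrib_left[symmetric])
    also have "\<dots> = \<mu> * x s" using orthonormal_expansion[OF B s, of x] by simp
    finally show ?thesis .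
  qed
  show ?case
  proof (intro exI[of _ "v(m := x)"] exI[of _ "\<nu>(m := \<mu>)"] conjI allI impI)
    fix i k assume "i < Suc m" "k < Suc m"
    thus "(\<Sum>t<n. (v(m := x)) i t * (v(m := x)) k t) = (if i = k then 1 else 0)"
      using v[of i k] x1 xv[of i] xv[of k] by (auto simp: less_Suc_eq mult.commute)
  next
    fix i s assume "i < Suc m" "s < n"
    thus "(\<Sum>t<n. a s t * (v(m := x)) i t) = (\<nu>(m := \<mu>)) i * (v(m := x)) i s"
      using ev[of i s] Ax by (auto simp: less_Suc_eq)
  qed
qed auto

text \<open>The v are eigenvectors of the transpose of a times a, sorted by decreasing eigenvalue;
  their images under a are orthogonal with squared norms \<sigma>^2. The nonzero images, divided by
  \<sigma>, are completed to m left vectors rather than n, so that every vector of the larger space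
  can be expanded in u.\<close>

lemma svd_exists:
  fixes a :: "nat \<Rightarrow> nat \<Rightarrow> real"
  assumes nm: "n \<le> m"
  obtains u v \<sigma> where
    "\<And>i k. i < m \<Longrightarrow> k < m \<Longrightarrow> (\<Sum>t<m. u i t * u k t) = (if i = k then 1 else 0)"
    "\<And>i k. i < n \<Longrightarrow> k < n \<Longrightarrow> (\<Sum>t<n. v i t * v k t) = (if i = k then 1 else 0)"
    "\<And>i. 0 \<le> \<sigma> i" "\<And>i k. i \<le> k \<Longrightarrow> \<sigma> k \<le> \<sigma> i"
    "\<And>i. n \<le> i \<Longrightarrow> \<sigma> i = 0"
    "\<And>i s. i < n \<Longrightarrow> s < m \<Longrightarrow> (\<Sum>t<n. a s t * v i t) = \<sigma> i * u i s"
proof -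
  define b where "b s t = (\<Sum>r<m. a r s * a r t)" for s t
  have "\<exists>v \<nu>. (\<forall>i<n. \<forall>k<n. (\<Sum>t<n. v i t * v k t) = (if i = k then 1 else 0)) \<and>
     (\<forall>i<n. \<forall>s<n. (\<Sum>t<n. b s t * v i t) = \<nu> i * v i s)"
    by (rule symmetric_orthonormal_eigenvectors) (auto simp: b_def mult.commute)
  then obtain v0 \<nu> where "\<forall>i<n. \<forall>k<n. (\<Sum>t<n. v0 i t * v0 k t) = (if i = k then 1 else 0)"
     "\<forall>i<n. \<forall>s<n. (\<Sum>t<n. b s t * v0 i t) = \<nu> i * v0 i s" by blast
  hence v0: "\<And>i k. i < n \<Longrightarrow> k < n \<Longrightarrow> (\<Sum>t<n. v0 i t * v0 k t) = (if i = k then 1 else 0)"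
    and ev0: "\<And>i s. i < n \<Longrightarrow> s < n \<Longrightarrow> (\<Sum>t<n. b s t * v0 i t) = \<nu> i * v0 i s" by auto
  have AA0: "(\<Sum>r<m. (\<Sum>t<n. a r t * v0 i t) * (\<Sum>t<n. a r t * v0 k t)) = (if i = k then \<nu> i else 0)"
    if "i < n" "k < n" for i k
  proof -
    have "(\<Sum>r<m. (\<Sum>t<n. a r t * v0 i t) * (\<Sum>t<n. a r t * v0 k t))
       = (\<Sum>r<m. \<Sum>s<n. \<Sum>t<n. v0 i s * (a r s * a r t * v0 k t))"
      by (simp add: sum_product mult_ac)
    also have "\<dots> = (\<Sum>s<n. \<Sum>t<n. \<Sum>r<m. v0 i s * (a r s * a r t * v0 k t))"
      by (subst sum.swap, rule sum.cong, simp, rule sum.swap)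
    also have "\<dots> = (\<Sum>s<n. v0 i s * (\<Sum>t<n. b s t * v0 k t))"
      by (simp add: b_def sum_distrib_left sum_distrib_right)
    also have "\<dots> = (\<Sum>s<n. v0 i s * (\<nu> k * v0 k s))" using ev0 that by (intro sum.cong) auto
    also have "\<dots> = \<nu> k * (\<Sum>s<n. v0 i s * v0 k s)" by (simp add: sum_distrib_left mult_ac)
    finally show ?thesis using v0 that by auto
  qed
  define xs where "xs = rev (sort_key \<nu> [0..<n])"
  have xs: "length xs = n" "distinct xs" "set xs = {..<n}" by (auto simp: xs_def)
  define p where "p i = xs ! i" for i
  have p: "p i < n" if "i < n" for i using that xs nth_mem[of i xs] by (auto simp: p_def)
  have pinj: "p i = p k \<longleftrightarrow> i = k" if "i < n" "k < n" for i k
    using that xs by (simp add: p_def nth_eq_iff_index_eq)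
  have pdec: "\<nu> (p k) \<le> \<nu> (p i)" if "i \<le> k" "k < n" for i k
  proof -
    have "sorted (map \<nu> (sort_key \<nu> [0..<n]))" by simp
    from sorted_nth_mono[OF this, of "n - Suc k" "n - Suc i"] that
    show ?thesis by (simp add: p_def xs_def rev_nth)
  qed
  define v where "v i = v0 (p i)" for i
  define \<sigma> where "\<sigma> i = (if i < n then sqrt (\<nu> (p i)) else 0)" for i
  have v: "(\<Sum>t<n. v i t * v k t) = (if i = k then 1 else 0)" if "i < n" "k < n" for i k
    using v0[OF p[OF that(1)] p[OF that(2)]] pinj[OF that] by (simp add: v_def)
  have \<nu>0: "\<nu> i \<ge> 0" if "i < n" for i
    using AA0[OF that that] sum_nonneg[of "{..<m}" "\<lambda>r. (\<Sum>t<n. a r t * v0 i t) * (\<Sum>t<n. a r t * v0 i t)"] by simp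
  define w where "w i s = (\<Sum>t<n. a s t * v i t)" for i s
  have ww: "(\<Sum>s<m. w i s * w k s) = (if i = k then (\<sigma> i)\<^sup>2 else 0)" if "i < n" "k < n" for i k
    using AA0[OF p[OF that(1)] p[OF that(2)]] pinj[OF that] \<nu>0[OF p[OF that(1)]] that
    by (auto simp: w_def v_def \<sigma>_def)
  have \<sigma>0: "\<sigma> i \<ge> 0" for i using \<nu>0 p by (auto simp: \<sigma>_def)
  have \<sigma>dec: "\<sigma> k \<le> \<sigma> i" if "i \<le> k" "k < n" for i k
    using pdec[OF that] that by (simp add: \<sigma>_def)
  \<comment> \<open>The rank: \<sigma> is decreasing, so the indices with positive \<sigma> form an
    initial segment.\<close>
  define r where "r = card {i. i < n \<and> \<sigma> i > 0}"
  have rset: "{i. i < n \<and> \<sigma> i > 0} = {..<r}"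
  proof -
    let ?S = "{i. i < n \<and> \<sigma> i > 0}"
    define q where "q = (LEAST q. q \<notin> ?S)"
    have "n \<notin> ?S" by simp
    hence q: "q \<notin> ?S" unfolding q_def by (rule LeastI)
    have "i \<in> ?S \<longleftrightarrow> i < q" for i
    proof
      assume "i < q"
      thus "i \<in> ?S" unfolding q_def by (metis not_less_Least)
    next
      assume i: "i \<in> ?S"
      show "i < q"
      proof (rule ccontr)
        assume "\<not> i < q"
        hence "q \<le> i" "q < n" using i by auto
        hence "\<sigma> q > 0" using \<sigma>dec[of q i] i by auto
        thus False using q \<open>q < n\<close> by simp
      qed
    qed
    hence "?S = {..<q}" by auto
    thus ?thesis unfolding r_def by simp
  qed
  have rn: "r \<le> n"
  proof (rule ccontr)
    assume "\<not> r \<le> n"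
    hence "n \<in> {..<r}" by simp
    thus False unfolding rset[symmetric] by simp
  qed
  have pos: "\<sigma> i > 0" if "i < r" for i using rset that by auto
  have zero: "\<sigma> i = 0" if "i < n" "\<not> i < r" for i using rset that \<sigma>0[of i] by fastforce
  have "\<exists>q. (\<forall>i<m - r. \<forall>k<m - r. (\<Sum>t<m. q i t * q k t) = (if i = k then 1 else 0)) \<and>
     (\<forall>i<r. \<forall>k<m - r. (\<Sum>t<m. w i t * q k t) = 0)"
    by (rule orthonormal_complement) (use rn nm in simp)
  then obtain q where "\<forall>i<m - r. \<forall>k<m - r. (\<Sum>t<m. q i t * q k t) = (if i = k then 1 else 0)"
     "\<forall>i<r. \<forall>k<m - r. (\<Sum>t<m. w i t * q k t) = 0" by blast
  hence q: "\<And>i k. i < m - r \<Longrightarrow> k < m - r \<Longrightarrow> (\<Sum>t<m. q i t * q k t) = (if i = k then 1 else 0)"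
    and wq: "\<And>i k. i < r \<Longrightarrow> k < m - r \<Longrightarrow> (\<Sum>t<m. w i t * q k t) = 0" by auto
  define u where "u i s = (if i < r then w i s / \<sigma> i else q (i - r) s)" for i s
  show ?thesis
  proof (rule that[of u v \<sigma>])
    fix i k assume ik: "i < m" "k < m"
    consider "i < r" "k < r" | "i < r" "\<not> k < r" | "\<not> i < r" "k < r" | "\<not> i < r" "\<not> k < r" by blast
    thus "(\<Sum>t<m. u i t * u k t) = (if i = k then 1 else 0)"
    proof cases
      case 1
      have "(\<Sum>t<m. u i t * u k t) = (\<Sum>t<m. w i t * w k t) / (\<sigma> i * \<sigma> k)"
        using 1 by (simp add: u_def sum_divide_distrib)
      thus ?thesis using 1 ww[of i k] rn pos[of i] by (auto simp: power2_eq_square)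
    next
      case 2
      have "(\<Sum>t<m. u i t * u k t) = (\<Sum>t<m. w i t * q (k - r) t) / \<sigma> i"
        using 2 by (simp add: u_def sum_divide_distrib)
      thus ?thesis using 2 wq[of i "k - r"] ik by auto
    next
      case 3
      have "(\<Sum>t<m. u i t * u k t) = (\<Sum>t<m. w k t * q (i - r) t) / \<sigma> k"
        using 3 by (simp add: u_def sum_divide_distrib mult.commute)
      also have "\<dots> = 0" using wq[of k "i - r"] 3 ik by simp
      finally show ?thesis using 3 by auto
    next
      case 4
      thus ?thesis using q[of "i - r" "k - r"] ik by (auto simp: u_def)
    qed
  next
    fix i s assume i: "i < n" and s: "s < m"
    show "(\<Sum>t<n. a s t * v i t) = \<sigma> i * u i s"
    proof (cases "i < r")
      case True
      thus ?thesis using pos[OF True] by (simp add: u_def w_def)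
    next
      case False
      have "(\<Sum>s<m. w i s * w i s) = 0" using ww[OF i i] zero[OF i False] by simp
      hence "w i s = 0" using s sum_nonneg_eq_0_iff[of "{..<m}" "\<lambda>s. w i s * w i s"] by auto
      thus ?thesis using zero[OF i False] by (simp add: w_def)
    qed
  next
    fix i k :: nat assume "i \<le> k"
    thus "\<sigma> k \<le> \<sigma> i" using \<sigma>dec[of i k] \<sigma>0[of i] by (cases "k < n") (auto simp: \<sigma>_def)
  next
    fix i assume "n \<le> i"
    thus "\<sigma> i = 0" by (simp add: \<sigma>_def)
  qed (use v \<sigma>0 in blast)+
qed

text \<open>Courant-Fischer argument: the span of the first r + 1 vectors w contains a unit vector x
  orthogonal to the first r vectors v. There the common quadratic form is at least the square of
  \<rho> r and at most the square of \<sigma> r.\<close>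

lemma singular_values_unique_le:
  fixes v w :: "nat \<Rightarrow> nat \<Rightarrow> real"
  assumes v: "\<And>i k. i < n \<Longrightarrow> k < n \<Longrightarrow> (\<Sum>t<n. v i t * v k t) = (if i = k then 1 else 0)"
    and w: "\<And>i k. i < n \<Longrightarrow> k < n \<Longrightarrow> (\<Sum>t<n. w i t * w k t) = (if i = k then 1 else 0)"
    and dec: "\<And>i k. i \<le> k \<Longrightarrow> k < n \<Longrightarrow> \<sigma> k \<le> \<sigma> i" "\<And>i k. i \<le> k \<Longrightarrow> k < n \<Longrightarrow> \<rho> k \<le> \<rho> i"
    and nn: "\<And>i. i < n \<Longrightarrow> 0 \<le> \<sigma> i" "\<And>i. i < n \<Longrightarrow> 0 \<le> \<rho> i"
    and eq: "\<And>x. (\<Sum>i<n. (\<sigma> i * (\<Sum>t<n. v i t * x t))\<^sup>2) = (\<Sum>i<n. (\<rho> i * (\<Sum>t<n. w i t * x t))\<^sup>2)"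
    and r: "r < n"
  shows "\<rho> r \<le> \<sigma> r"
proof -
  obtain c where c: "(\<Sum>a<Suc r. (c a)\<^sup>2) = 1" "\<And>i. i < r \<Longrightarrow> (\<Sum>a<Suc r. (\<Sum>t<n. v i t * w a t) * c a) = 0"
    using orthogonal_unit_vector[of r "Suc r" "\<lambda>i a. \<Sum>t<n. v i t * w a t"] by auto
  define x where "x t = (\<Sum>a<Suc r. c a * w a t)" for t
  have wx: "(\<Sum>t<n. w i t * x t) = (if i < Suc r then c i else 0)" if "i < n" for i
  proof -
    have "(\<Sum>t<n. w i t * x t) = (\<Sum>a<Suc r. c a * (\<Sum>t<n. w i t * w a t))"
      unfolding x_def sum_distrib_left by (subst sum.swap) (simp only: mult_ac)
    also have "\<dots> = (\<Sum>a<Suc r. if a = i then c a else 0)"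
      using w[OF that] r by (intro sum.cong refl) auto
    finally show ?thesis by simp
  qed
  have vx: "(\<Sum>t<n. v i t * x t) = 0" if "i < r" for i
  proof -
    have "(\<Sum>t<n. v i t * x t) = (\<Sum>a<Suc r. (\<Sum>t<n. v i t * w a t) * c a)"
      unfolding x_def sum_distrib_left sum_distrib_right by (subst sum.swap) (simp only: mult_ac)
    thus ?thesis using c(2)[OF that] by simp
  qed
  have nx: "(\<Sum>i<n. (\<Sum>t<n. w i t * x t)\<^sup>2) = 1"
  proof -
    have "(\<Sum>i<n. (\<Sum>t<n. w i t * x t)\<^sup>2) = (\<Sum>i<n. if i < Suc r then (c i)\<^sup>2 else 0)"
      by (intro sum.cong refl) (simp add: wx)
    also have "\<dots> = (\<Sum>i<Suc r. (c i)\<^sup>2)" using r by (intro sum.mono_neutral_cong_right) auto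
    finally show ?thesis using c(1) by simp
  qed
  have nx': "(\<Sum>i<n. (\<Sum>t<n. v i t * x t)\<^sup>2) = 1"
    using nx orthonormal_parseval[OF v, of x x] orthonormal_parseval[OF w, of x x]
    by (simp add: power2_eq_square)
  have "(\<rho> r)\<^sup>2 = (\<Sum>i<n. (\<rho> r)\<^sup>2 * (\<Sum>t<n. w i t * x t)\<^sup>2)" using nx by (simp add: sum_distrib_left[symmetric])
  also have "\<dots> \<le> (\<Sum>i<n. (\<rho> i * (\<Sum>t<n. w i t * x t))\<^sup>2)"
  proof (rule sum_mono)
    fix i assume "i \<in> {..<n}"
    show "(\<rho> r)\<^sup>2 * (\<Sum>t<n. w i t * x t)\<^sup>2 \<le> (\<rho> i * (\<Sum>t<n. w i t * x t))\<^sup>2"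
    proof (cases "i < Suc r")
      case True
      hence "(\<rho> r)\<^sup>2 \<le> (\<rho> i)\<^sup>2" using dec(2)[of i r] nn(2)[of r] r by (intro power_mono) auto
      thus ?thesis by (simp add: power_mult_distrib mult_right_mono)
    next
      case False
      thus ?thesis using wx[of i] \<open>i \<in> {..<n}\<close> by simp
    qed
  qed
  also have "\<dots> = (\<Sum>i<n. (\<sigma> i * (\<Sum>t<n. v i t * x t))\<^sup>2)" by (rule eq[symmetric])
  also have "\<dots> \<le> (\<Sum>i<n. (\<sigma> r)\<^sup>2 * (\<Sum>t<n. v i t * x t)\<^sup>2)"
  proof (rule sum_mono)
    fix i assume "i \<in> {..<n}"
    show "(\<sigma> i * (\<Sum>t<n. v i t * x t))\<^sup>2 \<le> (\<sigma> r)\<^sup>2 * (\<Sum>t<n. v i t * x t)\<^sup>2"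
    proof (cases "i < r")
      case False
      hence "(\<sigma> i)\<^sup>2 \<le> (\<sigma> r)\<^sup>2" using dec(1)[of r i] nn(1)[of i] \<open>i \<in> {..<n}\<close> by (intro power_mono) auto
      thus ?thesis by (simp add: power_mult_distrib mult_right_mono)
    qed (simp add: vx)
  qed
  also have "\<dots> = (\<sigma> r)\<^sup>2" using nx' by (simp add: sum_distrib_left[symmetric])
  finally show ?thesis using nn(1)[OF r] by (rule power2_le_imp_le)
qed

text \<open>Indices start at 0, so \<sigma> i is singular value number i + 1. Extending \<sigma> by
  0 beyond n allows the coordinates along u, numbered up to m, to be handled uniformly.\<close>

locale svd_data =
  fixes m n :: nat and a u v :: "nat \<Rightarrow> nat \<Rightarrow> real" and \<sigma> :: "nat \<Rightarrow> real"
  assumes nm: "n \<le> m"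
    and u: "\<And>i k. i < m \<Longrightarrow> k < m \<Longrightarrow> (\<Sum>t<m. u i t * u k t) = (if i = k then 1 else 0)"
    and v: "\<And>i k. i < n \<Longrightarrow> k < n \<Longrightarrow> (\<Sum>t<n. v i t * v k t) = (if i = k then 1 else 0)"
    and \<sigma>_nonneg: "\<And>i. 0 \<le> \<sigma> i"
    and \<sigma>_dec: "\<And>i k. i \<le> k \<Longrightarrow> \<sigma> k \<le> \<sigma> i"
    and \<sigma>_zero: "\<And>i. n \<le> i \<Longrightarrow> \<sigma> i = 0"
    and av: "\<And>i s. i < n \<Longrightarrow> s < m \<Longrightarrow> (\<Sum>t<n. a s t * v i t) = \<sigma> i * u i s"
begin

definition cu :: "nat \<Rightarrow> (nat \<Rightarrow> real) \<Rightarrow> real" where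
  "cu i y = (\<Sum>s<m. u i s * y s)"

definition cv :: "nat \<Rightarrow> (nat \<Rightarrow> real) \<Rightarrow> real" where
  "cv i x = (\<Sum>t<n. v i t * x t)"

lemma cu_parseval: "(\<Sum>s<m. (y s)\<^sup>2) = (\<Sum>i<m. (cu i y)\<^sup>2)"
  using orthonormal_parseval[OF u, of y y] by (simp add: cu_def power2_eq_square)

lemma cv_parseval: "(\<Sum>t<n. (x t)\<^sup>2) = (\<Sum>i<n. (cv i x)\<^sup>2)"
  using orthonormal_parseval[OF v, of x x] by (simp add: cv_def power2_eq_square)

lemma cu_apply: 
  assumes "i < m"
  shows "cu i (\<lambda>s. \<Sum>t<n. a s t * x t) = \<sigma> i * cv i x"
proof -
  have e: "(\<Sum>t<n. a s t * x t) = (\<Sum>k<n. cv k x * (\<sigma> k * u k s))" if "s < m" for s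
  proof -
    have "(\<Sum>t<n. a s t * x t) = (\<Sum>t<n. a s t * (\<Sum>k<n. cv k x * v k t))"
      unfolding cv_def by (intro sum.cong refl arg_cong2[where f="(*)"] orthonormal_expansion[OF v]) auto
    also have "\<dots> = (\<Sum>k<n. cv k x * (\<Sum>t<n. a s t * v k t))"
      unfolding sum_distrib_left by (subst sum.swap) (simp only: mult_ac)
    finally show ?thesis using av that by simp
  qed
  have "cu i (\<lambda>s. \<Sum>t<n. a s t * x t) = (\<Sum>s<m. u i s * (\<Sum>k<n. cv k x * (\<sigma> k * u k s)))"
    unfolding cu_def by (intro sum.cong refl) (simp add: e)
  also have "\<dots> = (\<Sum>k<n. cv k x * \<sigma> k * (\<Sum>s<m. u i s * u k s))"
    unfolding sum_distrib_left by (subst sum.swap) (simp only: mult_ac)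
  also have "\<dots> = (\<Sum>k<n. if k = i then cv k x * \<sigma> k else 0)"
    using assms nm u by (intro sum.cong refl) auto
  also have "\<dots> = \<sigma> i * cv i x" using \<sigma>_zero[of i] by auto
  finally show ?thesis .
qed

lemma cu_apply_sym:
  assumes i: "i < m"
  shows "cu i (\<lambda>s. \<Sum>t<n. a s t * (\<Sum>r<m. a r t * y r)) = (\<sigma> i)\<^sup>2 * cu i y"
proof (cases "i < n")
  case True
  have "cv i (\<lambda>t. \<Sum>r<m. a r t * y r) = (\<Sum>r<m. y r * (\<Sum>t<n. a r t * v i t))"
    unfolding cv_def sum_distrib_left by (subst sum.swap) (simp only: mult_ac)
  also have "\<dots> = (\<Sum>r<m. y r * (\<sigma> i * u i r))" using av[OF True] by (intro sum.cong) auto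
  also have "\<dots> = \<sigma> i * cu i y" unfolding cu_def sum_distrib_left by (simp only: mult_ac)
  finally show ?thesis unfolding cu_apply[OF i] by (simp add: power2_eq_square)
next
  case False
  thus ?thesis unfolding cu_apply[OF i] using \<sigma>_zero[of i] by simp
qed

end

section \<open>Agreement with the economic SVD and with \<open>sing_val\<close>\<close>

lemma econ_svdD:
  assumes svd: "econ_svd B U S W" and B: "B \<in> carrier_mat r c"
  shows "U \<in> carrier_mat r c"
    and "\<And>i k. i < c \<Longrightarrow> k < c \<Longrightarrow> (\<Sum>s<r. U $$ (s, i) * U $$ (s, k)) = (if i = k then 1 else 0)"
    and "\<And>i k. i < c \<Longrightarrow> k < c \<Longrightarrow> (\<Sum>t<c. W $$ (t, i) * W $$ (t, k)) = (if i = k then 1 else 0)"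
    and "\<And>i. i < c \<Longrightarrow> 0 \<le> S $$ (i, i)"
    and "\<And>i k. i \<le> k \<Longrightarrow> k < c \<Longrightarrow> S $$ (k, k) \<le> S $$ (i, i)"
    and "\<And>s t. s < r \<Longrightarrow> t < c \<Longrightarrow> B $$ (s, t) = (\<Sum>i<c. U $$ (s, i) * S $$ (i, i) * W $$ (t, i))"
proof -
  have d: "dim_row B = r" "dim_col B = c" using B by auto
  have U: "U \<in> carrier_mat r c" and UU: "transpose_mat U * U = 1\<^sub>m c" and S: "S \<in> carrier_mat c c"
    and off: "\<And>i j. i < c \<Longrightarrow> j < c \<Longrightarrow> i \<noteq> j \<Longrightarrow> S $$ (i, j) = 0"
    and pos: "\<And>i. i < c \<Longrightarrow> 0 \<le> S $$ (i, i)"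
    and dec: "\<And>i j. i \<le> j \<Longrightarrow> j < c \<Longrightarrow> S $$ (j, j) \<le> S $$ (i, i)"
    and W: "W \<in> carrier_mat c c" and WW: "transpose_mat W * W = 1\<^sub>m c"
    and eq: "B = U * S * transpose_mat W"
    using svd unfolding econ_svd_def Let_def d by auto
  show "U \<in> carrier_mat r c" by fact
  show "(\<Sum>s<r. U $$ (s, i) * U $$ (s, k)) = (if i = k then 1 else 0)" if "i < c" "k < c" for i k
  proof -
    have "(transpose_mat U * U) $$ (i, k) = (if i = k then 1 else 0)" unfolding UU using that by simp
    thus ?thesis using U that by (simp add: scalar_prod_def atLeast0LessThan)
  qed
  show "(\<Sum>t<c. W $$ (t, i) * W $$ (t, k)) = (if i = k then 1 else 0)" if "i < c" "k < c" for i k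
  proof -
    have "(transpose_mat W * W) $$ (i, k) = (if i = k then 1 else 0)" unfolding WW using that by simp
    thus ?thesis using W that by (simp add: scalar_prod_def atLeast0LessThan)
  qed
  show "0 \<le> S $$ (i, i)" if "i < c" for i by (rule pos[OF that])
  show "S $$ (k, k) \<le> S $$ (i, i)" if "i \<le> k" "k < c" for i k by (rule dec[OF that])
  show "B $$ (s, t) = (\<Sum>i<c. U $$ (s, i) * S $$ (i, i) * W $$ (t, i))" if s: "s < r" and t: "t < c" for s t
  proof -
    have US: "(U * S) $$ (s, i) = U $$ (s, i) * S $$ (i, i)" if "i < c" for i
    proof -
      have "(U * S) $$ (s, i) = (\<Sum>k<c. U $$ (s, k) * S $$ (k, i))"
        using U S s that by (simp add: scalar_prod_def atLeast0LessThan)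
      also have "\<dots> = (\<Sum>k<c. if k = i then U $$ (s, k) * S $$ (k, i) else 0)"
        using off that by (intro sum.cong refl) auto
      finally show ?thesis using that by simp
    qed
    have "B $$ (s, t) = (\<Sum>i<c. (U * S) $$ (s, i) * W $$ (t, i))"
    proof -
      have US': "U * S \<in> carrier_mat r c" using U S by auto
      have "B $$ (s, t) = row (U * S) s \<bullet> col (transpose_mat W) t"
        unfolding eq using US' W s t by (intro index_mult_mat(1)) auto
      also have "\<dots> = (\<Sum>i<c. row (U * S) s $ i * col (transpose_mat W) t $ i)"
        using W by (simp add: scalar_prod_def atLeast0LessThan del: index_row)
      also have "\<dots> = (\<Sum>i<c. (U * S) $$ (s, i) * W $$ (t, i))"
      proof (intro sum.cong refl)
        fix i assume "i \<in> {..<c}"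
        hence i: "i < c" by simp
        have "row (U * S) s $ i = (U * S) $$ (s, i)"
          using US' s i by (intro index_row(1)) (auto simp del: index_mult_mat)
        moreover have "col (transpose_mat W) t $ i = W $$ (t, i)" using W t i by simp
        ultimately show "row (U * S) s $ i * col (transpose_mat W) t $ i = (U * S) $$ (s, i) * W $$ (t, i)"
          by simp
      qed
      finally show ?thesis .
    qed
    thus ?thesis using US by simp
  qed
qed

text \<open>Both decompositions diagonalise the quadratic form |A x|^2, so
  \<open>singular_values_unique_le\<close> applies in both directions. This uniqueness makes the
  definite description in \<open>sing_val\<close> denote.\<close>

lemma (in svd_data) econ_svd_diag:
  assumes A: "A \<in> carrier_mat m n" and a: "\<And>s t. s < m \<Longrightarrow> t < n \<Longrightarrow> a s t = A $$ (s, t)"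
    and svd: "econ_svd A U S W" and r: "r < n"
  shows "S $$ (r, r) = \<sigma> r"
proof -
  note E = econ_svdD[OF svd A]
  define w where "w i t = W $$ (t, i)" for i t
  have w: "(\<Sum>t<n. w i t * w k t) = (if i = k then 1 else 0)" if "i < n" "k < n" for i k
    using E(3)[OF that] by (simp add: w_def)
  have eq: "(\<Sum>i<n. (\<sigma> i * (\<Sum>t<n. v i t * x t))\<^sup>2) = (\<Sum>i<n. (S $$ (i, i) * (\<Sum>t<n. w i t * x t))\<^sup>2)" for x
  proof -
    let ?y = "\<lambda>s. \<Sum>t<n. a s t * x t"
    let ?z = "\<lambda>i. S $$ (i, i) * (\<Sum>t<n. w i t * x t)"
    have "(\<Sum>s<m. (?y s)\<^sup>2) = (\<Sum>i<m. (\<sigma> i * cv i x)\<^sup>2)"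
      by (subst cu_parseval) (intro sum.cong refl, simp add: cu_apply)
    also have "\<dots> = (\<Sum>i<n. (\<sigma> i * cv i x)\<^sup>2)"
      using nm \<sigma>_zero by (intro sum.mono_neutral_right) auto
    finally have 1: "(\<Sum>s<m. (?y s)\<^sup>2) = (\<Sum>i<n. (\<sigma> i * cv i x)\<^sup>2)" .
    have y: "?y s = (\<Sum>i<n. U $$ (s, i) * ?z i)" if s: "s < m" for s
    proof -
      have "?y s = (\<Sum>t<n. (\<Sum>i<n. U $$ (s, i) * S $$ (i, i) * W $$ (t, i)) * x t)"
        using a s E(6)[OF s] by (intro sum.cong refl) auto
      also have "\<dots> = (\<Sum>i<n. U $$ (s, i) * ?z i)"
        unfolding sum_distrib_right sum_distrib_left by (subst sum.swap) (simp add: w_def mult_ac)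
      finally show ?thesis .
    qed
    have "(\<Sum>s<m. (?y s)\<^sup>2) = (\<Sum>s<m. \<Sum>i<n. \<Sum>k<n. ?z i * ?z k * (U $$ (s, i) * U $$ (s, k)))"
    proof (intro sum.cong refl)
      fix s assume "s \<in> {..<m}"
      hence "(?y s)\<^sup>2 = (\<Sum>i<n. U $$ (s, i) * ?z i) * (\<Sum>k<n. U $$ (s, k) * ?z k)"
        using y by (simp add: power2_eq_square)
      thus "(?y s)\<^sup>2 = (\<Sum>i<n. \<Sum>k<n. ?z i * ?z k * (U $$ (s, i) * U $$ (s, k)))"
        by (simp add: sum_product mult_ac)
    qed
    also have "\<dots> = (\<Sum>i<n. \<Sum>k<n. ?z i * ?z k * (\<Sum>s<m. U $$ (s, i) * U $$ (s, k)))"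
      unfolding sum_distrib_left by (subst sum.swap, rule sum.cong, simp, rule sum.swap)
    also have "\<dots> = (\<Sum>i<n. \<Sum>k<n. if k = i then ?z i * ?z k else 0)"
      using E(2) by (intro sum.cong refl) auto
    also have "\<dots> = (\<Sum>i<n. (?z i)\<^sup>2)" by (simp add: power2_eq_square)
    finally show ?thesis using 1 by (simp add: cv_def)
  qed
  have "S $$ (r, r) \<le> \<sigma> r"
    by (rule singular_values_unique_le[OF v w \<sigma>_dec E(5) \<sigma>_nonneg E(4) eq r])
  moreover have "\<sigma> r \<le> S $$ (r, r)"
    by (rule singular_values_unique_le[OF w v E(5) \<sigma>_dec E(4) \<sigma>_nonneg eq[symmetric] r])
  ultimately show ?thesis by simp
qed

lemma (in svd_data) sing_val_eq:
  assumes A: "A \<in> carrier_mat m n" and a: "\<And>s t. s < m \<Longrightarrow> t < n \<Longrightarrow> a s t = A $$ (s, t)"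
    and i: "i < n"
  shows "sing_val A (i + 1) = \<sigma> i"
proof -
  define U where "U = mat m n (\<lambda>(s, i). u i s)"
  define S where "S = mat n n (\<lambda>(i, k). if i = k then \<sigma> i else 0)"
  define W where "W = mat n n (\<lambda>(t, i). v i t)"
  have d: "dim_row A = m" "dim_col A = n" using A by auto
  have "econ_svd A U S W" unfolding econ_svd_def Let_def d
  proof (intro conjI)
    show "transpose_mat U * U = 1\<^sub>m n"
      using nm u by (intro eq_matI) (auto simp: U_def scalar_prod_def atLeast0LessThan)
    show "transpose_mat W * W = 1\<^sub>m n"
      using v by (intro eq_matI) (auto simp: W_def scalar_prod_def atLeast0LessThan)
    show "A = U * S * transpose_mat W"
    proof (rule eq_matI)
      fix s t assume "s < dim_row (U * S * transpose_mat W)" "t < dim_col (U * S * transpose_mat W)"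
      hence st: "s < m" "t < n" by (auto simp: U_def W_def)
      have US: "(U * S) $$ (s, k) = u k s * \<sigma> k" if "k < n" for k
        using st that by (simp add: U_def S_def scalar_prod_def atLeast0LessThan if_distrib[of "\<lambda>x. _ * x"] cong: if_cong)
      have "(U * S * transpose_mat W) $$ (s, t) = (\<Sum>k<n. (U * S) $$ (s, k) * v k t)"
        using st by (subst index_mult_mat(1)) (auto simp: U_def S_def W_def scalar_prod_def atLeast0LessThan)
      also have "\<dots> = (\<Sum>k<n. (\<Sum>r<n. v k r * a s r) * v k t)"
        using US av st by (intro sum.cong refl) (simp add: mult.commute)
      also have "\<dots> = a s t" by (rule orthonormal_expansion[OF v st(2), symmetric])
      finally show "A $$ (s, t) = (U * S * transpose_mat W) $$ (s, t)" using a st by simp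
    qed (use A in \<open>auto simp: U_def W_def\<close>)
  qed (use \<sigma>_nonneg \<sigma>_dec in \<open>auto simp: U_def S_def W_def\<close>)
  hence ex: "\<exists>U S W. econ_svd A U S W \<and> map \<sigma> [0..<n] = map (\<lambda>i. S $$ (i, i)) [0..<n]"
    by (intro exI[of _ U] exI[of _ S] exI[of _ W]) (auto simp: S_def)
  have "(THE xs. \<exists>U S W. econ_svd A U S W \<and> xs = map (\<lambda>i. S $$ (i, i)) [0..<n]) = map \<sigma> [0..<n]"
  proof (rule the_equality)
    show "\<exists>U S W. econ_svd A U S W \<and> map \<sigma> [0..<n] = map (\<lambda>i. S $$ (i, i)) [0..<n]" by (rule ex)
    fix xs assume "\<exists>U S W. econ_svd A U S W \<and> xs = map (\<lambda>i. S $$ (i, i)) [0..<n]"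
    thus "xs = map \<sigma> [0..<n]" using econ_svd_diag[OF A a] by auto
  qed
  thus ?thesis unfolding sing_val_def d using i by simp
qed

section \<open>Runs of the algorithm\<close>

locale alg2_data = svd_data +
  fixes A Om :: "real mat" and k s p l :: nat and Q Sh W :: "nat \<Rightarrow> real mat" and \<alpha> :: "nat \<Rightarrow> real"
  assumes A: "A \<in> carrier_mat m n" and aA: "\<And>r t. r < m \<Longrightarrow> t < n \<Longrightarrow> a r t = A $$ (r, t)"
    and Om: "Om \<in> carrier_mat n l" and l: "l = k + s" "0 < l" "l \<le> n"
    and run: "alg2_run A k s p Om Q \<alpha> Sh W"
begin

definition Qv :: "nat \<Rightarrow> (nat \<Rightarrow> real) \<Rightarrow> nat \<Rightarrow> real" where
  "Qv c z r = (\<Sum>b<l. Q c $$ (r, b) * z b)"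

definition S :: "nat \<Rightarrow> real" where
  "S c = Sh c $$ (l - 1, l - 1)"

abbreviation "Bmat c \<equiv> A * transpose_mat A * Q (c - 1) - \<alpha> c \<cdot>\<^sub>m Q (c - 1)"

lemma run0: "Q 0 \<in> carrier_mat m l" "transpose_mat (Q 0) * Q 0 = 1\<^sub>m l"
    "col_space (Q 0) = col_space (A * Om)" "\<alpha> 1 = 0"
  using run A unfolding alg2_run_def Let_def l(1) by auto

lemma run_svd: "c \<in> {1..p} \<Longrightarrow> econ_svd (Bmat c) (Q c) (Sh c) (W c)"
  using run unfolding alg2_run_def Let_def by auto

lemma run_shift: "c \<in> {1..p} \<Longrightarrow> \<alpha> (c + 1) = (if S c > \<alpha> c then (S c + \<alpha> c) / 2 else \<alpha> c)"
  using run unfolding alg2_run_def Let_def S_def l(1)[symmetric] by auto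

lemma Q_carrier: "c \<le> p \<Longrightarrow> Q c \<in> carrier_mat m l"
proof (induction c)
  case (Suc c)
  have B: "Bmat (Suc c) \<in> carrier_mat m l" using Suc A by auto
  show ?case by (rule econ_svdD(1)[OF run_svd B]) (use Suc in auto)
qed (rule run0)

lemma Bmat_carrier:
  assumes "c \<in> {1..p}"
  shows "Bmat c \<in> carrier_mat m l"
proof -
  have "Q (c - 1) \<in> carrier_mat m l" using assms by (intro Q_carrier) auto
  moreover from this have "A * transpose_mat A * Q (c - 1) \<in> carrier_mat m l" using A by (intro mult_carrier_mat) auto
  ultimately show ?thesis by (intro minus_carrier_mat) auto
qed

lemma Q_orth:
  assumes "c \<le> p" "i < l" "b < l"
  shows "(\<Sum>r<m. Q c $$ (r, i) * Q c $$ (r, b)) = (if i = b then 1 else 0)"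
proof (cases "c = 0")
  case True
  have "(transpose_mat (Q 0) * Q 0) $$ (i, b) = (if i = b then 1 else 0)"
    unfolding run0 using assms by simp
  thus ?thesis using run0(1) assms True by (simp add: scalar_prod_def atLeast0LessThan)
next
  case False
  have B: "Bmat c \<in> carrier_mat m l" using assms False by (intro Bmat_carrier) auto
  show ?thesis by (rule econ_svdD(2)[OF run_svd B]) (use assms False in auto)
qed

lemma Qv_inner:
  assumes "c \<le> p"
  shows "(\<Sum>r<m. Qv c z r * Qv c w r) = (\<Sum>b<l. z b * w b)"
proof -
  have "(\<Sum>r<m. Qv c z r * Qv c w r) = (\<Sum>r<m. \<Sum>i<l. \<Sum>b<l. z i * w b * (Q c $$ (r, i) * Q c $$ (r, b)))"
    unfolding Qv_def sum_product by (intro sum.cong refl) (simp only: mult_ac)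
  also have "\<dots> = (\<Sum>i<l. \<Sum>b<l. z i * w b * (\<Sum>r<m. Q c $$ (r, i) * Q c $$ (r, b)))"
    unfolding sum_distrib_left by (subst sum.swap, rule sum.cong, simp, rule sum.swap)
  also have "\<dots> = (\<Sum>i<l. \<Sum>b<l. if b = i then z i * w b else 0)"
    using Q_orth[OF assms] by (intro sum.cong refl) auto
  finally show ?thesis by simp
qed

lemma Qv_norm: "c \<le> p \<Longrightarrow> (\<Sum>i<m. (cu i (Qv c z))\<^sup>2) = (\<Sum>b<l. (z b)\<^sup>2)"
  unfolding cu_parseval[symmetric] using Qv_inner[of c z z] by (simp add: power2_eq_square)

lemma Bmat_entry:
  assumes c: "c \<in> {1..p}" and r: "r < m" and b: "b < l"
  shows "Bmat c $$ (r, b) = (\<Sum>t<n. a r t * (\<Sum>q<m. a q t * Q (c - 1) $$ (q, b))) - \<alpha> c * Q (c - 1) $$ (r, b)"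
proof -
  have Qc: "Q (c - 1) \<in> carrier_mat m l" using Q_carrier[of "c - 1"] c by auto
  have AA: "A * transpose_mat A \<in> carrier_mat m m" using A by auto
  have AAe: "(A * transpose_mat A) $$ (r, q) = (\<Sum>t<n. a r t * a q t)" if "q < m" for q
    using A aA r that by (simp add: scalar_prod_def atLeast0LessThan)
  have "(A * transpose_mat A * Q (c - 1)) $$ (r, b) = row (A * transpose_mat A) r \<bullet> col (Q (c - 1)) b"
    using AA Qc r b by (intro index_mult_mat(1)) (auto simp del: index_mult_mat)
  also have "\<dots> = (\<Sum>q<m. row (A * transpose_mat A) r $ q * col (Q (c - 1)) b $ q)"
    using Qc by (simp add: scalar_prod_def atLeast0LessThan del: index_row)
  also have "\<dots> = (\<Sum>q<m. (\<Sum>t<n. a r t * a q t) * Q (c - 1) $$ (q, b))"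
  proof (intro sum.cong refl)
    fix q assume "q \<in> {..<m}"
    hence q: "q < m" by simp
    have "row (A * transpose_mat A) r $ q = (A * transpose_mat A) $$ (r, q)"
      using AA r q by (intro index_row(1)) (auto simp del: index_mult_mat)
    thus "row (A * transpose_mat A) r $ q * col (Q (c - 1)) b $ q = (\<Sum>t<n. a r t * a q t) * Q (c - 1) $$ (q, b)"
      using AAe[OF q] Qc q b by simp
  qed
  also have "\<dots> = (\<Sum>t<n. a r t * (\<Sum>q<m. a q t * Q (c - 1) $$ (q, b)))"
    unfolding sum_distrib_left sum_distrib_right by (subst sum.swap) (simp only: mult_ac)
  finally show ?thesis using Qc AA r b by simp
qed

text \<open>The witness is the diagonal of \<open>Sh c\<close> times the transpose of
  \<open>W c\<close> applied to z: the SVD says that it represents, in the new basis, the old vector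
  multiplied by the shifted matrix. The norm estimate holds because S c is the smallest singular
  value.\<close>

lemma power_step:
  assumes c: "c \<in> {1..p}"
  shows "\<exists>z'. (\<forall>i<m. cu i (Qv c z') = ((\<sigma> i)\<^sup>2 - \<alpha> c) * cu i (Qv (c - 1) z)) \<and>
     (S c)\<^sup>2 * (\<Sum>b<l. (z b)\<^sup>2) \<le> (\<Sum>b<l. (z' b)\<^sup>2)"
proof -
  note B = Bmat_carrier[OF c]
  note E = econ_svdD[OF run_svd[OF c] B]
  define w where "w i b = W c $$ (b, i)" for i b
  have w: "(\<Sum>t<l. w i t * w b t) = (if i = b then 1 else 0)" if "i < l" "b < l" for i b
    using E(3)[OF that] by (simp add: w_def)
  define z' where "z' i = Sh c $$ (i, i) * (\<Sum>b<l. w i b * z b)" for i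
  let ?y = "Qv (c - 1) z"
  have Qz: "Qv c z' r = (\<Sum>t<n. a r t * (\<Sum>q<m. a q t * ?y q)) - \<alpha> c * ?y r" if r: "r < m" for r
  proof -
    have "Qv c z' r = (\<Sum>b<l. (\<Sum>i<l. Q c $$ (r, i) * Sh c $$ (i, i) * W c $$ (b, i)) * z b)"
      unfolding Qv_def z'_def w_def sum_distrib_left sum_distrib_right by (subst sum.swap) (simp only: mult_ac)
    also have "\<dots> = (\<Sum>b<l. Bmat c $$ (r, b) * z b)" using E(6)[OF r] by (intro sum.cong refl) auto
    also have "\<dots> = (\<Sum>b<l. (\<Sum>t<n. a r t * (\<Sum>q<m. a q t * Q (c - 1) $$ (q, b))) * z b) - \<alpha> c * ?y r"
      using Bmat_entry[OF c r] by (simp add: left_diff_distrib sum_subtractf Qv_def sum_distrib_left mult.assoc)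
    also have "(\<Sum>b<l. (\<Sum>t<n. a r t * (\<Sum>q<m. a q t * Q (c - 1) $$ (q, b))) * z b)
       = (\<Sum>t<n. a r t * (\<Sum>q<m. a q t * ?y q))"
    proof -
      define g where "g t b = (\<Sum>q<m. a q t * Q (c - 1) $$ (q, b))" for t b
      have 1: "(\<Sum>q<m. a q t * ?y q) = (\<Sum>b<l. g t b * z b)" for t
        unfolding g_def Qv_def sum_distrib_left sum_distrib_right by (subst sum.swap) (simp only: mult_ac)
      show ?thesis unfolding g_def[symmetric] 1 sum_distrib_left sum_distrib_right
        by (subst sum.swap) (simp only: mult_ac)
    qed
    finally show ?thesis .
  qed
  have "cu i (Qv c z') = ((\<sigma> i)\<^sup>2 - \<alpha> c) * cu i ?y" if i: "i < m" for i
  proof -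
    have "cu i (Qv c z') = (\<Sum>r<m. u i r * ((\<Sum>t<n. a r t * (\<Sum>q<m. a q t * ?y q)) - \<alpha> c * ?y r))"
      unfolding cu_def using Qz by (intro sum.cong refl) auto
    also have "\<dots> = cu i (\<lambda>r. \<Sum>t<n. a r t * (\<Sum>q<m. a q t * ?y q)) - \<alpha> c * cu i ?y"
      unfolding cu_def right_diff_distrib sum_subtractf by (simp add: sum_distrib_left mult_ac)
    finally show ?thesis unfolding cu_apply_sym[OF i] by (simp add: left_diff_distrib)
  qed
  moreover have "(S c)\<^sup>2 * (\<Sum>b<l. (z b)\<^sup>2) \<le> (\<Sum>b<l. (z' b)\<^sup>2)"
  proof -
    have "(\<Sum>b<l. (z b)\<^sup>2) = (\<Sum>i<l. (\<Sum>b<l. w i b * z b)\<^sup>2)"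
      using orthonormal_parseval[OF w, of z z] by (simp add: power2_eq_square)
    hence "(S c)\<^sup>2 * (\<Sum>b<l. (z b)\<^sup>2) = (\<Sum>i<l. (S c)\<^sup>2 * (\<Sum>b<l. w i b * z b)\<^sup>2)"
      by (simp add: sum_distrib_left)
    also have "\<dots> \<le> (\<Sum>i<l. (z' i)\<^sup>2)"
    proof (rule sum_mono)
      fix i assume "i \<in> {..<l}"
      hence "(S c)\<^sup>2 \<le> (Sh c $$ (i, i))\<^sup>2"
        unfolding S_def using E(4)[of "l - 1"] E(5)[of i "l - 1"] l by (intro power_mono) auto
      thus "(S c)\<^sup>2 * (\<Sum>b<l. w i b * z b)\<^sup>2 \<le> (z' i)\<^sup>2"
        unfolding z'_def power_mult_distrib by (intro mult_right_mono) auto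
    qed
    finally show ?thesis .
  qed
  ultimately show ?thesis by blast
qed

lemma S_nonneg: "c \<in> {1..p} \<Longrightarrow> S c \<ge> 0"
proof -
  assume c: "c \<in> {1..p}"
  note B = Bmat_carrier[OF c]
  show ?thesis unfolding S_def using econ_svdD(4)[OF run_svd[OF c] B, of "l - 1"] l by simp
qed

lemma S_le_norm:
  assumes c: "c \<in> {1..p}"
  shows "(S c)\<^sup>2 * (\<Sum>b<l. (z b)\<^sup>2) \<le> (\<Sum>i<m. (((\<sigma> i)\<^sup>2 - \<alpha> c) * cu i (Qv (c - 1) z))\<^sup>2)"
proof -
  obtain z' where z': "\<forall>i<m. cu i (Qv c z') = ((\<sigma> i)\<^sup>2 - \<alpha> c) * cu i (Qv (c - 1) z)"
    "(S c)\<^sup>2 * (\<Sum>b<l. (z b)\<^sup>2) \<le> (\<Sum>b<l. (z' b)\<^sup>2)" using power_step[OF c, of z] by blast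
  have "(\<Sum>b<l. (z' b)\<^sup>2) = (\<Sum>i<m. (cu i (Qv c z'))\<^sup>2)" using Qv_norm[of c z'] c by simp
  also have "\<dots> = (\<Sum>i<m. (((\<sigma> i)\<^sup>2 - \<alpha> c) * cu i (Qv (c - 1) z))\<^sup>2)"
    using z'(1) by (intro sum.cong refl) auto
  finally show ?thesis using z'(2) by simp
qed

text \<open>The initial step c0 is arbitrary: it is 0 for the Gaussian start and a later step in
  \<open>large_shift_error\<close>.\<close>

lemma power_steps:
  assumes "c0 \<le> c" "c \<le> p"
  shows "\<exists>z. \<forall>i<m. cu i (Qv c z) = (\<Prod>b\<in>{c0<..c}. (\<sigma> i)\<^sup>2 - \<alpha> b) * cu i (Qv c0 z0)"
  using assms
proof (induction c rule: dec_induct)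
  case base
  show ?case by (intro exI[of _ z0]) simp
next
  case (step c)
  then obtain z where z: "\<forall>i<m. cu i (Qv c z) = (\<Prod>b\<in>{c0<..c}. (\<sigma> i)\<^sup>2 - \<alpha> b) * cu i (Qv c0 z0)" by auto
  have "Suc c \<in> {1..p}" using step by auto
  from power_step[OF this, of z] obtain z' where
    "\<forall>i<m. cu i (Qv (Suc c) z') = ((\<sigma> i)\<^sup>2 - \<alpha> (Suc c)) * cu i (Qv c z)" by auto
  moreover have "{c0<..Suc c} = insert (Suc c) {c0<..c}" using step by auto
  ultimately show ?case using z by (intro exI[of _ z']) (simp add: mult.assoc)
qed

section \<open>The starting subspace, the rank of A and the size of the shifts\<close>

lemma col_space_iff: "B \<in> carrier_mat r c \<Longrightarrow> y \<in> col_space B \<longleftrightarrow>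
    (\<exists>z. y = Matrix.vec r (\<lambda>i. \<Sum>b<c. B $$ (i, b) * z b))"
proof
  assume B: "B \<in> carrier_mat r c" and "y \<in> col_space B"
  then obtain x where x: "x \<in> carrier_vec c" "y = B *\<^sub>v x" by (auto simp: col_space_def)
  thus "\<exists>z. y = Matrix.vec r (\<lambda>i. \<Sum>b<c. B $$ (i, b) * z b)"
    using B by (intro exI[of _ "\<lambda>b. x $ b"]) (auto intro!: eq_vecI simp: scalar_prod_def atLeast0LessThan)
next
  assume B: "B \<in> carrier_mat r c" and "\<exists>z. y = Matrix.vec r (\<lambda>i. \<Sum>b<c. B $$ (i, b) * z b)"
  then obtain z where "y = Matrix.vec r (\<lambda>i. \<Sum>b<c. B $$ (i, b) * z b)" by blast
  hence "y = B *\<^sub>v Matrix.vec c z"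
    using B by (auto intro!: eq_vecI simp: scalar_prod_def atLeast0LessThan)
  thus "y \<in> col_space B" using B by (auto simp: col_space_def)
qed

definition Omv :: "(nat \<Rightarrow> real) \<Rightarrow> nat \<Rightarrow> real" where
  "Omv h t = (\<Sum>b<l. Om $$ (t, b) * h b)"

lemma AOm_entry: "r < m \<Longrightarrow> (\<Sum>b<l. (A * Om) $$ (r, b) * h b) = (\<Sum>t<n. a r t * Omv h t)"
proof -
  assume r: "r < m"
  have "(\<Sum>b<l. (A * Om) $$ (r, b) * h b) = (\<Sum>b<l. (\<Sum>t<n. a r t * Om $$ (t, b)) * h b)"
    using A Om aA r by (intro sum.cong refl) (simp add: scalar_prod_def atLeast0LessThan)
  also have "\<dots> = (\<Sum>t<n. a r t * Omv h t)"
    unfolding Omv_def sum_distrib_left sum_distrib_right by (subst sum.swap) (simp only: mult_ac)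
  finally show ?thesis .
qed

lemma start: "\<exists>z. \<forall>i<m. cu i (Qv 0 z) = \<sigma> i * cv i (Omv h)"
proof -
  have AO: "A * Om \<in> carrier_mat m l" using A Om by auto
  have "Matrix.vec m (\<lambda>i. \<Sum>b<l. (A * Om) $$ (i, b) * h b) \<in> col_space (A * Om)"
    unfolding col_space_iff[OF AO] by blast
  hence "Matrix.vec m (\<lambda>i. \<Sum>b<l. (A * Om) $$ (i, b) * h b) \<in> col_space (Q 0)" using run0 by simp
  then obtain z where z: "Matrix.vec m (\<lambda>i. \<Sum>b<l. (A * Om) $$ (i, b) * h b) = Matrix.vec m (\<lambda>i. \<Sum>b<l. Q 0 $$ (i, b) * z b)"
    unfolding col_space_iff[OF run0(1)] by blast
  have "Qv 0 z r = (\<Sum>t<n. a r t * Omv h t)" if "r < m" for r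
    using arg_cong[OF z, of "\<lambda>y. y $ r"] that AOm_entry[OF that, of h] by (simp add: Qv_def)
  hence "cu i (Qv 0 z) = cu i (\<lambda>r. \<Sum>t<n. a r t * Omv h t)" for i
    unfolding cu_def by (intro sum.cong refl) auto
  thus ?thesis by (intro exI[of _ z]) (simp add: cu_apply)
qed

lemma start_range: "\<exists>h. \<forall>i<m. cu i (Qv 0 z) = \<sigma> i * cv i (Omv h)"
proof -
  have AO: "A * Om \<in> carrier_mat m l" using A Om by auto
  have "Matrix.vec m (\<lambda>i. \<Sum>b<l. Q 0 $$ (i, b) * z b) \<in> col_space (Q 0)"
    unfolding col_space_iff[OF run0(1)] by blast
  hence "Matrix.vec m (\<lambda>i. \<Sum>b<l. Q 0 $$ (i, b) * z b) \<in> col_space (A * Om)" using run0 by simp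
  then obtain h where z: "Matrix.vec m (\<lambda>i. \<Sum>b<l. Q 0 $$ (i, b) * z b) = Matrix.vec m (\<lambda>i. \<Sum>b<l. (A * Om) $$ (i, b) * h b)"
    unfolding col_space_iff[OF AO] by blast
  have "Qv 0 z r = (\<Sum>t<n. a r t * Omv h t)" if "r < m" for r
    using arg_cong[OF z, of "\<lambda>y. y $ r"] that AOm_entry[OF that, of h] by (simp add: Qv_def)
  hence "cu i (Qv 0 z) = cu i (\<lambda>r. \<Sum>t<n. a r t * Omv h t)" for i
    unfolding cu_def by (intro sum.cong refl) auto
  thus ?thesis by (intro exI[of _ h]) (simp add: cu_apply)
qed

lemma cu_Qv: "cu i (Qv c z) = (\<Sum>b<l. (\<Sum>q<m. u i q * Q c $$ (q, b)) * z b)"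
  unfolding cu_def Qv_def sum_distrib_left sum_distrib_right by (subst sum.swap) (simp only: mult_ac)

lemma unit_coordinates_orthogonal:
  assumes "r < l"
  obtains z where "(\<Sum>b<l. (z b)\<^sup>2) = 1" "\<And>i. i < r \<Longrightarrow> cu i (Qv c z) = 0"
proof -
  obtain z where z: "(\<Sum>b<l. (z b)\<^sup>2) = 1" "\<And>i. i < r \<Longrightarrow> (\<Sum>b<l. (\<Sum>q<m. u i q * Q c $$ (q, b)) * z b) = 0"
    using orthogonal_unit_vector[OF assms, of "\<lambda>i b. \<Sum>q<m. u i q * Q c $$ (q, b)"] by blast
  show ?thesis by (rule that[OF z(1)]) (simp add: cu_Qv z(2))
qed

text \<open>The existence of a run forces rank at least l, since \<open>Q 0\<close> has l
  orthonormal columns in the range of A: otherwise a unit z with vanishing first l - 1 coordinates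
  would have image 0. The positivity of the filter denominators rests on this.\<close>

lemma \<sigma>_pos: "\<sigma> (l - 1) > 0"
proof (rule ccontr)
  assume "\<not> \<sigma> (l - 1) > 0"
  hence z0: "\<sigma> i = 0" if "l - 1 \<le> i" for i using \<sigma>_nonneg[of i] \<sigma>_dec[OF that] by linarith
  obtain z where z: "(\<Sum>b<l. (z b)\<^sup>2) = 1" "\<And>i. i < l - 1 \<Longrightarrow> cu i (Qv 0 z) = 0"
    using unit_coordinates_orthogonal[of "l - 1" 0] l by auto
  obtain h where h: "\<forall>i<m. cu i (Qv 0 z) = \<sigma> i * cv i (Omv h)" using start_range by blast
  have "cu i (Qv 0 z) = 0" if "i < m" for i
    using z(2)[of i] h that z0[of i] by (cases "i < l - 1") auto
  hence "(\<Sum>i<m. (cu i (Qv 0 z))\<^sup>2) = 0" by simp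
  thus False using Qv_norm[of 0 z] z by simp
qed

text \<open>l - 1 linear conditions on l unknowns leave a unit z whose vector has vanishing first l
  - 1 coordinates; S c is at most the amplification of that vector.\<close>

lemma S_le:
  assumes c: "c \<in> {1..p}" and M: "\<And>i. l - 1 \<le> i \<Longrightarrow> \<bar>(\<sigma> i)\<^sup>2 - \<alpha> c\<bar> \<le> M"
  shows "S c \<le> M"
proof -
  obtain z where z: "(\<Sum>b<l. (z b)\<^sup>2) = 1" "\<And>i. i < l - 1 \<Longrightarrow> cu i (Qv (c - 1) z) = 0"
    using unit_coordinates_orthogonal[of "l - 1" "c - 1"] l by auto
  have M0: "M \<ge> 0" using M[of "l - 1"] abs_ge_zero order_trans by blast
  have "(S c)\<^sup>2 \<le> (\<Sum>i<m. (((\<sigma> i)\<^sup>2 - \<alpha> c) * cu i (Qv (c - 1) z))\<^sup>2)"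
    using S_le_norm[OF c, of z] z by simp
  also have "\<dots> \<le> (\<Sum>i<m. M\<^sup>2 * (cu i (Qv (c - 1) z))\<^sup>2)"
  proof (rule sum_mono)
    fix i
    show "(((\<sigma> i)\<^sup>2 - \<alpha> c) * cu i (Qv (c - 1) z))\<^sup>2 \<le> M\<^sup>2 * (cu i (Qv (c - 1) z))\<^sup>2"
    proof (cases "i < l - 1")
      case False
      have "((\<sigma> i)\<^sup>2 - \<alpha> c)\<^sup>2 \<le> M\<^sup>2" using M[of i] False M0 by (simp add: abs_le_square_iff[symmetric])
      thus ?thesis unfolding power_mult_distrib by (rule mult_right_mono) simp
    qed (use z(2)[of i] in simp)
  qed
  also have "\<dots> = M\<^sup>2"
  proof -
    have "(\<Sum>i<m. (cu i (Qv (c - 1) z))\<^sup>2) = 1" using Qv_norm[of "c - 1" z] z c by auto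
    thus ?thesis unfolding sum_distrib_left[symmetric] by simp
  qed
  finally show ?thesis using M0 by (rule power2_le_imp_le)
qed

text \<open>Let t be the square of \<open>\<sigma> (l - 1)\<close>. While \<alpha> <= t / 2, every
  factor from index l - 1 on is at most t - \<alpha> in absolute value, so S <= t - \<alpha> and the
  mean of S and \<alpha> is again at most t / 2.\<close>

lemma shift_bounds:
  assumes "c \<le> p"
  shows "0 \<le> \<alpha> (Suc c) \<and> \<alpha> (Suc c) \<le> (\<sigma> (l - 1))\<^sup>2 / 2"
  using assms
proof (induction c)
  case 0
  thus ?case using run0(4) by simp
next
  case (Suc c)
  hence IH: "0 \<le> \<alpha> (Suc c)" "\<alpha> (Suc c) \<le> (\<sigma> (l - 1))\<^sup>2 / 2" by auto
  have c: "Suc c \<in> {1..p}" using Suc by auto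
  have "S (Suc c) \<le> (\<sigma> (l - 1))\<^sup>2 - \<alpha> (Suc c)"
  proof (rule S_le[OF c])
    fix i assume "l - 1 \<le> i"
    hence "(\<sigma> i)\<^sup>2 \<le> (\<sigma> (l - 1))\<^sup>2" using \<sigma>_dec \<sigma>_nonneg by (intro power_mono) auto
    moreover have "(\<sigma> i)\<^sup>2 \<ge> 0" by simp
    ultimately show "\<bar>(\<sigma> i)\<^sup>2 - \<alpha> (Suc c)\<bar> \<le> (\<sigma> (l - 1))\<^sup>2 - \<alpha> (Suc c)" using IH by linarith
  qed
  thus ?case using run_shift[OF c] S_nonneg[OF c] IH by auto
qed

lemma shift_bounds':
  assumes "c \<in> {1..p}"
  shows "0 \<le> \<alpha> c" "\<alpha> c \<le> (\<sigma> (l - 1))\<^sup>2 / 2"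
  using shift_bounds[of "c - 1"] assms by auto

text \<open>The matrix Q times its transpose projects orthogonally onto the range of Q, so the error
  at x is at most the distance of A x from any vector of that range. One approximant z per unit
  vector x suffices.\<close>

lemma spec_norm_le:
  assumes B: "B \<ge> 0"
    and ex: "\<And>x. (\<Sum>i<n. (cv i x)\<^sup>2) = 1 \<Longrightarrow> \<exists>z. (\<Sum>i<m. (\<sigma> i * cv i x - cu i (Qv p z))\<^sup>2) \<le> B\<^sup>2"
  shows "spec_norm (Q p * transpose_mat (Q p) * A - A) \<le> B"
proof -
  let ?P = "Q p * transpose_mat (Q p)"
  have Qp: "Q p \<in> carrier_mat m l" by (rule Q_carrier) simp
  have PA: "?P * A - A \<in> carrier_mat m n" using Qp A by auto
  have le: "vnorm ((?P * A - A) *\<^sub>v x) \<le> B" if x: "x \<in> carrier_vec n" and x1: "vnorm x = 1" for x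
  proof -
    define f where "f t = x $ t" for t
    have "(\<Sum>t<n. (f t)\<^sup>2) = 1"
      using x x1 by (simp add: vnorm_def scalar_prod_sum[OF x] f_def power2_eq_square)
    hence "(\<Sum>i<n. (cv i f)\<^sup>2) = 1" by (simp only: cv_parseval[symmetric])
    from ex[OF this] obtain z where z: "(\<Sum>i<m. (\<sigma> i * cv i f - cu i (Qv p z))\<^sup>2) \<le> B\<^sup>2" by blast
    define y where "y r = (\<Sum>t<n. a r t * f t)" for r
    define q where "q b = (\<Sum>r<m. Q p $$ (r, b) * y r)" for b
    have Qq: "(\<Sum>r<m. Qv p w r * y r) = (\<Sum>b<l. w b * q b)" for w
      unfolding Qv_def q_def sum_distrib_left sum_distrib_right by (subst sum.swap) (simp only: mult_ac)
    have dist: "(\<Sum>r<m. (Qv p w r - y r)\<^sup>2) = (\<Sum>b<l. (w b)\<^sup>2) - 2 * (\<Sum>b<l. w b * q b) + (\<Sum>r<m. (y r)\<^sup>2)" for w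
    proof -
      have "(\<Sum>r<m. (Qv p w r - y r)\<^sup>2) = (\<Sum>r<m. Qv p w r * Qv p w r) - 2 * (\<Sum>r<m. Qv p w r * y r) + (\<Sum>r<m. (y r)\<^sup>2)"
        unfolding power2_diff sum.distrib sum_subtractf sum_distrib_left by (simp only: power2_eq_square mult.assoc)
      thus ?thesis unfolding Qq using Qv_inner[of p w w] by (simp add: power2_eq_square)
    qed
    \<comment> \<open>Completing the square: the coordinates q minimise the distance from y to the
      range.\<close>
    have "(\<Sum>b<l. (z b - q b)\<^sup>2) \<ge> 0" by (simp add: sum_nonneg)
    hence "(\<Sum>b<l. (z b)\<^sup>2) - 2 * (\<Sum>b<l. z b * q b) \<ge> - (\<Sum>b<l. (q b)\<^sup>2)"
      by (simp add: power2_diff sum.distrib sum_subtractf sum_distrib_left mult.assoc)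
    hence "(\<Sum>r<m. (Qv p q r - y r)\<^sup>2) \<le> (\<Sum>r<m. (Qv p z r - y r)\<^sup>2)"
      unfolding dist by (simp add: power2_eq_square)
    also have "\<dots> = (\<Sum>i<m. (cu i (\<lambda>r. Qv p z r - y r))\<^sup>2)" by (rule cu_parseval)
    also have "\<dots> = (\<Sum>i<m. (\<sigma> i * cv i f - cu i (Qv p z))\<^sup>2)"
    proof (intro sum.cong refl)
      fix i assume "i \<in> {..<m}"
      hence "cu i y = \<sigma> i * cv i f" using cu_apply[of i f] by (simp add: y_def[abs_def])
      moreover have "cu i (\<lambda>r. Qv p z r - y r) = cu i (Qv p z) - cu i y"
        by (simp add: cu_def right_diff_distrib sum_subtractf)
      ultimately show "(cu i (\<lambda>r. Qv p z r - y r))\<^sup>2 = (\<sigma> i * cv i f - cu i (Qv p z))\<^sup>2"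
        by (simp add: power2_commute)
    qed
    also note z
    finally have le1: "(\<Sum>r<m. (Qv p q r - y r)\<^sup>2) \<le> B\<^sup>2" .
    have ent: "((?P * A - A) *\<^sub>v x) $ r = Qv p q r - y r" if r: "r < m" for r
    proof -
      have Ax: "(A *\<^sub>v x) $ r = y r" if "r < m" for r
        using A x aA that by (simp add: y_def f_def scalar_prod_def atLeast0LessThan)
      have QTAx: "(transpose_mat (Q p) *\<^sub>v (A *\<^sub>v x)) $ b = q b" if "b < l" for b
        using Qp A x Ax that by (simp add: q_def scalar_prod_def atLeast0LessThan)
      have "(?P * A - A) *\<^sub>v x = Q p *\<^sub>v (transpose_mat (Q p) *\<^sub>v (A *\<^sub>v x)) - A *\<^sub>v x"
      proof -
        have "(?P * A - A) *\<^sub>v x = (?P * A) *\<^sub>v x - A *\<^sub>v x"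
          by (rule minus_mult_distrib_mat_vec[of _ m n]) (use Qp A x in auto)
        also have "(?P * A) *\<^sub>v x = ?P *\<^sub>v (A *\<^sub>v x)"
          by (rule assoc_mult_mat_vec[of _ m m _ n]) (use Qp A x in auto)
        also have "\<dots> = Q p *\<^sub>v (transpose_mat (Q p) *\<^sub>v (A *\<^sub>v x))"
          by (rule assoc_mult_mat_vec[of _ m l _ m]) (use Qp A x in auto)
        finally show ?thesis .
      qed
      thus ?thesis using Qp A x r Ax QTAx
        by (simp add: Qv_def scalar_prod_def atLeast0LessThan)
    qed
    have "vnorm ((?P * A - A) *\<^sub>v x) = sqrt (\<Sum>r<m. (Qv p q r - y r)\<^sup>2)"
    proof -
      have cv: "(?P * A - A) *\<^sub>v x \<in> carrier_vec m" using PA x by auto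
      show ?thesis unfolding vnorm_def scalar_prod_sum[OF cv]
        using ent by (simp add: power2_eq_square)
    qed
    also have "\<dots> \<le> B" using le1 B by (simp add: real_le_lsqrt sum_nonneg)
    finally show ?thesis .
  qed
  have n0: "n > 0" using l(2,3) by linarith
  show ?thesis unfolding spec_norm_def
  proof (rule cSup_least)
    show "{vnorm ((?P * A - A) *\<^sub>v x) |x. x \<in> carrier_vec (dim_col (?P * A - A)) \<and> vnorm x = 1} \<noteq> {}"
      using n0 A by (auto intro!: exI[of _ "unit_vec n 0"] simp: vnorm_def)
  qed (use le A in auto)
qed

end

section \<open>Approximation error of the computed subspace\<close>

lemma square_system_solvable:
  fixes g :: "nat \<Rightarrow> nat \<Rightarrow> real"
  assumes inj: "\<And>z b. (\<And>i. i < k \<Longrightarrow> (\<Sum>b<k. g i b * z b) = 0) \<Longrightarrow> b < k \<Longrightarrow> z b = 0"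
  shows "\<exists>z. \<forall>i<k. (\<Sum>b<k. g i b * z b) = w i"
proof -
  define G where "G = mat k k (\<lambda>(i, b). g i b)"
  have G: "G \<in> carrier_mat k k" by (simp add: G_def)
  have Gx: "(G *\<^sub>v x) $ i = (\<Sum>b<k. g i b * x $ b)" if "x \<in> carrier_vec k" "i < k" for x i
    using that by (simp add: G_def scalar_prod_def atLeast0LessThan)
  have det: "det G \<noteq> 0"
  proof
    assume "det G = 0"
    then obtain x where x: "x \<in> carrier_vec k" "x \<noteq> 0\<^sub>v k" "G *\<^sub>v x = 0\<^sub>v k"
      using det_0_iff_vec_prod_zero_field[OF G] by blast
    have z: "(\<Sum>b<k. g i b * x $ b) = 0" if "i < k" for i
      using Gx[OF x(1) that] that unfolding x(3) by simp
    have "x = 0\<^sub>v k"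
    proof (rule eq_vecI)
      fix b assume "b < dim_vec (0\<^sub>v k :: real vec)"
      hence "b < k" by simp
      thus "x $ b = 0\<^sub>v k $ b" using inj[of "\<lambda>b. x $ b" b] z by simp
    qed (use x in auto)
    thus False using x by simp
  qed
  define y where "y = Matrix.vec k (\<lambda>i. w i / det G)"
  define x where "x = adj_mat G *\<^sub>v y"
  have y: "y \<in> carrier_vec k" by (simp add: y_def)
  have x: "x \<in> carrier_vec k" unfolding x_def using adj_mat(1)[OF G] y by auto
  have "G *\<^sub>v x = (G * adj_mat G) *\<^sub>v y"
    unfolding x_def by (rule assoc_mult_mat_vec[symmetric, of _ k k _ k]) (use adj_mat(1)[OF G] G y in auto)
  also have "\<dots> = det G \<cdot>\<^sub>v y" unfolding adj_mat(2)[OF G]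
    using y by (intro eq_vecI) (auto simp: row_smult)
  finally have "(G *\<^sub>v x) $ i = w i" if "i < k" for i using that det by (simp add: y_def)
  thus ?thesis using Gx[OF x] by (intro exI[of _ "\<lambda>b. x $ b"]) auto
qed

text \<open>Young's inequality (a - b)^2 <= (1 + K) a^2 + (1 + 1 / K) b^2. The weight K gives both
  terms the common factor 1 + K, so the masses of a and t can be added before they are bounded by 1,
  and a factor 2 is avoided.\<close>

lemma sum_square_diff_le:
  fixes a b :: "'a \<Rightarrow> real"
  assumes I: "finite I" and K: "0 \<le> K" and b: "(\<Sum>i\<in>I. (b i)\<^sup>2) \<le> K * t" and t: "0 \<le> t"
  shows "(\<Sum>i\<in>I. (a i - b i)\<^sup>2) \<le> (1 + K) * ((\<Sum>i\<in>I. (a i)\<^sup>2) + t)"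
proof (cases "K = 0")
  case True
  hence "(\<Sum>i\<in>I. (b i)\<^sup>2) = 0" using b sum_nonneg[of I "\<lambda>i. (b i)\<^sup>2"] by auto
  hence "\<forall>i\<in>I. b i = 0" using I by (simp add: sum_nonneg_eq_0_iff)
  hence "(\<Sum>i\<in>I. (a i - b i)\<^sup>2) = (\<Sum>i\<in>I. (a i)\<^sup>2)" by (intro sum.cong) auto
  thus ?thesis using True t by simp
next
  case False
  hence K0: "K > 0" using K by simp
  have 1: "(a i - b i)\<^sup>2 \<le> (1 + K) * (a i)\<^sup>2 + (1 + 1 / K) * (b i)\<^sup>2" for i
  proof -
    have "(1 + K) * (a i)\<^sup>2 + (1 + 1 / K) * (b i)\<^sup>2 - (a i - b i)\<^sup>2 = (K * a i + b i)\<^sup>2 / K"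
      using K0 by (simp add: power2_eq_square field_simps)
    moreover have "(K * a i + b i)\<^sup>2 / K \<ge> 0" using K0 by simp
    ultimately show ?thesis by linarith
  qed
  have "(\<Sum>i\<in>I. (a i - b i)\<^sup>2) \<le> (\<Sum>i\<in>I. (1 + K) * (a i)\<^sup>2 + (1 + 1 / K) * (b i)\<^sup>2)"
    by (rule sum_mono) (rule 1)
  also have "\<dots> = (1 + K) * (\<Sum>i\<in>I. (a i)\<^sup>2) + (1 + 1 / K) * (\<Sum>i\<in>I. (b i)\<^sup>2)"
    by (simp only: sum.distrib sum_distrib_left)
  also have "\<dots> \<le> (1 + K) * (\<Sum>i\<in>I. (a i)\<^sup>2) + (1 + 1 / K) * (K * t)"
    using b K0 by (intro add_left_mono mult_left_mono) auto
  also have "(1 + 1 / K) * (K * t) = (1 + K) * t" using K0 by (simp add: field_simps)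
  finally show ?thesis by (simp add: distrib_left)
qed

text \<open>The subtracted term carries the induction; the plain bound 6 / 5 is not
  inductive.\<close>

lemma prod_near_one:
  "(\<Prod>c=1..p. (1 + (1/16) ^ c) / (1 - (1/16) ^ c)) \<le> (6/5 - (1/16) ^ p / 5 :: real)"
proof (induction p)
  case (Suc p)
  define x :: real where "x = (1/16) ^ Suc p"
  have xp: "(1/16 :: real) ^ p = 16 * x" by (simp add: x_def)
  have x0: "0 < x" by (simp add: x_def)
  have x1: "x < 1" unfolding x_def by (rule power_Suc_less_one) auto
  have "(\<Prod>c=1..Suc p. (1 + (1/16) ^ c) / (1 - (1/16) ^ c)) =
      (\<Prod>c=1..p. (1 + (1/16) ^ c) / (1 - (1/16) ^ c)) * ((1 + x) / (1 - x))"
    unfolding x_def by (simp add: prod.nat_ivl_Suc' mult.commute del: power_Suc)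
  also have "\<dots> \<le> (6/5 - 16 * x / 5) * ((1 + x) / (1 - x))"
    using Suc x0 x1 unfolding xp by (intro mult_right_mono) auto
  also have "\<dots> \<le> 6/5 - x / 5"
  proof -
    have "(6/5 - 16 * x / 5) * (1 + x) \<le> (6/5 - x / 5) * (1 - x)"
    proof -
      have "(6/5 - x / 5) * (1 - x) - (6/5 - 16 * x / 5) * (1 + x) = 3/5 * x + 17/5 * (x * x)"
 
        by (simp add: field_simps)
      moreover have "x * x \<ge> 0" by simp
      ultimately show ?thesis using x0 by linarith
    qed
    thus ?thesis using x1 by (simp add: pos_divide_le_eq)
  qed
  finally show ?case unfolding x_def .
qed simp

locale alg2_gap = alg2_data +
  fixes j :: nat
  assumes j: "0 < j" "j < k" and kn: "2 * k + s \<le> n"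
begin

definition f :: "nat \<Rightarrow> real" where
  "f i = (\<Prod>c=1..p. (\<sigma> i)\<^sup>2 - \<alpha> c)"

lemma k_less_n: "k < n" using j kn by linarith

lemma k_le_l: "k \<le> l" using l(1) by simp

lemma factor_pos:
  assumes "i < l" "c \<in> {1..p}"
  shows "0 < (\<sigma> i)\<^sup>2 - \<alpha> c"
proof -
  have "(\<sigma> (l - 1))\<^sup>2 \<le> (\<sigma> i)\<^sup>2" using \<sigma>_dec[of i "l - 1"] assms \<sigma>_nonneg by (intro power_mono) auto
  moreover have "0 < (\<sigma> (l - 1))\<^sup>2" using \<sigma>_pos by simp
  ultimately show ?thesis using shift_bounds'[OF assms(2)] by linarith
qed

lemma f_pos: "i < l \<Longrightarrow> 0 < f i"
  unfolding f_def using factor_pos by (intro prod_pos) auto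

lemma f_dec:
  assumes "i \<le> i'" "i' < l"
  shows "f i' \<le> f i"
  unfolding f_def
proof (rule prod_mono)
  fix c assume c: "c \<in> {1..p}"
  have "(\<sigma> i')\<^sup>2 \<le> (\<sigma> i)\<^sup>2" using \<sigma>_dec[OF assms(1)] \<sigma>_nonneg by (intro power_mono) auto
  thus "0 \<le> (\<sigma> i')\<^sup>2 - \<alpha> c \<and> (\<sigma> i')\<^sup>2 - \<alpha> c \<le> (\<sigma> i)\<^sup>2 - \<alpha> c" using factor_pos[OF assms(2) c] by simp
qed

lemma start_power: "\<exists>z. \<forall>i<m. cu i (Qv p z) = f i * (\<sigma> i * cv i (Omv h))"
proof -
  obtain z0 where z0: "\<forall>i<m. cu i (Qv 0 z0) = \<sigma> i * cv i (Omv h)" using start by blast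
  obtain z where z: "\<forall>i<m. cu i (Qv p z) = (\<Prod>b\<in>{0<..p}. (\<sigma> i)\<^sup>2 - \<alpha> b) * cu i (Qv 0 z0)"
    using power_steps[of 0 p z0] by auto
  have "{0<..p} = {1..p}" by auto
  thus ?thesis using z z0 unfolding f_def by (intro exI[of _ z]) auto
qed

lemma split_sum:
  fixes F :: "nat \<Rightarrow> real"
  shows "(\<Sum>i<n. F i) = (\<Sum>i<j. F i) + (\<Sum>i=j..<k. F i) + (\<Sum>i=k..<n. F i)"
    and "(\<Sum>i<m. F i) = (\<Sum>i<n. F i) + (\<Sum>i=n..<m. F i)"
  using sum.atLeastLessThan_concat[of 0 j k F] sum.atLeastLessThan_concat[of 0 k n F]
    sum.atLeastLessThan_concat[of 0 n m F] j k_less_n nm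
  by (auto simp: lessThan_atLeast0)

text \<open>The i-th coordinate of the approximant is f i * \<sigma> i * cv i (Omv h), so the choice
  e i = cv i x / f i matches A x in the first j directions. Since F = f (j - 1) is the smallest
  leading filter value, the squared norm of e is at most T / F^2. C measures by how much the filter
  on the tail can exceed its value at k.\<close>

lemma matching_error:
  assumes event: "\<And>e. \<exists>h. (\<forall>i<j. cv i (Omv h) = e i) \<and>
      (\<Sum>i=j..<k. (cv i (Omv h))\<^sup>2) \<le> K2 * (\<Sum>i<j. (e i)\<^sup>2) \<and>
      (\<Sum>i=k..<n. (cv i (Omv h))\<^sup>2) \<le> K3 * (\<Sum>i<j. (e i)\<^sup>2)"
    and K: "0 \<le> K2" "0 \<le> K3"
    and C: "\<And>i. k \<le> i \<Longrightarrow> i < n \<Longrightarrow> \<bar>f i\<bar> \<le> C * \<bar>f k\<bar>"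
    and x: "(\<Sum>i<n. (cv i x)\<^sup>2) = 1"
  shows "\<exists>z. (\<Sum>i<m. (\<sigma> i * cv i x - cu i (Qv p z))\<^sup>2) \<le>
     (\<sigma> j)\<^sup>2 * (1 + (f j / f (j - 1))\<^sup>2 * K2) + (\<sigma> k)\<^sup>2 * (1 + C\<^sup>2 * (f k / f (j - 1))\<^sup>2 * K3)"
proof -
  define F where "F = f (j - 1)"
  have jl: "j < l" using j k_le_l by simp
  have F: "0 < F" unfolding F_def using f_pos jl by simp
  define e where "e i = cv i x / f i" for i
  obtain h where h: "\<forall>i<j. cv i (Omv h) = e i"
      "(\<Sum>i=j..<k. (cv i (Omv h))\<^sup>2) \<le> K2 * (\<Sum>i<j. (e i)\<^sup>2)"
      "(\<Sum>i=k..<n. (cv i (Omv h))\<^sup>2) \<le> K3 * (\<Sum>i<j. (e i)\<^sup>2)" using event[of e] by blast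
  obtain z where z: "\<forall>i<m. cu i (Qv p z) = f i * (\<sigma> i * cv i (Omv h))" using start_power by blast
  define T where "T = (\<Sum>i<j. (cv i x)\<^sup>2)"
  have T0: "0 \<le> T" unfolding T_def by (simp add: sum_nonneg)
  have eT: "(\<Sum>i<j. (e i)\<^sup>2) \<le> T / F\<^sup>2"
    unfolding T_def sum_divide_distrib
  proof (rule sum_mono)
    fix i assume "i \<in> {..<j}"
    hence "F \<le> f i" unfolding F_def using jl by (intro f_dec) auto
    hence "F\<^sup>2 \<le> (f i)\<^sup>2" using F by (intro power_mono) auto
    moreover have "0 < F\<^sup>2" using F by simp
    ultimately show "(e i)\<^sup>2 \<le> (cv i x)\<^sup>2 / F\<^sup>2"
      unfolding e_def power_divide by (intro divide_left_mono mult_pos_pos) auto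
  qed
  define b where "b i = f i * cv i (Omv h)" for i
  have err: "\<sigma> i * cv i x - cu i (Qv p z) = \<sigma> i * (cv i x - b i)" if "i < m" for i
    using z that unfolding b_def by (simp add: algebra_simps)
  have top: "cv i x - b i = 0" if "i < j" for i
  proof -
    have "f i \<noteq> 0" using f_pos[of i] that jl by simp
    thus ?thesis using h(1) that by (simp add: b_def e_def)
  qed
  have mid: "(\<Sum>i=j..<k. (b i)\<^sup>2) \<le> (f j / F)\<^sup>2 * K2 * T"
  proof -
    have "(\<Sum>i=j..<k. (b i)\<^sup>2) \<le> (\<Sum>i=j..<k. (f j)\<^sup>2 * (cv i (Omv h))\<^sup>2)"
    proof (rule sum_mono)
      fix i assume i: "i \<in> {j..<k}"
      have "f i \<le> f j" "0 < f i" using i k_le_l by (auto intro!: f_dec f_pos)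
      hence "(f i)\<^sup>2 \<le> (f j)\<^sup>2" by (intro power_mono) auto
      thus "(b i)\<^sup>2 \<le> (f j)\<^sup>2 * (cv i (Omv h))\<^sup>2" unfolding b_def power_mult_distrib by (rule mult_right_mono) simp
    qed
    also have "\<dots> \<le> (f j)\<^sup>2 * (K2 * (T / F\<^sup>2))"
      unfolding sum_distrib_left[symmetric]
      by (intro mult_left_mono order_trans[OF h(2)] eT K) auto
    finally show ?thesis by (simp add: power_divide)
  qed
  have tail: "(\<Sum>i=k..<n. (b i)\<^sup>2) \<le> C\<^sup>2 * (f k / F)\<^sup>2 * K3 * T"
  proof -
    have "(\<Sum>i=k..<n. (b i)\<^sup>2) \<le> (\<Sum>i=k..<n. (C\<^sup>2 * (f k)\<^sup>2) * (cv i (Omv h))\<^sup>2)"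
    proof (rule sum_mono)
      fix i assume i: "i \<in> {k..<n}"
      have "\<bar>f i\<bar>\<^sup>2 \<le> (C * \<bar>f k\<bar>)\<^sup>2" using C[of i] i by (intro power_mono) auto
      hence "(f i)\<^sup>2 \<le> C\<^sup>2 * (f k)\<^sup>2" by (simp add: power_mult_distrib)
      thus "(b i)\<^sup>2 \<le> (C\<^sup>2 * (f k)\<^sup>2) * (cv i (Omv h))\<^sup>2"
        unfolding b_def power_mult_distrib by (rule mult_right_mono) simp
    qed
    also have "\<dots> \<le> (C\<^sup>2 * (f k)\<^sup>2) * (K3 * (T / F\<^sup>2))"
      unfolding sum_distrib_left[symmetric]
      by (intro mult_left_mono order_trans[OF h(3)] eT K) auto
    finally show ?thesis by (simp add: power_divide)
  qed
  \<comment> \<open>The leading mass T is charged to the middle block and to the tail block; both X2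
    + T and X3 + T are at most 1.\<close>
  define X2 where "X2 = (\<Sum>i=j..<k. (cv i x)\<^sup>2)"
  define X3 where "X3 = (\<Sum>i=k..<n. (cv i x)\<^sup>2)"
  have X: "T + X2 + X3 = 1" using split_sum(1)[of "\<lambda>i. (cv i x)\<^sup>2"] x by (simp add: T_def X2_def X3_def)
  have Xn: "0 \<le> X2" "0 \<le> X3" by (simp_all add: X2_def X3_def sum_nonneg)
  let ?E = "\<lambda>i. (\<sigma> i * (cv i x - b i))\<^sup>2"
  have "(\<Sum>i<m. (\<sigma> i * cv i x - cu i (Qv p z))\<^sup>2) = (\<Sum>i<m. ?E i)"
    using err by (intro sum.cong) auto
  also have "\<dots> = (\<Sum>i=j..<k. ?E i) + (\<Sum>i=k..<n. ?E i)"
  proof -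
    have "(\<Sum>i<j. ?E i) = 0" using top by simp
    moreover have "(\<Sum>i=n..<m. ?E i) = 0" using \<sigma>_zero by simp
    ultimately show ?thesis using split_sum[of ?E] by linarith
  qed
  also have "(\<Sum>i=j..<k. ?E i) \<le> (\<sigma> j)\<^sup>2 * (1 + (f j / F)\<^sup>2 * K2)"
  proof -
    have "(\<Sum>i=j..<k. ?E i) \<le> (\<Sum>i=j..<k. (\<sigma> j)\<^sup>2 * (cv i x - b i)\<^sup>2)"
      unfolding power_mult_distrib using \<sigma>_nonneg \<sigma>_dec by (intro sum_mono mult_right_mono power_mono) auto
    also have "\<dots> = (\<sigma> j)\<^sup>2 * (\<Sum>i=j..<k. (cv i x - b i)\<^sup>2)" by (simp only: sum_distrib_left)
    also have "\<dots> \<le> (\<sigma> j)\<^sup>2 * ((1 + (f j / F)\<^sup>2 * K2) * (X2 + T))"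
      unfolding X2_def using mid K T0 by (intro mult_left_mono sum_square_diff_le) auto
    also have "\<dots> \<le> (\<sigma> j)\<^sup>2 * ((1 + (f j / F)\<^sup>2 * K2) * 1)"
      using X Xn T0 K by (intro mult_left_mono) auto
    finally show ?thesis by simp
  qed
  also have "(\<Sum>i=k..<n. ?E i) \<le> (\<sigma> k)\<^sup>2 * (1 + C\<^sup>2 * (f k / F)\<^sup>2 * K3)"
  proof -
    have "(\<Sum>i=k..<n. ?E i) \<le> (\<Sum>i=k..<n. (\<sigma> k)\<^sup>2 * (cv i x - b i)\<^sup>2)"
      unfolding power_mult_distrib using \<sigma>_nonneg \<sigma>_dec by (intro sum_mono mult_right_mono power_mono) auto
    also have "\<dots> = (\<sigma> k)\<^sup>2 * (\<Sum>i=k..<n. (cv i x - b i)\<^sup>2)" by (simp only: sum_distrib_left)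
    also have "\<dots> \<le> (\<sigma> k)\<^sup>2 * ((1 + C\<^sup>2 * (f k / F)\<^sup>2 * K3) * (X3 + T))"
      unfolding X3_def using tail K T0 by (intro mult_left_mono sum_square_diff_le) auto
    also have "\<dots> \<le> (\<sigma> k)\<^sup>2 * ((1 + C\<^sup>2 * (f k / F)\<^sup>2 * K3) * 1)"
      using X Xn T0 K by (intro mult_left_mono) auto
    finally show ?thesis by simp
  qed
  finally show ?thesis unfolding F_def by (intro exI[of _ z]) simp
qed

text \<open>For s > 0 index k lies below l, so all shifts are at most half of
  \<open>(\<sigma> k)\<^sup>2\<close> and no tail factor exceeds the one at k. For \<sigma> k = 0
  all tail factors coincide.\<close>

lemma filter_tail_trivial:
  assumes "s \<noteq> 0 \<or> \<sigma> k = 0" and i: "k \<le> i"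
  shows "\<bar>f i\<bar> \<le> \<bar>f k\<bar>"
proof (cases "\<sigma> k = 0")
  case True
  hence "\<sigma> i = 0" using \<sigma>_dec[OF i] \<sigma>_nonneg[of i] by simp
  thus ?thesis using True by (simp add: f_def)
next
  case False
  hence "k < l" using assms l(1) by simp
  hence "(\<sigma> (l - 1))\<^sup>2 \<le> (\<sigma> k)\<^sup>2" using \<sigma>_dec[of k "l - 1"] \<sigma>_nonneg by (intro power_mono) auto
  hence \<alpha>: "\<alpha> c \<le> (\<sigma> k)\<^sup>2 / 2" if "c \<in> {1..p}" for c using shift_bounds'[OF that] by simp
  have "(\<sigma> i)\<^sup>2 \<le> (\<sigma> k)\<^sup>2" using \<sigma>_dec[OF i] \<sigma>_nonneg by (intro power_mono) auto
  moreover have "0 \<le> (\<sigma> i)\<^sup>2" by simp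
  ultimately have "\<bar>(\<sigma> i)\<^sup>2 - \<alpha> c\<bar> \<le> \<bar>(\<sigma> k)\<^sup>2 - \<alpha> c\<bar>" if "c \<in> {1..p}" for c
    using \<alpha>[OF that] by linarith
  thus ?thesis unfolding f_def abs_prod by (intro prod_mono) auto
qed

text \<open>For s = 0 the shifts are only bounded by half of the k-th squared singular value, so they may
  exceed the (k+1)-st one and the filter need not be largest at index k among the tail. Let \<open>\<mu> c\<close> be the
  largest possible tail factor in step c. If every S c is barely larger than \<open>\<mu> c\<close>, the shifts stay close to
  half of the (k+1)-st squared singular value and the filter loses at most a factor 6/5. If some S c is
  larger, then after step c the tail of each vector in the range is controlled by its first k
  coordinates, and the dominant modes can be matched there without using the Gaussian matrix.\<close>

definition \<mu> :: "nat \<Rightarrow> real" where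
  "\<mu> c = max ((\<sigma> k)\<^sup>2 - \<alpha> c) (\<alpha> c)"

lemma \<mu>_bound:
  assumes "c \<in> {1..p}" "k \<le> i"
  shows "\<bar>(\<sigma> i)\<^sup>2 - \<alpha> c\<bar> \<le> \<mu> c"
proof -
  have "(\<sigma> i)\<^sup>2 \<le> (\<sigma> k)\<^sup>2" using \<sigma>_dec[OF assms(2)] \<sigma>_nonneg by (intro power_mono) auto
  moreover have "0 \<le> (\<sigma> i)\<^sup>2" by simp
  ultimately show ?thesis unfolding \<mu>_def by linarith
qed

text \<open>The shift of step c exceeds N / 2 by a relative amount of at most 16^(-(p + 1 - c)).
  This tolerance grows by the factor 16 per step, more than one update can add, and is still only 1
  / 16 in step p. The resulting ratios (1 + e) / (1 - e) multiply to at most 6 / 5.\<close>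

lemma filter_tail_small_shift:
  assumes small: "\<And>c. c \<in> {1..<p} \<Longrightarrow> (S c)\<^sup>2 < (\<mu> c)\<^sup>2 * (1 + (1/16) ^ (p - c))"
    and \<nu>: "0 < \<sigma> k" and i: "k \<le> i"
  shows "\<bar>f i\<bar> \<le> 6/5 * \<bar>f k\<bar>"
proof -
  define N where "N = (\<sigma> k)\<^sup>2"
  have N: "0 < N" using \<nu> by (simp add: N_def)
  have shift: "\<alpha> (Suc c) \<le> N / 2 * (1 + (1/16) ^ (p - c))" if "c < p" for c
    using that
  proof (induction c)
    case 0
    have "0 \<le> N / 2 * (1 + (1/16) ^ p)" using N by (intro mult_nonneg_nonneg) auto
    thus ?case using run0(4) by simp
  next
    case (Suc c)
    define d where "d = (1/16 :: real) ^ (p - Suc c)"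
    have c: "Suc c \<in> {1..p}" "Suc c \<in> {1..<p}" using Suc by auto
    obtain q where q: "p - Suc c = Suc q" using Suc.prems by (metis Suc_diff_Suc)
    have d0: "0 < d" by (simp add: d_def)
    have d1: "d \<le> 1/16" unfolding d_def q by (simp add: power_le_one)
    have pc: "p - c = Suc (p - Suc c)" using Suc.prems by simp
    have "\<alpha> (Suc c) \<le> N / 2 * (1 + (1/16) ^ (p - c))" using Suc by simp
    hence IH: "\<alpha> (Suc c) \<le> N / 2 * (1 + d / 16)" unfolding pc d_def by simp
    have a0: "0 \<le> \<alpha> (Suc c)" using shift_bounds'[OF c(1)] by simp
    have Nd: "0 < N * d" using N d0 by simp
    have Ndd: "N * (d * d) \<le> N * d" using N d0 d1 by (intro mult_left_mono) (auto simp: mult_le_cancel_right1)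
    have IH': "\<alpha> (Suc c) \<le> N / 2 + N * d / 32" using IH by (simp add: algebra_simps)
    have m0: "0 \<le> \<mu> (Suc c)" using a0 by (simp add: \<mu>_def)
    have "(S (Suc c))\<^sup>2 \<le> (\<mu> (Suc c))\<^sup>2 * (1 + d)" using small[OF c(2)] unfolding d_def by simp
    also have "\<dots> \<le> (\<mu> (Suc c))\<^sup>2 * (1 + d / 2)\<^sup>2"
    proof (rule mult_left_mono)
      have "(1 + d / 2)\<^sup>2 = 1 + d + (d / 2)\<^sup>2" by (simp add: power2_sum)
      thus "1 + d \<le> (1 + d / 2)\<^sup>2" by simp
    qed simp
    also have "\<dots> = (\<mu> (Suc c) * (1 + d / 2))\<^sup>2" by (simp only: power_mult_distrib)
    finally have Sle: "S (Suc c) \<le> \<mu> (Suc c) * (1 + d / 2)"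
      using m0 d0 by (elim power2_le_imp_le) auto
    \<comment> \<open>The maximum in \<mu> decides: if it is \<alpha>, averaging moves the shift
      only by \<alpha> d / 4; otherwise the mean of N - \<alpha> and \<alpha> is N / 2 up to a term
      in d.\<close>
    have "(\<mu> (Suc c) * (1 + d / 2) + \<alpha> (Suc c)) / 2 \<le> N / 2 + N * d / 2"
    proof (cases "\<mu> (Suc c) = \<alpha> (Suc c)")
      case True
      have "\<alpha> (Suc c) * d \<le> (N / 2 * (1 + d / 16)) * d" using IH d0 by (intro mult_right_mono) auto
      also have "\<dots> = N * d / 2 + N * (d * d) / 32" by (simp add: algebra_simps)
      finally have "\<alpha> (Suc c) * d \<le> N * d / 2 + N * (d * d) / 32" .
      moreover have "(\<mu> (Suc c) * (1 + d / 2) + \<alpha> (Suc c)) / 2 = \<alpha> (Suc c) + \<alpha> (Suc c) * d / 4"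
        unfolding True by (simp add: algebra_simps)
      ultimately show ?thesis using IH' Ndd Nd by linarith
    next
      case False
      hence mu: "\<mu> (Suc c) = N - \<alpha> (Suc c)" unfolding \<mu>_def N_def max_def by (auto split: if_splits)
      have "(\<mu> (Suc c) * (1 + d / 2) + \<alpha> (Suc c)) / 2 = N / 2 + N * d / 4 - \<alpha> (Suc c) * d / 4"
        unfolding mu by (simp add: field_simps)
      moreover have "0 \<le> \<alpha> (Suc c) * d" using a0 d0 by simp
      ultimately show ?thesis using Nd by linarith
    qed
    moreover have "\<alpha> (Suc c) \<le> N / 2 + N * d / 2" using IH' Nd by linarith
    ultimately have "\<alpha> (Suc (Suc c)) \<le> N / 2 + N * d / 2"
      using run_shift[OF c(1)] Sle by (auto split: if_splits)
    thus ?case unfolding d_def[symmetric] by (simp add: algebra_simps)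
  qed
  define e where "e c = (1/16 :: real) ^ (p + 1 - c)" for c
  have e01: "0 < e c" "e c < 1" if "c \<in> {1..p}" for c
  proof -
    show "0 < e c" by (simp add: e_def)
    have "p + 1 - c = Suc (p - c)" using that by auto
    thus "e c < 1" unfolding e_def using power_Suc_less_one[of "1/16 :: real" "p - c"] by simp
  qed
  have ratio: "\<bar>(\<sigma> i)\<^sup>2 - \<alpha> c\<bar> \<le> (1 + e c) / (1 - e c) * \<bar>(\<sigma> k)\<^sup>2 - \<alpha> c\<bar>" if c: "c \<in> {1..p}" for c
  proof -
    have al: "\<alpha> c \<le> N / 2 * (1 + e c)"
      using shift[of "c - 1"] c unfolding e_def by auto
    have ge: "N / 2 * (1 - e c) \<le> N - \<alpha> c" using al by (simp add: field_simps)
    have pos: "0 \<le> N / 2 * (1 - e c)" using N e01[OF c] by simp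
    have one: "1 \<le> (1 + e c) / (1 - e c)" using e01[OF c] by (simp add: field_simps)
    have "\<alpha> c \<le> (1 + e c) / (1 - e c) * (N / 2 * (1 - e c))" using al e01[OF c] by (simp add: mult.commute)
    also have "\<dots> \<le> (1 + e c) / (1 - e c) * (N - \<alpha> c)" using one by (intro mult_left_mono ge) simp
    finally have 1: "\<alpha> c \<le> (1 + e c) / (1 - e c) * (N - \<alpha> c)" .
    have "1 * (N - \<alpha> c) \<le> (1 + e c) / (1 - e c) * (N - \<alpha> c)"
      using one ge pos by (intro mult_right_mono) auto
    hence "\<mu> c \<le> (1 + e c) / (1 - e c) * (N - \<alpha> c)" using 1 unfolding \<mu>_def N_def by simp
    thus ?thesis using \<mu>_bound[OF c i] ge pos unfolding N_def by simp
  qed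
  have "\<bar>f i\<bar> \<le> (\<Prod>c=1..p. (1 + e c) / (1 - e c) * \<bar>(\<sigma> k)\<^sup>2 - \<alpha> c\<bar>)"
    unfolding f_def abs_prod using ratio by (intro prod_mono) auto
  also have "\<dots> = (\<Prod>c=1..p. (1 + e c) / (1 - e c)) * \<bar>f k\<bar>"
    unfolding f_def abs_prod prod.distrib ..
  also have "(\<Prod>c=1..p. (1 + e c) / (1 - e c)) = (\<Prod>c=1..p. (1 + (1/16) ^ c) / (1 - (1/16) ^ c))"
    unfolding e_def by (subst prod.atLeastAtMost_rev) simp
  also have "\<dots> * \<bar>f k\<bar> \<le> 6/5 * \<bar>f k\<bar>"
  proof (rule mult_right_mono)
    have "0 \<le> (1/16 :: real) ^ p / 5" by simp
    thus "(\<Prod>c=1..p. (1 + (1/16) ^ c) / (1 - (1/16) ^ c)) \<le> (6/5 :: real)"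
      using prod_near_one[of p] by linarith
  qed simp
  finally show ?thesis .
qed

text \<open>S c bounds the growth of every z from below, \<mu> c bounds the growth of the tail from
  above. If S c is larger by the factor 1 + e in squares, the tail alone cannot account for the
  norm, and the first k coordinates must carry the rest.\<close>

lemma large_shift_tail:
  assumes c: "c \<in> {1..p}" and e: "0 \<le> e"
    and large: "(\<mu> c)\<^sup>2 * (1 + e) \<le> (S c)\<^sup>2"
  shows "e * (\<Sum>i=k..<m. (((\<sigma> i)\<^sup>2 - \<alpha> c) * cu i (Qv (c - 1) z))\<^sup>2)
      \<le> (\<Sum>i<k. (((\<sigma> i)\<^sup>2 - \<alpha> c) * cu i (Qv (c - 1) z))\<^sup>2)"
proof -
  define y where "y i = ((\<sigma> i)\<^sup>2 - \<alpha> c) * cu i (Qv (c - 1) z)" for i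
  define T where "T = (\<Sum>i=k..<m. (cu i (Qv (c - 1) z))\<^sup>2)"
  define B where "B = (\<Sum>i=k..<m. (y i)\<^sup>2)"
  have km: "k \<le> m" using k_less_n nm by simp
  have split: "(\<Sum>i<m. F i) = (\<Sum>i<k. F i) + (\<Sum>i=k..<m. F i)" for F :: "nat \<Rightarrow> real"
    using sum.atLeastLessThan_concat[of 0 k m F] km by (simp add: lessThan_atLeast0)
  have B: "B \<le> (\<mu> c)\<^sup>2 * T"
    unfolding B_def T_def sum_distrib_left y_def power_mult_distrib
  proof (intro sum_mono mult_right_mono)
    fix i assume "i \<in> {k..<m}"
    hence "\<bar>(\<sigma> i)\<^sup>2 - \<alpha> c\<bar> \<le> \<mu> c" by (intro \<mu>_bound[OF c]) simp
    hence "\<bar>(\<sigma> i)\<^sup>2 - \<alpha> c\<bar>\<^sup>2 \<le> (\<mu> c)\<^sup>2" by (rule power_mono) simp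
    thus "((\<sigma> i)\<^sup>2 - \<alpha> c)\<^sup>2 \<le> (\<mu> c)\<^sup>2" by simp
  qed simp
  have "(1 + e) * B \<le> (1 + e) * ((\<mu> c)\<^sup>2 * T)" using B e by (intro mult_left_mono) auto
  also have "\<dots> = ((\<mu> c)\<^sup>2 * (1 + e)) * T" by simp
  also have "\<dots> \<le> (S c)\<^sup>2 * T" by (intro mult_right_mono large) (simp add: T_def sum_nonneg)
  also have "\<dots> \<le> (S c)\<^sup>2 * (\<Sum>b<l. (z b)\<^sup>2)"
  proof (rule mult_left_mono)
    have "c - 1 \<le> p" using c by auto
    from Qv_norm[OF this, of z] have "(\<Sum>b<l. (z b)\<^sup>2) = (\<Sum>i<k. (cu i (Qv (c - 1) z))\<^sup>2) + T"
      unfolding T_def split by simp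
    thus "T \<le> (\<Sum>b<l. (z b)\<^sup>2)" by (simp add: sum_nonneg)
  qed simp
  also have "\<dots> \<le> (\<Sum>i<m. (y i)\<^sup>2)" unfolding y_def by (rule S_le_norm[OF c])
  also have "\<dots> = (\<Sum>i<k. (y i)\<^sup>2) + B" unfolding split B_def ..
  finally have "e * B \<le> (\<Sum>i<k. (y i)\<^sup>2)" by (simp add: distrib_right)
  thus ?thesis unfolding B_def y_def .
qed

text \<open>For s = 0 there are as many unknowns as prescribed coordinates, so injectivity suffices.
  If the first k coordinates vanish, so does the filtered tail by \<open>large_shift_tail\<close>,
  and S c > 0 forces z = 0.\<close>

lemma large_shift_solvable:
  assumes c: "c \<in> {1..p}" and \<nu>: "0 < \<sigma> k" and e: "0 < e" and s0: "s = 0"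
    and large: "(\<mu> c)\<^sup>2 * (1 + e) \<le> (S c)\<^sup>2"
  shows "\<exists>z. \<forall>i<k. cu i (Qv (c - 1) z) = w i"
proof -
  have lk: "l = k" using s0 l by simp
  define g where "g i b = (\<Sum>q<m. u i q * Q (c - 1) $$ (q, b))" for i b
  have cu_g: "cu i (Qv (c - 1) z) = (\<Sum>b<k. g i b * z b)" for i z
    unfolding cu_Qv g_def by (simp add: lk)
  have "\<exists>z. \<forall>i<k. (\<Sum>b<k. g i b * z b) = w i"
  proof (rule square_system_solvable)
    fix z b assume z: "\<And>i. i < k \<Longrightarrow> (\<Sum>b<k. g i b * z b) = 0" and b: "b < k"
    have cu0: "cu i (Qv (c - 1) z) = 0" if "i < k" for i
      using z[OF that] unfolding cu_g .
    define Y where "Y = (\<Sum>i=k..<m. (((\<sigma> i)\<^sup>2 - \<alpha> c) * cu i (Qv (c - 1) z))\<^sup>2)"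
    have "e * Y \<le> 0" using large_shift_tail[OF c less_imp_le[OF e] large, of z] cu0 by (simp add: Y_def)
    hence Y: "Y \<le> 0" using e by (simp add: mult_le_0_iff)
    have km: "k \<le> m" using k_less_n nm by simp
    have "(\<Sum>i<m. (((\<sigma> i)\<^sup>2 - \<alpha> c) * cu i (Qv (c - 1) z))\<^sup>2)
        = (\<Sum>i<k. (((\<sigma> i)\<^sup>2 - \<alpha> c) * cu i (Qv (c - 1) z))\<^sup>2) + Y"
      unfolding Y_def lessThan_atLeast0 using km by (subst sum.atLeastLessThan_concat) auto
    hence "(S c)\<^sup>2 * (\<Sum>b<l. (z b)\<^sup>2) \<le> 0" using S_le_norm[OF c, of z] cu0 Y by simp
    moreover have "0 < (S c)\<^sup>2"
    proof -
      have "0 < (\<sigma> k)\<^sup>2" using \<nu> by simp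
      hence "0 < \<mu> c" unfolding \<mu>_def by linarith
      hence "0 < (\<mu> c)\<^sup>2 * (1 + e)" using e by simp
      thus ?thesis using large by linarith
    qed
    ultimately have "(\<Sum>b<l. (z b)\<^sup>2) \<le> 0" by (simp add: mult_le_0_iff)
    hence "(\<Sum>b<l. (z b)\<^sup>2) = 0" using sum_nonneg[of "{..<l}" "\<lambda>b. (z b)\<^sup>2"] by auto
    hence "\<forall>b\<in>{..<l}. (z b)\<^sup>2 = 0" by (subst (asm) sum_nonneg_eq_0_iff) auto
    thus "z b = 0" using b lk by auto
  qed
  thus ?thesis unfolding cu_g .
qed

text \<open>Subtracting \<alpha> b from both terms of a fraction that is at most 1 does not increase
  it. So each step damps the tail relative to coordinate i at least by the squared ratio of
  \<open>\<sigma> (k - 1)\<close> to \<open>\<sigma> i\<close>.\<close>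

lemma shift_contraction:
  assumes s0: "s = 0" and b: "b \<in> {1..p}" and i: "i < k"
  shows "\<mu> b * (\<sigma> i)\<^sup>2 \<le> (\<sigma> (k - 1))\<^sup>2 * ((\<sigma> i)\<^sup>2 - \<alpha> b)"
proof -
  have lk: "l = k" using s0 l by simp
  note al = shift_bounds'[OF b, unfolded lk]
  have "(\<sigma> k)\<^sup>2 \<le> (\<sigma> (k - 1))\<^sup>2" using \<sigma>_dec[of "k - 1" k] \<sigma>_nonneg by (intro power_mono) auto
  hence mu: "\<mu> b \<le> (\<sigma> (k - 1))\<^sup>2 - \<alpha> b" unfolding \<mu>_def using al by simp
  have "(\<sigma> (k - 1))\<^sup>2 \<le> (\<sigma> i)\<^sup>2" using \<sigma>_dec[of i "k - 1"] \<sigma>_nonneg i by (intro power_mono) auto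
  hence "\<alpha> b * (\<sigma> (k - 1))\<^sup>2 \<le> \<alpha> b * (\<sigma> i)\<^sup>2" using al by (intro mult_left_mono) auto
  moreover have "\<mu> b * (\<sigma> i)\<^sup>2 \<le> ((\<sigma> (k - 1))\<^sup>2 - \<alpha> b) * (\<sigma> i)\<^sup>2" using mu by (rule mult_right_mono) simp
  ultimately show ?thesis by (simp add: algebra_simps)
qed

text \<open>After step c the first k coordinates can be prescribed, with a tail at most 16^q times
  as large in squares, q = p - c. In directions with \<sigma> i > 2 * \<sigma> j each of the q
  remaining steps damps the tail by a factor below 1 / 4, that is 1 / 16 in squares, which pays for
  this; hence the base 16. The other directions are left unmatched.\<close>

lemma large_shift_error:
  assumes s0: "s = 0" and c: "c \<in> {1..<p}" and \<nu>: "0 < \<sigma> k"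
    and large: "(\<mu> c)\<^sup>2 * (1 + (1/16) ^ (p - c)) \<le> (S c)\<^sup>2"
    and x: "(\<Sum>i<n. (cv i x)\<^sup>2) = 1"
  shows "\<exists>z. (\<Sum>i<m. (\<sigma> i * cv i x - cu i (Qv p z))\<^sup>2) \<le> 4 * (\<sigma> j)\<^sup>2 + (\<sigma> k)\<^sup>2"
proof -
  have c1: "c \<in> {1..p}" using c by simp
  have lk: "l = k" using s0 l by simp
  have km: "k \<le> m" using k_less_n nm by simp
  define g where "g i = (\<Prod>b\<in>{c<..p}. (\<sigma> i)\<^sup>2 - \<alpha> b)" for i
  have gpos: "0 < g i" if "i < k" for i
    unfolding g_def using factor_pos[of i] that c lk by (intro prod_pos) auto
  \<comment> \<open>Leading directions below this threshold contribute at most 4 times the square of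
    \<sigma> j to the squared error, which is what the summand 1 next to the first product in the
    claimed bound provides.\<close>
  define big where "big i \<longleftrightarrow> 2 * \<sigma> j < \<sigma> i" for i
  define w where "w i = (if big i then \<sigma> i * cv i x / g i / ((\<sigma> i)\<^sup>2 - \<alpha> c) else 0)" for i
  have e0: "(0 :: real) < (1/16) ^ (p - c)" by simp
  obtain z0 where z0: "\<forall>i<k. cu i (Qv (c - 1) z0) = w i"
    using large_shift_solvable[OF c1 \<nu> e0 s0 large, of w] by blast
  define y where "y i = ((\<sigma> i)\<^sup>2 - \<alpha> c) * cu i (Qv (c - 1) z0)" for i
  obtain z1 where z1: "\<forall>i<m. cu i (Qv c z1) = y i" using power_step[OF c1, of z0] unfolding y_def by blast
  have cp: "c \<le> p" using c by simp
  obtain z where z: "\<forall>i<m. cu i (Qv p z) = g i * cu i (Qv c z1)"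
    using power_steps[OF cp order_refl, of z1] unfolding g_def by blast
  have yi: "y i = (if big i then \<sigma> i * cv i x / g i else 0)" if "i < k" for i
    using z0 factor_pos[of i c] that lk c1 unfolding y_def w_def by simp
  have head: "(\<Sum>i<k. (\<sigma> i * cv i x - g i * y i)\<^sup>2) \<le> 4 * (\<sigma> j)\<^sup>2 * (\<Sum>i<k. if big i then 0 else (cv i x)\<^sup>2)"
    unfolding sum_distrib_left
  proof (rule sum_mono)
    fix i assume "i \<in> {..<k}"
    hence i: "i < k" by simp
    show "(\<sigma> i * cv i x - g i * y i)\<^sup>2 \<le> 4 * (\<sigma> j)\<^sup>2 * (if big i then 0 else (cv i x)\<^sup>2)"
    proof (cases "big i")
      case True
      thus ?thesis using yi[OF i] gpos[OF i] by simp
    next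
      case False
      hence "(\<sigma> i)\<^sup>2 \<le> (2 * \<sigma> j)\<^sup>2" unfolding big_def using \<sigma>_nonneg by (intro power_mono) auto
      hence "(\<sigma> i)\<^sup>2 * (cv i x)\<^sup>2 \<le> (2 * \<sigma> j)\<^sup>2 * (cv i x)\<^sup>2" by (rule mult_right_mono) simp
      thus ?thesis using yi[OF i] False by (simp add: power_mult_distrib)
    qed
  qed
  define Xb where "Xb = (\<Sum>i<k. if big i then (cv i x)\<^sup>2 else 0)"
  define Xs where "Xs = (\<Sum>i<k. if big i then 0 else (cv i x)\<^sup>2)"
  define Xt where "Xt = (\<Sum>i=k..<n. (cv i x)\<^sup>2)"
  have Xn: "0 \<le> Xb" "0 \<le> Xs" "0 \<le> Xt" unfolding Xb_def Xs_def Xt_def by (auto intro!: sum_nonneg)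
  have X: "Xb + Xs + Xt = 1"
  proof -
    have "Xb + Xs = (\<Sum>i<k. (cv i x)\<^sup>2)"
      unfolding Xb_def Xs_def sum.distrib[symmetric] by (intro sum.cong) auto
    moreover have "(\<Sum>i<n. (cv i x)\<^sup>2) = (\<Sum>i<k. (cv i x)\<^sup>2) + Xt"
      unfolding Xt_def lessThan_atLeast0 using k_less_n by (subst sum.atLeastLessThan_concat) auto
    ultimately show ?thesis using x by simp
  qed
  define G where "G = (\<Prod>b\<in>{c<..p}. \<mu> b)"
  define q where "q = p - c"
  have q: "0 < q" "card {c<..p} = q" using c by (auto simp: q_def)
  have gG: "\<bar>g i\<bar> \<le> G" if "k \<le> i" for i
    unfolding g_def G_def abs_prod using that c by (intro prod_mono conjI \<mu>_bound) auto
  have G0: "0 \<le> G" using gG[of k] by linarith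
  have damp: "(4 ^ q * G * y i)\<^sup>2 \<le> 4 * (\<sigma> j)\<^sup>2 * (if big i then (cv i x)\<^sup>2 else 0)" if i: "i < k" for i
  proof (cases "big i")
    case True
    have sj: "\<sigma> (k - 1) \<le> \<sigma> j" using \<sigma>_dec[of j "k - 1"] j by simp
    have si: "2 * \<sigma> (k - 1) \<le> \<sigma> i" "0 < \<sigma> i"
      using True sj \<sigma>_nonneg[of j] unfolding big_def by linarith+
    define \<rho> where "\<rho> = 4 * (\<sigma> (k - 1))\<^sup>2 / (\<sigma> i)\<^sup>2"
    have "(2 * \<sigma> (k - 1))\<^sup>2 \<le> (\<sigma> i)\<^sup>2" using si \<sigma>_nonneg by (intro power_mono) auto
    hence \<rho>1: "\<rho> \<le> 1" using si unfolding \<rho>_def by (simp add: power_mult_distrib)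
    have \<rho>0: "0 \<le> \<rho>" unfolding \<rho>_def by simp
    have "4 ^ q * G = (\<Prod>b\<in>{c<..p}. 4 * \<mu> b)"
      unfolding G_def prod.distrib using q by simp
    also have "\<dots> \<le> (\<Prod>b\<in>{c<..p}. \<rho> * ((\<sigma> i)\<^sup>2 - \<alpha> b))"
    proof (rule prod_mono)
      fix b assume "b \<in> {c<..p}"
      hence b: "b \<in> {1..p}" using c by auto
      have "0 \<le> \<mu> b" using \<mu>_bound[OF b order_refl] by linarith
      moreover have "\<mu> b * (\<sigma> i)\<^sup>2 \<le> (\<sigma> (k - 1))\<^sup>2 * ((\<sigma> i)\<^sup>2 - \<alpha> b)" by (rule shift_contraction[OF s0 b i])
      ultimately show "0 \<le> 4 * \<mu> b \<and> 4 * \<mu> b \<le> \<rho> * ((\<sigma> i)\<^sup>2 - \<alpha> b)"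
        using si unfolding \<rho>_def by (simp add: pos_le_divide_eq)
    qed
    also have "\<dots> = \<rho> ^ q * g i" unfolding g_def prod.distrib using q by simp
    \<comment> \<open>One of the q factors \<rho> is kept, which needs c < p: it later reduces
      \<sigma> i to at most 2 * \<sigma> j. The others are bounded by 1.\<close>
    also have "\<dots> \<le> \<rho> ^ 1 * g i"
      using \<rho>0 \<rho>1 q gpos[OF i] by (intro mult_right_mono power_decreasing) auto
    finally have le: "4 ^ q * G \<le> \<rho> * g i" by simp
    have "\<bar>4 ^ q * G * y i\<bar> = (4 ^ q * G / g i) * (\<sigma> i * \<bar>cv i x\<bar>)"
      using yi[OF i] True gpos[OF i] G0 si by (simp add: abs_mult)
    also have "\<dots> \<le> \<rho> * (\<sigma> i * \<bar>cv i x\<bar>)"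
      using le gpos[OF i] si by (intro mult_right_mono) (auto simp: pos_divide_le_eq)
    also have "\<dots> = (2 * \<sigma> (k - 1)) * (2 * \<sigma> (k - 1)) / \<sigma> i * \<bar>cv i x\<bar>"
      using si unfolding \<rho>_def by (simp add: power2_eq_square)
    also have "\<dots> \<le> (2 * \<sigma> j) * \<bar>cv i x\<bar>"
    proof (rule mult_right_mono)
      have "(2 * \<sigma> (k - 1)) * (2 * \<sigma> (k - 1)) \<le> (2 * \<sigma> j) * \<sigma> i"
        using sj si(1) \<sigma>_nonneg by (intro mult_mono) auto
      thus "(2 * \<sigma> (k - 1)) * (2 * \<sigma> (k - 1)) / \<sigma> i \<le> 2 * \<sigma> j" using si by (simp add: pos_divide_le_eq)
    qed simp
    finally have "\<bar>4 ^ q * G * y i\<bar>\<^sup>2 \<le> ((2 * \<sigma> j) * \<bar>cv i x\<bar>)\<^sup>2" by (intro power_mono) auto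
    thus ?thesis using True by (simp add: power_mult_distrib)
  next
    case False
    thus ?thesis using yi[OF i] by simp
  qed
  have tailb: "(\<Sum>i=k..<m. (g i * y i)\<^sup>2) \<le> 4 * (\<sigma> j)\<^sup>2 * Xb"
  proof -
    have "(\<Sum>i=k..<m. (g i * y i)\<^sup>2) \<le> (\<Sum>i=k..<m. G\<^sup>2 * (y i)\<^sup>2)"
    proof (rule sum_mono)
      fix i assume "i \<in> {k..<m}"
      hence "\<bar>g i\<bar>\<^sup>2 \<le> G\<^sup>2" using gG by (intro power_mono) auto
      thus "(g i * y i)\<^sup>2 \<le> G\<^sup>2 * (y i)\<^sup>2" unfolding power_mult_distrib by (intro mult_right_mono) auto
    qed
    also have "\<dots> = G\<^sup>2 * (\<Sum>i=k..<m. (y i)\<^sup>2)" by (simp only: sum_distrib_left)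
    also have "\<dots> \<le> G\<^sup>2 * (16 ^ q * (\<Sum>i<k. (y i)\<^sup>2))"
    proof (rule mult_left_mono)
      have "(1/16) ^ q * (\<Sum>i=k..<m. (y i)\<^sup>2) \<le> (\<Sum>i<k. (y i)\<^sup>2)"
        using large_shift_tail[OF c1 less_imp_le[OF e0] large, of z0] unfolding y_def q_def .
      hence "16 ^ q * ((1/16) ^ q * (\<Sum>i=k..<m. (y i)\<^sup>2)) \<le> 16 ^ q * (\<Sum>i<k. (y i)\<^sup>2)"
        by (rule mult_left_mono) simp
      moreover have "(16 :: real) ^ q * (1/16) ^ q = 1" by (simp add: power_mult_distrib[symmetric])
      ultimately show "(\<Sum>i=k..<m. (y i)\<^sup>2) \<le> 16 ^ q * (\<Sum>i<k. (y i)\<^sup>2)"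
        by (simp add: mult.assoc[symmetric])
    qed simp
    also have "\<dots> = (\<Sum>i<k. (4 ^ q * G * y i)\<^sup>2)"
    proof -
      have sq: "(16 :: real) ^ q = (4 ^ q)\<^sup>2" by (simp add: power2_eq_square power_mult_distrib[symmetric])
      show ?thesis unfolding sq sum_distrib_left power_mult_distrib by (simp only: mult_ac)
    qed
    also have "\<dots> \<le> (\<Sum>i<k. 4 * (\<sigma> j)\<^sup>2 * (if big i then (cv i x)\<^sup>2 else 0))"
      by (rule sum_mono) (rule damp, simp)
    also have "\<dots> = 4 * (\<sigma> j)\<^sup>2 * Xb" unfolding Xb_def by (simp only: sum_distrib_left)
    finally show ?thesis .
  qed
  have taila: "(\<Sum>i=k..<m. (\<sigma> i * cv i x)\<^sup>2) \<le> (\<sigma> k)\<^sup>2 * Xt"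
  proof -
    have "(\<Sum>i=k..<m. (\<sigma> i * cv i x)\<^sup>2) = (\<Sum>i=k..<n. (\<sigma> i * cv i x)\<^sup>2)"
      using nm \<sigma>_zero by (intro sum.mono_neutral_right) auto
    also have "\<dots> \<le> (\<sigma> k)\<^sup>2 * Xt"
      unfolding Xt_def sum_distrib_left power_mult_distrib using \<sigma>_dec \<sigma>_nonneg
      by (intro sum_mono mult_right_mono power_mono) auto
    finally show ?thesis .
  qed
  \<comment> \<open>Chosen so that the tail of the approximant has the form required by
    \<open>sum_square_diff_le\<close> with t = \<open>(\<sigma> k)\<^sup>2 * Xb\<close>; the factor
    1 + K then adds 4 times the square of \<sigma> j to that of \<sigma> k.\<close>
  define K where "K = 4 * (\<sigma> j)\<^sup>2 / (\<sigma> k)\<^sup>2"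
  have K0: "0 \<le> K" unfolding K_def by simp
  have Kk: "K * (\<sigma> k)\<^sup>2 = 4 * (\<sigma> j)\<^sup>2" unfolding K_def using \<nu> by simp
  have "(\<Sum>i=k..<m. (g i * y i)\<^sup>2) \<le> K * ((\<sigma> k)\<^sup>2 * Xb)"
    using tailb unfolding Kk[symmetric] by (simp only: mult.assoc)
  hence "(\<Sum>i=k..<m. (\<sigma> i * cv i x - g i * y i)\<^sup>2) \<le> (1 + K) * ((\<Sum>i=k..<m. (\<sigma> i * cv i x)\<^sup>2) + (\<sigma> k)\<^sup>2 * Xb)"
    using K0 Xn by (intro sum_square_diff_le) auto
  also have "\<dots> \<le> (1 + K) * ((\<sigma> k)\<^sup>2 * Xt + (\<sigma> k)\<^sup>2 * Xb)" using K0 taila by (intro mult_left_mono) auto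
  also have "\<dots> = ((\<sigma> k)\<^sup>2 + K * (\<sigma> k)\<^sup>2) * (Xt + Xb)" by (simp add: algebra_simps)
  finally have tl: "(\<Sum>i=k..<m. (\<sigma> i * cv i x - g i * y i)\<^sup>2) \<le> ((\<sigma> k)\<^sup>2 + 4 * (\<sigma> j)\<^sup>2) * (Xt + Xb)"
    unfolding Kk .
  have "(\<Sum>i<m. (\<sigma> i * cv i x - cu i (Qv p z))\<^sup>2) = (\<Sum>i<m. (\<sigma> i * cv i x - g i * y i)\<^sup>2)"
    using z z1 by (intro sum.cong) auto
  also have "\<dots> = (\<Sum>i<k. (\<sigma> i * cv i x - g i * y i)\<^sup>2) + (\<Sum>i=k..<m. (\<sigma> i * cv i x - g i * y i)\<^sup>2)"
    unfolding lessThan_atLeast0 using km by (subst sum.atLeastLessThan_concat) auto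
  also have "\<dots> \<le> 4 * (\<sigma> j)\<^sup>2 * Xs + ((\<sigma> k)\<^sup>2 + 4 * (\<sigma> j)\<^sup>2) * (Xt + Xb)"
    using head tl unfolding Xs_def[symmetric] by linarith
  also have "\<dots> \<le> ((\<sigma> k)\<^sup>2 + 4 * (\<sigma> j)\<^sup>2) * Xs + ((\<sigma> k)\<^sup>2 + 4 * (\<sigma> j)\<^sup>2) * (Xt + Xb)"
    using Xn by (intro add_right_mono mult_right_mono) auto
  also have "\<dots> = ((\<sigma> k)\<^sup>2 + 4 * (\<sigma> j)\<^sup>2) * (Xb + Xs + Xt)" by (simp only: distrib_left add_ac)
  finally show ?thesis unfolding X by (intro exI[of _ z]) (simp add: add.commute)
qed

text \<open>The squared bound is four times the sum of R, T and the squares of \<sigma> j and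
  \<sigma> k. The middle block spends 4 R. The tail block spends C^2 * (8 / 3) * T, at most 4 T
  since C is 1 or 6 / 5 and 36 / 25 <= 3 / 2. If some S c is large, the squares of \<sigma> j and
  \<sigma> k alone cover the error.\<close>

lemma error_bound:
  assumes \<kappa>: "0 \<le> \<kappa>"
    and event: "\<And>e. \<exists>h. (\<forall>i<j. cv i (Omv h) = e i) \<and>
      (\<Sum>i=j..<k. (cv i (Omv h))\<^sup>2) \<le> 8 * (real l)\<^sup>2 * \<kappa> * (\<Sum>i<j. (e i)\<^sup>2) \<and>
      (\<Sum>i=k..<n. (cv i (Omv h))\<^sup>2) \<le> 16/3 * real l * real (n - k) * \<kappa> * (\<Sum>i<j. (e i)\<^sup>2)"
  shows "spec_norm (Q p * transpose_mat (Q p) * A - A) \<le>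
    2 * sqrt ((2 * (real l)\<^sup>2 * \<kappa> * (f j / f (j - 1))\<^sup>2 + 1) * (\<sigma> j)\<^sup>2
      + (2 * real l * real (n - k) * \<kappa> * (f k / f (j - 1))\<^sup>2 + 1) * (\<sigma> k)\<^sup>2)" (is "_ \<le> 2 * sqrt ?b")
proof (rule spec_norm_le)
  define R where "R = 2 * (real l)\<^sup>2 * \<kappa> * (f j / f (j - 1))\<^sup>2 * (\<sigma> j)\<^sup>2"
  define T where "T = 2 * real l * real (n - k) * \<kappa> * (f k / f (j - 1))\<^sup>2 * (\<sigma> k)\<^sup>2"
  have R: "0 \<le> R" and T: "0 \<le> T" unfolding R_def T_def using \<kappa> by (intro mult_nonneg_nonneg; simp)+
  have b: "?b = R + (\<sigma> j)\<^sup>2 + (T + (\<sigma> k)\<^sup>2)" unfolding R_def T_def by (simp only: distrib_right mult_1)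
  define sj sk where "sj = (\<sigma> j)\<^sup>2" and "sk = (\<sigma> k)\<^sup>2"
  have s: "0 \<le> sj" "0 \<le> sk" by (simp_all add: sj_def sk_def)
  have b0: "0 \<le> ?b" unfolding b using R T by simp
  have B2: "(2 * sqrt ?b)\<^sup>2 = 4 * R + 4 * (\<sigma> j)\<^sup>2 + 4 * T + 4 * (\<sigma> k)\<^sup>2"
    unfolding power_mult_distrib real_sqrt_pow2[OF b0] unfolding b by (simp add: distrib_left)
  show "0 \<le> 2 * sqrt ?b" using b0 by simp
  fix x assume x: "(\<Sum>i<n. (cv i x)\<^sup>2) = 1"
  have matched: "\<exists>z. (\<Sum>i<m. (\<sigma> i * cv i x - cu i (Qv p z))\<^sup>2) \<le> 4 * R + 4 * (\<sigma> j)\<^sup>2 + 4 * T + 4 * (\<sigma> k)\<^sup>2"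
    if C: "\<And>i. k \<le> i \<Longrightarrow> i < n \<Longrightarrow> \<bar>f i\<bar> \<le> C * \<bar>f k\<bar>" and C2: "C\<^sup>2 \<le> 3/2" for C
  proof -
    obtain z where z: "(\<Sum>i<m. (\<sigma> i * cv i x - cu i (Qv p z))\<^sup>2) \<le>
     (\<sigma> j)\<^sup>2 * (1 + (f j / f (j - 1))\<^sup>2 * (8 * (real l)\<^sup>2 * \<kappa>)) +
     (\<sigma> k)\<^sup>2 * (1 + C\<^sup>2 * (f k / f (j - 1))\<^sup>2 * (16/3 * real l * real (n - k) * \<kappa>))"
      using matching_error[OF event _ _ C x] \<kappa> by auto
    have e1: "(\<sigma> j)\<^sup>2 * (1 + (f j / f (j - 1))\<^sup>2 * (8 * (real l)\<^sup>2 * \<kappa>)) = (\<sigma> j)\<^sup>2 + 4 * R"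
      unfolding R_def by (simp add: algebra_simps)
    have e2: "(\<sigma> k)\<^sup>2 * (1 + C\<^sup>2 * (f k / f (j - 1))\<^sup>2 * (16/3 * real l * real (n - k) * \<kappa>))
        = (\<sigma> k)\<^sup>2 + C\<^sup>2 * (8/3 * T)"
      unfolding T_def by (simp add: algebra_simps)
    define P where "P = C\<^sup>2 * (8/3 * T)"
    have "P \<le> 3/2 * (8/3 * T)" unfolding P_def using C2 T by (intro mult_right_mono) auto
    also have "3/2 * (8/3 * T) = 4 * T" by simp
    finally have "(\<sigma> j)\<^sup>2 + 4 * R + ((\<sigma> k)\<^sup>2 + P) \<le> 4 * R + 4 * (\<sigma> j)\<^sup>2 + 4 * T + 4 * (\<sigma> k)\<^sup>2"
      unfolding sj_def[symmetric] sk_def[symmetric] using s by linarith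
    thus ?thesis using order_trans[OF z[unfolded e1 e2, folded P_def]] by blast
  qed
  consider "s \<noteq> 0 \<or> \<sigma> k = 0"
    | c where "s = 0" "0 < \<sigma> k" "c \<in> {1..<p}" "(\<mu> c)\<^sup>2 * (1 + (1/16) ^ (p - c)) \<le> (S c)\<^sup>2"
    | "0 < \<sigma> k" "\<forall>c\<in>{1..<p}. (S c)\<^sup>2 < (\<mu> c)\<^sup>2 * (1 + (1/16) ^ (p - c))"
    using \<sigma>_nonneg[of k] by (metis not_less order_le_less)
  thus "\<exists>z. (\<Sum>i<m. (\<sigma> i * cv i x - cu i (Qv p z))\<^sup>2) \<le> (2 * sqrt ?b)\<^sup>2"
    unfolding B2
  proof cases
    case 1
    show "\<exists>z. (\<Sum>i<m. (\<sigma> i * cv i x - cu i (Qv p z))\<^sup>2) \<le> 4 * R + 4 * (\<sigma> j)\<^sup>2 + 4 * T + 4 * (\<sigma> k)\<^sup>2"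
      by (rule matched[of 1]) (use filter_tail_trivial[OF 1] in auto)
  next
    case 2
    obtain z where "(\<Sum>i<m. (\<sigma> i * cv i x - cu i (Qv p z))\<^sup>2) \<le> 4 * (\<sigma> j)\<^sup>2 + (\<sigma> k)\<^sup>2"
      using large_shift_error[OF 2(1,3,2,4) x] by blast
    thus "\<exists>z. (\<Sum>i<m. (\<sigma> i * cv i x - cu i (Qv p z))\<^sup>2) \<le> 4 * R + 4 * (\<sigma> j)\<^sup>2 + 4 * T + 4 * (\<sigma> k)\<^sup>2"
      unfolding sj_def[symmetric] sk_def[symmetric] using s R T by (intro exI[of _ z]) linarith
  next
    case 3
    show "\<exists>z. (\<Sum>i<m. (\<sigma> i * cv i x - cu i (Qv p z))\<^sup>2) \<le> 4 * R + 4 * (\<sigma> j)\<^sup>2 + 4 * T + 4 * (\<sigma> k)\<^sup>2"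
      by (rule matched[of "6/5"]) (use filter_tail_small_shift[OF _ 3(1)] 3(2) in \<open>auto simp: power2_eq_square\<close>)
  qed
qed

end

section \<open>Assembly of the Gaussian event and the deterministic error bound\<close>

lemma gauss_rotate_rows:
  fixes Y :: "nat \<times> nat \<Rightarrow> 'w \<Rightarrow> real"
  assumes M: "prob_space M" and g: "gauss M ({..<n} \<times> {..<l}) Y"
    and v: "\<And>i k. i < n \<Longrightarrow> k < n \<Longrightarrow> (\<Sum>t<n. v i t * v k t) = (if i = k then 1 else 0)"
  shows "gauss M ({..<n} \<times> {..<l}) (\<lambda>p \<omega>. \<Sum>r<n. v (fst p) r * Y (r, snd p) \<omega>)"
proof -
  define c where "c p q = (if snd q = snd p then v (fst p) (fst q) else 0)" for p q :: "nat \<times> nat"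
  have "gauss M ({..<n} \<times> {..<l}) (\<lambda>p \<omega>. \<Sum>q\<in>{..<n} \<times> {..<l}. c p q * Y q \<omega>)"
  proof (rule gauss_rotate[OF M g])
    fix a b assume "a \<in> {..<n} \<times> {..<l}" "b \<in> {..<n} \<times> {..<l}"
    then obtain i t i' t' where ab: "a = (i, t)" "b = (i', t')" "i < n" "t < l" "i' < n" "t' < l" by auto
    have "(\<Sum>q\<in>{..<n} \<times> {..<l}. c a q * c b q) = (\<Sum>r<n. \<Sum>t0<l. c a (r, t0) * c b (r, t0))"
      by (simp add: sum.cartesian_product)
    also have "\<dots> = (\<Sum>r<n. \<Sum>t0<l. if t0 = t then (if t = t' then v i r * v i' r else 0) else 0)"
      unfolding ab c_def by (intro sum.cong refl) auto
    also have "\<dots> = (\<Sum>r<n. if t = t' then v i r * v i' r else 0)" using ab by simp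
    also have "\<dots> = (if a = b then 1 else 0)" using v[OF ab(3,5)] ab by (cases "t = t'") auto
    finally show "(\<Sum>q\<in>{..<n} \<times> {..<l}. c a q * c b q) = (if a = b then 1 else 0)" .
  qed auto
  moreover have "(\<Sum>q\<in>{..<n} \<times> {..<l}. c p q * Y q \<omega>) = (\<Sum>r<n. v (fst p) r * Y (r, snd p) \<omega>)"
    if "p \<in> {..<n} \<times> {..<l}" for p \<omega>
  proof -
    have "(\<Sum>q\<in>{..<n} \<times> {..<l}. c p q * Y q \<omega>) = (\<Sum>r<n. \<Sum>t0<l. c p (r, t0) * Y (r, t0) \<omega>)"
      by (simp add: sum.cartesian_product)
    also have "\<dots> = (\<Sum>r<n. \<Sum>t0<l. if t0 = snd p then v (fst p) r * Y (r, t0) \<omega> else 0)"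
      unfolding c_def by (intro sum.cong refl) auto
    finally show ?thesis using that by auto
  qed
  ultimately show ?thesis by (simp add: gauss_def cong: restrict_cong)
qed

text \<open>E is fixed before Q, \<alpha>, Sh and W are quantified. So on E the bound holds for
  every orthonormalisation and every choice of singular vectors at once, without any question of how
  these depend measurably on the sample point.\<close>

theorem theorem1:
  fixes M :: "'w measure" and Om :: "'w \<Rightarrow> real mat"
    and A :: "real mat" and m n k s p j :: nat and \<beta> \<gamma> :: real
  assumes "prob_space M"
    and Om_dim: "\<forall>\<omega>. Om \<omega> \<in> carrier_mat n (k + s)"
    and Om_indep: "prob_space.indep_vars M (\<lambda>_. borel) (\<lambda>(i, t) \<omega>. Om \<omega> $$ (i, t)) ({0..<n} \<times> {0..<k + s})"
    and Om_gauss: "\<forall>i<n. \<forall>t<k + s. distributed M lborel (\<lambda>\<omega>. Om \<omega> $$ (i, t)) (\<lambda>x. ennreal (std_normal_density x))"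
    and A_dim: "A \<in> carrier_mat m n" and "m \<ge> n"
    and "k + s \<le> n - k"
    and "0 < j" and "j < k"
    and "\<beta> > 1" and "\<gamma> > 1"
    and phi_le: "1 / sqrt (2 * pi * real (k + s - j + 1)) * (exp 1 / (real (k + s - j + 1) * \<beta>)) ^ (k + s - j + 1)
            + 1 / (4 * \<gamma> * (\<gamma>\<^sup>2 - 1)) *
              (1 / sqrt (pi * real (n - k)) * (2 * \<gamma>\<^sup>2 / exp (\<gamma>\<^sup>2 - 1)) ^ (n - k)
               + 1 / sqrt (pi * real (k + s)) * (2 * \<gamma>\<^sup>2 / exp (\<gamma>\<^sup>2 - 1)) ^ (k + s)) \<le> 1"
  shows "\<exists>E \<in> sets M.
     measure M E \<ge> 1 - (1 / sqrt (2 * pi * real (k + s - j + 1)) * (exp 1 / (real (k + s - j + 1) * \<beta>)) ^ (k + s - j + 1)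
            + 1 / (4 * \<gamma> * (\<gamma>\<^sup>2 - 1)) *
              (1 / sqrt (pi * real (n - k)) * (2 * \<gamma>\<^sup>2 / exp (\<gamma>\<^sup>2 - 1)) ^ (n - k)
               + 1 / sqrt (pi * real (k + s)) * (2 * \<gamma>\<^sup>2 / exp (\<gamma>\<^sup>2 - 1)) ^ (k + s))) \<and>
     (\<forall>\<omega>\<in>E. \<forall>Q \<alpha> Sh W. alg2_run A k s p (Om \<omega>) Q \<alpha> Sh W \<longrightarrow>
        spec_norm (Q p * transpose_mat (Q p) * A - A) \<le>
          2 * sqrt ((2 * real (k + s)^2 * \<beta>\<^sup>2 * \<gamma>\<^sup>2 *
                     (\<Prod>c = 1..p. ((sing_val A (j + 1))\<^sup>2 - \<alpha> c) / ((sing_val A j)\<^sup>2 - \<alpha> c)) ^ 2 + 1)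
                    * (sing_val A (j + 1))\<^sup>2
                  + (2 * real (k + s) * real (n - k) * \<beta>\<^sup>2 * \<gamma>\<^sup>2 *
                     (\<Prod>c = 1..p. ((sing_val A (k + 1))\<^sup>2 - \<alpha> c) / ((sing_val A j)\<^sup>2 - \<alpha> c)) ^ 2 + 1)
                    * (sing_val A (k + 1))\<^sup>2))"
proof -
  note M = \<open>prob_space M\<close>
  have dims: "2 * k + s \<le> n" "0 < k + s" "k + s \<le> n" "k < n" "k \<le> k + s"
    using \<open>k + s \<le> n - k\<close> \<open>0 < j\<close> \<open>j < k\<close> by auto
  define a where "a r t = A $$ (r, t)" for r t
  obtain u v \<sigma> where
    u: "\<And>i k. i < m \<Longrightarrow> k < m \<Longrightarrow> (\<Sum>t<m. u i t * u k t) = (if i = k then 1 else 0)"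
    and v: "\<And>i k. i < n \<Longrightarrow> k < n \<Longrightarrow> (\<Sum>t<n. v i t * v k t) = (if i = k then 1 else 0)"
    and \<sigma>: "\<And>i. 0 \<le> \<sigma> i" "\<And>i k. i \<le> k \<Longrightarrow> \<sigma> k \<le> \<sigma> i" "\<And>i. n \<le> i \<Longrightarrow> \<sigma> i = 0"
    and av: "\<And>i s. i < n \<Longrightarrow> s < m \<Longrightarrow> (\<Sum>t<n. a s t * v i t) = \<sigma> i * u i s"
    by (rule svd_exists[OF \<open>m \<ge> n\<close>, of a]) blast
  interpret svd_data m n a u v \<sigma>
    using \<open>m \<ge> n\<close> u v \<sigma> av by unfold_locales
  have sv: "sing_val A (i + 1) = \<sigma> i" if "i < n" for i
    by (rule sing_val_eq[OF A_dim _ that]) (simp add: a_def)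
  have "gauss M ({..<n} \<times> {..<k + s}) (\<lambda>(i, t) \<omega>. Om \<omega> $$ (i, t))"
  proof (rule gauss_indep_vars[OF M])
    show "{..<n} \<times> {..<k + s} \<noteq> {}" using dims by auto
    show "prob_space.indep_vars M (\<lambda>_. borel) (\<lambda>(i, t) \<omega>. Om \<omega> $$ (i, t)) ({..<n} \<times> {..<k + s})"
      using Om_indep by (simp only: lessThan_atLeast0)
  qed (use Om_gauss in auto)
  from gauss_rotate_rows[OF M this v]
  have gX: "gauss M ({..<n} \<times> {..<k + s}) (\<lambda>p \<omega>. \<Sum>r<n. v (fst p) r * Om \<omega> $$ (r, snd p))" by simp
  define X where "X = (\<lambda>p \<omega>. \<Sum>r<n. v (fst p) r * Om \<omega> $$ (r, snd p))"
  obtain E where E: "E \<in> sets M"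
    "1 - 1 / sqrt (2 * pi * real (k + s - j + 1)) * (exp 1 / (real (k + s - j + 1) * \<beta>)) ^ (k + s - j + 1) \<le> measure M E"
    "\<forall>\<omega>\<in>E. \<forall>e. \<exists>h. (\<forall>i<j. (\<Sum>t<k + s. X (i, t) \<omega> * h t) = e i) \<and>
        (\<Sum>i\<in>{j..<k}. (\<Sum>t<k + s. X (i, t) \<omega> * h t)\<^sup>2) \<le> 8 * (real (k + s))\<^sup>2 * \<beta>\<^sup>2 * \<gamma>\<^sup>2 * (\<Sum>i<j. (e i)\<^sup>2) \<and>
        (\<Sum>i\<in>{k..<n}. (\<Sum>t<k + s. X (i, t) \<omega> * h t)\<^sup>2) \<le> 16 / 3 * real (k + s) * real (n - k) * \<beta>\<^sup>2 * \<gamma>\<^sup>2 * (\<Sum>i<j. (e i)\<^sup>2)"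
    using gauss_good_event[OF M gX[folded X_def] \<open>0 < j\<close> \<open>j < k\<close> dims(5) \<open>k + s \<le> n - k\<close> \<open>\<beta> > 1\<close> \<open>\<gamma> > 1\<close> refl] by blast
  have g1: "\<gamma>\<^sup>2 - 1 > 0" using \<open>\<gamma> > 1\<close> by simp
  have "0 \<le> 1 / (4 * \<gamma> * (\<gamma>\<^sup>2 - 1)) *
              (1 / sqrt (pi * real (n - k)) * (2 * \<gamma>\<^sup>2 / exp (\<gamma>\<^sup>2 - 1)) ^ (n - k)
               + 1 / sqrt (pi * real (k + s)) * (2 * \<gamma>\<^sup>2 / exp (\<gamma>\<^sup>2 - 1)) ^ (k + s))"
    using g1 \<open>\<gamma> > 1\<close> by (intro mult_nonneg_nonneg add_nonneg_nonneg divide_nonneg_nonneg zero_le_power) auto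
  hence prob: "measure M E \<ge> 1 - (1 / sqrt (2 * pi * real (k + s - j + 1)) * (exp 1 / (real (k + s - j + 1) * \<beta>)) ^ (k + s - j + 1)
            + 1 / (4 * \<gamma> * (\<gamma>\<^sup>2 - 1)) *
              (1 / sqrt (pi * real (n - k)) * (2 * \<gamma>\<^sup>2 / exp (\<gamma>\<^sup>2 - 1)) ^ (n - k)
               + 1 / sqrt (pi * real (k + s)) * (2 * \<gamma>\<^sup>2 / exp (\<gamma>\<^sup>2 - 1)) ^ (k + s)))"
    using E(2) by linarith
  show ?thesis
  proof (intro bexI[OF _ E(1)] conjI prob ballI allI impI)
    fix \<omega> Q \<alpha> Sh W
    assume \<omega>: "\<omega> \<in> E" and run: "alg2_run A k s p (Om \<omega>) Q \<alpha> Sh W"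
    interpret alg2_gap m n a u v \<sigma> A "Om \<omega>" k s p "k + s" Q Sh W \<alpha> j
      using A_dim Om_dim dims run \<open>0 < j\<close> \<open>j < k\<close> by unfold_locales (auto simp: a_def)
    have cvX: "cv i (Omv h) = (\<Sum>t<k + s. X (i, t) \<omega> * h t)" for i h
      unfolding cv_def Omv_def X_def fst_conv snd_conv sum_distrib_left sum_distrib_right
      by (subst sum.swap) (simp only: mult.assoc)
    have "spec_norm (Q p * transpose_mat (Q p) * A - A) \<le>
      2 * sqrt ((2 * (real (k + s))\<^sup>2 * (\<beta>\<^sup>2 * \<gamma>\<^sup>2) * (f j / f (j - 1))\<^sup>2 + 1) * (\<sigma> j)\<^sup>2
      + (2 * real (k + s) * real (n - k) * (\<beta>\<^sup>2 * \<gamma>\<^sup>2) * (f k / f (j - 1))\<^sup>2 + 1) * (\<sigma> k)\<^sup>2)"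
    proof (rule error_bound)
      fix e
      show "\<exists>h. (\<forall>i<j. cv i (Omv h) = e i) \<and>
        (\<Sum>i=j..<k. (cv i (Omv h))\<^sup>2) \<le> 8 * (real (k + s))\<^sup>2 * (\<beta>\<^sup>2 * \<gamma>\<^sup>2) * (\<Sum>i<j. (e i)\<^sup>2) \<and>
        (\<Sum>i=k..<n. (cv i (Omv h))\<^sup>2) \<le> 16/3 * real (k + s) * real (n - k) * (\<beta>\<^sup>2 * \<gamma>\<^sup>2) * (\<Sum>i<j. (e i)\<^sup>2)"
        unfolding cvX mult.assoc[symmetric] using E(3) \<omega> by blast
    qed simp
    \<comment> \<open>\<open>f (j - 1)\<close> belongs to singular value number j, since \<sigma> is
      indexed from 0 and \<open>sing_val\<close> from 1.\<close>
    moreover have "f i / f (j - 1) = (\<Prod>c = 1..p. ((sing_val A (i + 1))\<^sup>2 - \<alpha> c) / ((sing_val A j)\<^sup>2 - \<alpha> c))"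
      if "i < n" for i
      using sv[OF that] sv[of "j - 1"] \<open>0 < j\<close> \<open>j < k\<close> dims unfolding f_def prod_dividef by simp
    moreover have "\<sigma> j = sing_val A (j + 1)" "\<sigma> k = sing_val A (k + 1)"
      using sv[of j] sv[of k] \<open>j < k\<close> dims by auto
    moreover have "j < n" using \<open>j < k\<close> dims by simp
    ultimately show "spec_norm (Q p * transpose_mat (Q p) * A - A) \<le>
          2 * sqrt ((2 * real (k + s)^2 * \<beta>\<^sup>2 * \<gamma>\<^sup>2 *
                     (\<Prod>c = 1..p. ((sing_val A (j + 1))\<^sup>2 - \<alpha> c) / ((sing_val A j)\<^sup>2 - \<alpha> c)) ^ 2 + 1)
                    * (sing_val A (j + 1))\<^sup>2
                  + (2 * real (k + s) * real (n - k) * \<beta>\<^sup>2 * \<gamma>\<^sup>2 *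
                     (\<Prod>c = 1..p. ((sing_val A (k + 1))\<^sup>2 - \<alpha> c) / ((sing_val A j)\<^sup>2 - \<alpha> c)) ^ 2 + 1)
                    * (sing_val A (k + 1))\<^sup>2)"
      using dims(4) by (simp only: mult.assoc)
  qed
qed

end
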